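(* Let $d\ge 2$ and let $E\subset\mathbb{R}^d$ be measurable with finite measure. (i) If $\limsup_{r\to0^+}\frac{\tilde J^s_r(E)}{\sigma^s(r)}<+\infty$ for some $s\ge1$, then $E$ has finite perimeter. (ii) If $E$ has finite perimeter, then for every $s\ge 1$ $$\omega_{d-1}\mathrm{Per}(E)\le\liminf_{r\to0^+}\frac{\tilde J^s_r(E)}{\sigma^s(r)}\le\limsup_{r\to0^+}\frac{\tilde J^s_r(E)}{\sigma^s(r)}\le M(s,d)\mathrm{Per}(E),$$ where $M(1,d)=\frac{d\omega_d}{2}$ and $M(s,d)=\omega_{d-1}$ for $s>1$. In particular, for $s>1$, $\lim_{r\to0^+}\frac{\tilde J^s_r(E)}{\sigma^s(r)}=\omega_{d-1}\mathrm{Per}(E)$.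
   Context: $k^s_r(t)=r^{-d-s}$ for $0\le t\le r$ and $k^s_r(t)=t^{-d-s}$ for $t>r$; $\tilde J_r^s(E):=\int_E\int_{\mathbb{R}^d\setminus E}k^s_r(|x-y|)\,dy\,dx$. $\sigma^s(r):=|\log r|$ if $s=1$ and $\sigma^s(r):=\frac{d+s}{d+1}\frac{r^{1-s}}{s-1}$ if $s>1$. $\omega_d$ is the volume of the unit ball of $\mathbb{R}^d$ and $\omega_{d-1}$ that of the unit ball of $\mathbb{R}^{d-1}$. *)

theory Defs
  imports "HOL-Analysis.Analysis"
begin

definition kern :: "nat \<Rightarrow> real \<Rightarrow> real \<Rightarrow> real \<Rightarrow> real" where
  "kern d s r t = (if t \<le> r then r powr (- real d - s) else t powr (- real d - s))"

definition Jt :: "real \<Rightarrow> real \<Rightarrow> 'a::euclidean_space set \<Rightarrow> ennreal" where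
  "Jt s r E = (\<integral>\<^sup>+ x. indicator E x *
      (\<integral>\<^sup>+ y. indicator (UNIV - E) y * ennreal (kern DIM('a) s r (dist x y)) \<partial>lebesgue) \<partial>lebesgue)"

definition sigma_s :: "nat \<Rightarrow> real \<Rightarrow> real \<Rightarrow> real" where
  "sigma_s d s r = (if s = 1 then \<bar>ln r\<bar>
     else ((real d + s) / (real d + 1)) * (r powr (1 - s) / (s - 1)))"

abbreviation omega :: "real \<Rightarrow> real" where "omega n \<equiv> unit_ball_vol n"

definition C1c_fields :: "('a::euclidean_space \<Rightarrow> 'a) set" where
  "C1c_fields = {\<phi>. (\<exists>D :: 'a \<Rightarrow> ('a \<Rightarrow>\<^sub>L 'a). continuous_on UNIV D \<and>
        (\<forall>x. (\<phi> has_derivative blinfun_apply (D x)) (at x)))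
      \<and> compact (closure {x. \<phi> x \<noteq> 0})}"

definition divergence :: "('a::euclidean_space \<Rightarrow> 'a) \<Rightarrow> 'a \<Rightarrow> real" where
  "divergence \<phi> x = (\<Sum>i\<in>Basis. frechet_derivative \<phi> (at x) i \<bullet> i)"

definition perimeter :: "'a::euclidean_space set \<Rightarrow> ereal" where
  "perimeter E = (SUP \<phi> \<in> {\<phi> \<in> C1c_fields. \<forall>x. norm (\<phi> x) \<le> 1}.
      ereal (LINT x:E|lebesgue. divergence \<phi> x))"

definition ratio :: "real \<Rightarrow> 'a::euclidean_space set \<Rightarrow> real \<Rightarrow> ereal" where
  "ratio s E r = enn2ereal (Jt s r E) / ereal (sigma_s DIM('a) s r)"

definition Mconst :: "real \<Rightarrow> nat \<Rightarrow> real" where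
  "Mconst s d = (if s = 1 then real d * omega (real d) / 2 else omega (real d - 1))"

end

theory Submission
  imports Defs
begin

text \<open>
  Write \<open>f\<close> for the indicator function of \<open>E\<close> and let \<open>Q(\<rho>)\<close> be the integral of
  \<open>|f(x + h) - f(x)|\<close> over all \<open>x\<close> and all \<open>h\<close> with \<open>|h| \<le> \<rho>\<close>. Decomposing the kernel into indicators
  of balls gives \<open>2 J\<^sub>r(E) = \<integral>\<^bsub>\<rho> \<ge> r\<^esub> (d + s) \<rho>\<^bsup>-d-s-1\<^esup> Q(\<rho>) d\<rho>\<close>, so everything reduces to two facts
  about \<open>Q\<close>. Put \<open>m = 2 \<omega>\<^bsub>d-1\<^esub> / (d + 1)\<close>, so that \<open>\<integral>\<^bsub>|h| \<le> \<rho>\<^esub> |v \<bullet> h| dh = m \<rho>\<^bsup>d+1\<^esup> |v|\<close> for every \<open>v\<close>.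

  Upper bound: \<open>Q(\<rho>) \<le> m \<rho>\<^bsup>d+1\<^esup> Per(E)\<close>. For a mollification \<open>g\<close> of \<open>f\<close> the difference \<open>g(x + h) - g(x)\<close>
  is the integral of \<open>\<nabla>g \<bullet> h\<close> along a segment, and testing with (a cutoff of) the direction of
  \<open>-\<nabla>g\<close> gives \<open>\<integral> |\<nabla>g| \<le> Per(E)\<close>.

  Lower bound: \<open>liminf Q(\<rho>) / \<rho>\<^bsup>d+1\<^esup> \<ge> m Per(E)\<close> as \<open>\<rho> \<rightarrow> 0\<close>. Mollifying does not increase \<open>Q\<close>, and for
  the smooth \<open>g\<close> a first-order Taylor expansion on a ball \<open>B\<close> gives the limit inferior at least
  \<open>m \<integral>\<^sub>B |\<nabla>g|\<close>, which dominates \<open>m \<integral> g div \<phi>\<close> for every admissible field \<open>\<phi>\<close> supported in \<open>B\<close>.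
\<close>

subsection \<open>Invariance of Lebesgue measure and first moments of balls\<close>

text \<open>The normalisation is forced by three factors: the weight \<open>d + s\<close>, the
  constant \<open>m\<close>, and the 2 introduced by symmetrising \<open>J\<close>. Together
  \<open>(d + s) m / 2\<close> equals \<open>omega(d-1) (d + s) / (d + 1)\<close>, multiplied by the
  integral of \<open>\<rho> powr - s\<close> from \<open>r\<close> on. For \<open>s > 1\<close> this
  is exactly \<open>omega(d-1)\<close> times \<open>sigma_s\<close>. At \<open>s = 1\<close> the
  integral also diverges at infinity, so the perimeter estimate serves only up to
  \<open>\<rho> = 1\<close>; beyond that the trivial bound of \<open>Q\<close> by the volume of
  \<open>E\<close> leaves a remainder that is negligible against \<open>|ln r|\<close>. The limits
  in the mollification parameter and in \<open>\<rho>\<close> are never interchanged. The lower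
  bound fixes one mollification before \<open>\<rho>\<close> becomes small; the upper bound fixes
  \<open>\<rho>\<close> and then makes the L1 error of the mollification small. The lower bound does
  not presuppose finite perimeter, so (i) is a corollary: infinite perimeter would force an infinite
  limsup. The upper bound is obtained with \<open>omega(d-1)\<close> at \<open>s = 1\<close> too;
  the constant \<open>M(1,d)\<close> then follows from a comparison of ball volumes.\<close>

lemma borel_measurable_cball [measurable]: "cball (a::'a::euclidean_space) r \<in> sets borel"
  by simp

lemma lborel_distr_translate: "distr lborel borel (\<lambda>x::'a::euclidean_space. c + x) = lborel"
  using lborel_distr_plus[of c] by simp

lemma lborel_distr_reflect: "distr lborel borel (\<lambda>x::'a::euclidean_space. c - x) = lborel"
  using lborel_affine[of "-1" c] by (simp add: density_1)

lemma nn_integral_lborel_translate: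
  fixes f :: "'a::euclidean_space \<Rightarrow> ennreal"
  assumes [measurable]: "f \<in> borel_measurable borel"
  shows "(\<integral>\<^sup>+x. f (c + x) \<partial>lborel) = (\<integral>\<^sup>+x. f x \<partial>lborel)"
proof -
  have "(\<integral>\<^sup>+x. f x \<partial>lborel) = (\<integral>\<^sup>+x. f x \<partial>distr lborel borel (\<lambda>x. c + x))"
    by (simp only: lborel_distr_translate)
  also have "\<dots> = (\<integral>\<^sup>+x. f (c + x) \<partial>lborel)"
    by (rule nn_integral_distr) auto
  finally show ?thesis by simp
qed

lemma nn_integral_lborel_reflect:
  fixes f :: "'a::euclidean_space \<Rightarrow> ennreal"
  assumes [measurable]: "f \<in> borel_measurable borel"
  shows "(\<integral>\<^sup>+x. f (c - x) \<partial>lborel) = (\<integral>\<^sup>+x. f x \<partial>lborel)"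
proof -
  have "(\<integral>\<^sup>+x. f x \<partial>lborel) = (\<integral>\<^sup>+x. f x \<partial>distr lborel borel (\<lambda>x. c - x))"
    by (simp only: lborel_distr_reflect)
  also have "\<dots> = (\<integral>\<^sup>+x. f (c - x) \<partial>lborel)"
    by (rule nn_integral_distr) auto
  finally show ?thesis by simp
qed

lemma integral_lborel_translate:
  fixes f :: "'a::euclidean_space \<Rightarrow> 'b::{banach, second_countable_topology}"
  assumes [measurable]: "f \<in> borel_measurable borel"
  shows "(\<integral>x. f (c + x) \<partial>lborel) = (\<integral>x. f x \<partial>lborel)"
proof -
  have "(\<integral>x. f x \<partial>lborel) = (\<integral>x. f x \<partial>distr lborel borel (\<lambda>x. c + x))"
    by (simp only: lborel_distr_translate)
  also have "\<dots> = (\<integral>x. f (c + x) \<partial>lborel)"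
    by (rule integral_distr) auto
  finally show ?thesis by simp
qed

lemma integral_lborel_reflect:
  fixes f :: "'a::euclidean_space \<Rightarrow> 'b::{banach, second_countable_topology}"
  assumes [measurable]: "f \<in> borel_measurable borel"
  shows "(\<integral>x. f (c - x) \<partial>lborel) = (\<integral>x. f x \<partial>lborel)"
proof -
  have "(\<integral>x. f x \<partial>lborel) = (\<integral>x. f x \<partial>distr lborel borel (\<lambda>x. c - x))"
    by (simp only: lborel_distr_reflect)
  also have "\<dots> = (\<integral>x. f (c - x) \<partial>lborel)"
    by (rule integral_distr) auto
  finally show ?thesis by simp
qed

lemma integrable_lborel_translate:
  fixes f :: "'a::euclidean_space \<Rightarrow> 'b::{banach, second_countable_topology}"
  assumes "integrable lborel f"
  shows "integrable lborel (\<lambda>x. f (c + x))"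
proof -
  have "integrable (distr lborel borel (\<lambda>x. c + x)) f"
    using assms by (simp only: lborel_distr_translate)
  then show ?thesis
    using assms by (subst (asm) integrable_distr_eq) auto
qed

text \<open>Uniqueness of Haar measure in disguise: integrating \<open>1\<^sub>B(x) 1\<^sub>A(x + T y)\<close> over both variables,
  with \<open>B\<close> a ball, gives \<open>|B| |T\<inverse>A|\<close> in one order and \<open>|B| |A|\<close> in the other.\<close>

lemma lborel_distr_linear_isometry:
  fixes T S :: "'a::euclidean_space \<Rightarrow> 'a"
  assumes T: "linear T" "\<And>x. norm (T x) = norm x" and S: "\<And>x. T (S x) = x"
  shows "distr lborel borel T = lborel"
proof (rule measure_eqI)
  fix A assume "A \<in> sets (distr lborel borel T)"
  then have [measurable]: "A \<in> sets borel" by simp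
  have contT: "continuous_on UNIV T"
    using T(1) by (simp add: linear_continuous_on linear_conv_bounded_linear)
  then have [measurable]: "T \<in> borel_measurable borel"
    by (rule borel_measurable_continuous_onI)
  define B where "B = (cball 0 1 :: 'a set)"
  have [measurable]: "B \<in> sets borel" by (simp add: B_def)
  have Tadd: "T (x + y) = T x + T y" for x y using T(1) by (simp add: linear_add)
  have B_fin: "emeasure lborel B = ennreal (unit_ball_vol (DIM('a)))"
    unfolding B_def by (subst emeasure_cball) auto
  \<comment> \<open>Writing \<open>x = T (S x)\<close> turns the shift by \<open>x\<close> into a
    translation of \<open>y\<close>, so the integral does not depend on \<open>x\<close>.\<close>
  have 1: "(\<integral>\<^sup>+y. indicator A (x + T y) \<partial>lborel) = emeasure (distr lborel borel T) A" for x
  proof -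
    have "(\<integral>\<^sup>+y. indicator A (x + T y) \<partial>lborel) = (\<integral>\<^sup>+y. indicator A (T (S x + y)) \<partial>lborel)"
      by (simp add: Tadd S)
    also have "\<dots> = (\<integral>\<^sup>+y. indicator A (T y) \<partial>lborel)"
      by (rule nn_integral_lborel_translate[where f="\<lambda>y. indicator A (T y)"]) measurable
    also have "\<dots> = (\<integral>\<^sup>+y. indicator A y \<partial>distr lborel borel T)"
      by (rule nn_integral_distr[symmetric]) auto
    finally show ?thesis by simp
  qed
  have 2: "(\<integral>\<^sup>+y. indicator B (x - T y) \<partial>lborel) = emeasure lborel B" for x
  proof -
    have "(\<integral>\<^sup>+y. indicator B (x - T y) \<partial>lborel) = (\<integral>\<^sup>+y. indicator B (S x - y) \<partial>lborel)"
    proof (rule nn_integral_cong)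
      fix y
      \<comment> \<open>The ball is the one set known to be invariant under \<open>T\<close>; this
        is where preservation of the norm enters.\<close>
      have "x - T y = T (S x - y)" by (simp add: linear_diff[OF T(1)] S)
      then show "indicator B (x - T y) = (indicator B (S x - y) :: ennreal)"
        by (simp add: B_def indicator_def T(2))
    qed
    also have "\<dots> = (\<integral>\<^sup>+y. indicator B y \<partial>lborel)"
      by (rule nn_integral_lborel_reflect) measurable
    finally show ?thesis by simp
  qed
  have "emeasure lborel B * emeasure (distr lborel borel T) A
      = (\<integral>\<^sup>+x. indicator B x * (\<integral>\<^sup>+y. indicator A (x + T y) \<partial>lborel) \<partial>lborel)"
    by (simp add: 1 nn_integral_multc)
  also have "\<dots> = (\<integral>\<^sup>+x. (\<integral>\<^sup>+y. indicator B x * indicator A (x + T y) \<partial>lborel) \<partial>lborel)"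
    by (intro nn_integral_cong nn_integral_cmult[symmetric]) measurable
  also have "\<dots> = (\<integral>\<^sup>+y. (\<integral>\<^sup>+x. indicator B x * indicator A (x + T y) \<partial>lborel) \<partial>lborel)"
    by (rule lborel_pair.Fubini'[symmetric]) measurable
  also have "\<dots> = (\<integral>\<^sup>+y. (\<integral>\<^sup>+x. indicator B (x - T y) * indicator A x \<partial>lborel) \<partial>lborel)"
  proof (rule nn_integral_cong)
    fix y
    show "(\<integral>\<^sup>+x. indicator B x * indicator A (x + T y) \<partial>lborel)
        = (\<integral>\<^sup>+x. indicator B (x - T y) * (indicator A x :: ennreal) \<partial>lborel)"
      using nn_integral_lborel_translate[where f="\<lambda>x. indicator B (x - T y) * indicator A x" and c="T y"]
      by (simp add: add.commute)
  qed
  also have "\<dots> = (\<integral>\<^sup>+x. (\<integral>\<^sup>+y. indicator B (x - T y) * indicator A x \<partial>lborel) \<partial>lborel)"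
    by (rule lborel_pair.Fubini') measurable
  also have "\<dots> = (\<integral>\<^sup>+x. emeasure lborel B * indicator A x \<partial>lborel)"
    by (intro nn_integral_cong, subst nn_integral_multc) (auto simp: 2)
  also have "\<dots> = emeasure lborel B * emeasure lborel A"
    by (simp add: nn_integral_cmult)
  finally have "emeasure lborel B * emeasure (distr lborel borel T) A = emeasure lborel B * emeasure lborel A" .
  then show "emeasure (distr lborel borel T) A = emeasure lborel A"
    using unit_ball_vol_pos[of "real DIM('a)"] unfolding B_fin
    by (subst (asm) ennreal_mult_cancel_left) (auto simp del: unit_ball_vol_pos)
qed simp

section \<open>Householder reflections\<close>

definition householder :: "'a::euclidean_space \<Rightarrow> 'a \<Rightarrow> 'a" where
  "householder w x = x - (2 * (x \<bullet> w) / (w \<bullet> w)) *\<^sub>R w"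

lemma householder_linear: "linear (householder w)"
  by (rule linearI) (auto simp: householder_def inner_simps algebra_simps add_divide_distrib)

lemma householder_self_adjoint: "householder w x \<bullet> y = x \<bullet> householder w y"
  by (simp add: householder_def inner_simps inner_commute)

lemma householder_involution: "householder w (householder w x) = x"
  by (cases "w = 0") (auto simp: householder_def inner_simps algebra_simps divide_simps
      simp flip: scaleR_add_left scaleR_diff_left)

lemma householder_norm: "norm (householder w x) = norm x"
  unfolding norm_eq_sqrt_inner
  by (simp add: householder_self_adjoint householder_involution)

text \<open>The mirror is the hyperplane bisecting \<open>x\<close> and \<open>y\<close>. Equal
  norms give \<open>(x - y) \<bullet> (x - y) = 2 * (x \<bullet> (x - y))\<close>, so the
  coefficient in the reflection is 1. If \<open>x = y\<close>, division by zero yields 0 and the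
  reflection is the identity.\<close>

lemma householder_swap:
  assumes "norm x = norm y"
  shows "householder (x - y) x = y"
proof (cases "x = y")
  case False
  have xy: "x \<bullet> x = y \<bullet> y" using assms by (simp add: norm_eq_sqrt_inner)
  have "(x - y) \<bullet> (x - y) = 2 * (x \<bullet> (x - y))"
    by (simp add: inner_simps inner_commute xy)
  moreover have "(x - y) \<bullet> (x - y) \<noteq> 0" using False by (metis inner_eq_zero_iff right_minus_eq)
  ultimately have one: "2 * (x \<bullet> (x - y)) / ((x - y) \<bullet> (x - y)) = 1" by (metis divide_self)
  show ?thesis unfolding householder_def one by simp
qed (simp add: householder_def)

text \<open>The weight \<open>\<bar>y\<bar>\<close> gives the integrand an elementary antiderivative
  on either side of 0, so no Beta integral appears. The power of the root is the volume of a slice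
  of the ball up to the factor \<open>unit_ball_vol n\<close>.\<close>

lemma moment_1d:
  assumes "\<rho> > 0"
  shows "(\<integral>\<^sup>+y. indicator {-\<rho>..\<rho>} y * ennreal (\<bar>y\<bar> * sqrt (\<rho>\<^sup>2 - y\<^sup>2) ^ n) \<partial>lborel)
    = ennreal (2 * \<rho> ^ (n + 2) / (n + 2))"
proof -
  have pos: "\<rho>\<^sup>2 - y\<^sup>2 > 0" if "-\<rho> < y" "y < \<rho>" for y
  proof -
    have "\<bar>y\<bar> < \<bar>\<rho>\<bar>" using that by linarith
    then show ?thesis using abs_le_square_iff[of \<rho> y] by linarith
  qed
  have D: "((\<lambda>y. sqrt (\<rho>\<^sup>2 - y\<^sup>2) ^ (n + 2) / (n + 2)) has_real_derivative - y * sqrt (\<rho>\<^sup>2 - y\<^sup>2) ^ n) (at y)"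
    if "-\<rho> < y" "y < \<rho>" for y
  proof -
    let ?q = "sqrt (\<rho>\<^sup>2 - y\<^sup>2)"
    have q: "?q > 0" using pos[OF that] by simp
    have "((\<lambda>y. sqrt (\<rho>\<^sup>2 - y\<^sup>2)) has_real_derivative - y * inverse ?q) (at y)"
      using pos[OF that] by (auto intro!: derivative_eq_intros)
    from DERIV_cdivide[OF DERIV_power[OF this, of "n + 2"], of "real (n + 2)"]
    have "((\<lambda>y. sqrt (\<rho>\<^sup>2 - y\<^sup>2) ^ (n + 2) / (n + 2)) has_real_derivative
        real (n + 2) * (- y * inverse ?q * ?q ^ (n + 1)) / (n + 2)) (at y)"
      by simp
    also have "real (n + 2) * (- y * inverse ?q * ?q ^ (n + 1)) / (n + 2) = - y * ?q ^ n"
      using q by (simp add: field_simps)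
    finally show ?thesis .
  qed
  \<comment> \<open>The root is not differentiable at the endpoints of the interval; the fundamental
    theorem is therefore applied with derivatives in the interior and continuity up to the
    boundary.\<close>
  have C: "continuous_on S (\<lambda>y. sqrt (\<rho>\<^sup>2 - y\<^sup>2) ^ (n + 2) / (n + 2))" for S
    by (intro continuous_intros) auto
  have I1: "((\<lambda>y. \<bar>y\<bar> * sqrt (\<rho>\<^sup>2 - y\<^sup>2) ^ n) has_integral \<rho> ^ (n + 2) / (n + 2)) {-\<rho>..0}"
  proof -
    have "((\<lambda>y. - y * sqrt (\<rho>\<^sup>2 - y\<^sup>2) ^ n) has_integral
      sqrt (\<rho>\<^sup>2 - 0\<^sup>2) ^ (n + 2) / (n + 2) - sqrt (\<rho>\<^sup>2 - (-\<rho>)\<^sup>2) ^ (n + 2) / (n + 2)) {-\<rho>..0}"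
      using assms D C
      by (intro fundamental_theorem_of_calculus_interior)
         (auto simp: has_real_derivative_iff_has_vector_derivative)
    then have "((\<lambda>y. - y * sqrt (\<rho>\<^sup>2 - y\<^sup>2) ^ n) has_integral \<rho> ^ (n + 2) / (n + 2)) {-\<rho>..0}"
      using assms by simp
    then show ?thesis by (rule has_integral_eq[rotated]) auto
  qed
  have I2: "((\<lambda>y. \<bar>y\<bar> * sqrt (\<rho>\<^sup>2 - y\<^sup>2) ^ n) has_integral \<rho> ^ (n + 2) / (n + 2)) {0..\<rho>}"
  proof -
    have "((\<lambda>y. - y * sqrt (\<rho>\<^sup>2 - y\<^sup>2) ^ n) has_integral
      sqrt (\<rho>\<^sup>2 - \<rho>\<^sup>2) ^ (n + 2) / (n + 2) - sqrt (\<rho>\<^sup>2 - 0\<^sup>2) ^ (n + 2) / (n + 2)) {0..\<rho>}"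
      using assms D C
      by (intro fundamental_theorem_of_calculus_interior)
         (auto simp: has_real_derivative_iff_has_vector_derivative)
    from has_integral_neg[OF this]
    have "((\<lambda>y. y * sqrt (\<rho>\<^sup>2 - y\<^sup>2) ^ n) has_integral \<rho> ^ (n + 2) / (n + 2)) {0..\<rho>}"
      using assms by simp
    then show ?thesis by (rule has_integral_eq[rotated]) auto
  qed
  have "((\<lambda>y. \<bar>y\<bar> * sqrt (\<rho>\<^sup>2 - y\<^sup>2) ^ n) has_integral
     \<rho> ^ (n + 2) / (n + 2) + \<rho> ^ (n + 2) / (n + 2)) {-\<rho>..\<rho>}"
    by (rule has_integral_combine[OF _ _ I1 I2]) (use assms in auto)
  then have "((\<lambda>y. \<bar>y\<bar> * sqrt (\<rho>\<^sup>2 - y\<^sup>2) ^ n) has_integral 2 * \<rho> ^ (n + 2) / (n + 2)) {-\<rho>..\<rho>}"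
    by (simp only: mult_2 add_divide_distrib distrib_right)
  then have "((\<lambda>y. if y \<in> {-\<rho>..\<rho>} then \<bar>y\<bar> * sqrt (\<rho>\<^sup>2 - y\<^sup>2) ^ n else 0) has_integral
      2 * \<rho> ^ (n + 2) / (n + 2)) UNIV"
    by (simp only: has_integral_restrict_UNIV)
  moreover have "(\<lambda>y. if y \<in> {-\<rho>..\<rho>} then \<bar>y\<bar> * sqrt (\<rho>\<^sup>2 - y\<^sup>2) ^ n else 0) =
      (\<lambda>y. indicator {-\<rho>..\<rho>} y * (\<bar>y\<bar> * sqrt (\<rho>\<^sup>2 - y\<^sup>2) ^ n))"
    by (auto simp: indicator_def)
  ultimately have "((\<lambda>y. indicator {-\<rho>..\<rho>} y * (\<bar>y\<bar> * sqrt (\<rho>\<^sup>2 - y\<^sup>2) ^ n)) has_integral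
     2 * \<rho> ^ (n + 2) / (n + 2)) UNIV"
    by simp
  then have "(\<integral>\<^sup>+y. ennreal (indicator {-\<rho>..\<rho>} y * (\<bar>y\<bar> * sqrt (\<rho>\<^sup>2 - y\<^sup>2) ^ n)) \<partial>lborel)
    = ennreal (2 * \<rho> ^ (n + 2) / (n + 2))"
    by (intro nn_integral_has_integral_lborel)
       (auto simp: indicator_def abs_le_iff abs_square_le_1 intro!: mult_nonneg_nonneg zero_le_power
          abs_le_square_iff[THEN iffD1] power2_le_iff_abs_le[THEN iffD2])
  also have "(\<integral>\<^sup>+y. ennreal (indicator {-\<rho>..\<rho>} y * (\<bar>y\<bar> * sqrt (\<rho>\<^sup>2 - y\<^sup>2) ^ n)) \<partial>lborel) =
     (\<integral>\<^sup>+y. indicator {-\<rho>..\<rho>} y * ennreal (\<bar>y\<bar> * sqrt (\<rho>\<^sup>2 - y\<^sup>2) ^ n) \<partial>lborel)"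
    by (intro nn_integral_cong) (auto simp: indicator_def)
  finally show ?thesis by simp
qed

text \<open>Slicing orthogonally to \<open>b\<close>: at height \<open>y\<close> the ball cuts out a
  ball of one dimension less and radius \<open>sqrt (\<rho>\<^sup>2 - y\<^sup>2)\<close>, which
  leaves the one-dimensional moment of \<open>moment_1d\<close>.\<close>

lemma ball_moment_Basis:
  fixes b :: "'a::euclidean_space"
  assumes b: "b \<in> Basis" and \<rho>: "\<rho> > 0"
  shows "(\<integral>\<^sup>+h. indicator (cball 0 \<rho>) h * ennreal \<bar>b \<bullet> h\<bar> \<partial>lborel)
    = ennreal (2 * unit_ball_vol (real DIM('a) - 1) / (real DIM('a) + 1) * \<rho> ^ (DIM('a) + 1))"
proof -
  interpret product_sigma_finite "\<lambda>_. lborel" by standard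
  define A where "A = Basis - {b}"
  have A: "finite A" "b \<notin> A" "insert b A = Basis" "card A = DIM('a) - 1"
    using b by (auto simp: A_def)
  have dim: "Suc (card A) = DIM('a)" using A(4) DIM_positive[where 'a='a] by simp
  let ?P = "\<lambda>I. Pi\<^sub>M I (\<lambda>_. lborel :: real measure)"
  let ?g = "\<lambda>f. \<Sum>c\<in>Basis. f c *\<^sub>R c :: 'a"
  let ?w = "unit_ball_vol (real (card A))"
  have gin: "?g f \<bullet> b = f b" for f
    using b by (simp add: inner_sum_left inner_Basis if_distrib sum.delta cong: if_cong)
  have gnorm: "norm (?g f) = sqrt ((f b)\<^sup>2 + (\<Sum>i\<in>A. (f i)\<^sup>2))" for f
  proof -
    have "norm (?g f) = dist 0 (?g f)" by simp
    also have "\<dots> = sqrt (\<Sum>i\<in>Basis. (f i)\<^sup>2)"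
      by (subst euclidean_dist_l2) (auto simp: L2_set_def)
    also have "(\<Sum>i\<in>Basis. (f i)\<^sup>2) = (f b)\<^sup>2 + (\<Sum>i\<in>A. (f i)\<^sup>2)"
      using A by (metis sum.insert)
    finally show ?thesis .
  qed
  have "(\<integral>\<^sup>+h. indicator (cball 0 \<rho>) h * ennreal \<bar>b \<bullet> h\<bar> \<partial>lborel)
      = (\<integral>\<^sup>+h. indicator (cball 0 \<rho>) h * ennreal \<bar>b \<bullet> h\<bar> \<partial>distr (?P Basis) borel ?g)"
    by (simp only: lborel_eq[symmetric])
  also have "\<dots> = (\<integral>\<^sup>+f. indicator (cball 0 \<rho>) (?g f) * ennreal \<bar>b \<bullet> ?g f\<bar> \<partial>?P Basis)"
    by (rule nn_integral_distr) auto
  also have "\<dots> = (\<integral>\<^sup>+f. indicator {f. sqrt ((f b)\<^sup>2 + (\<Sum>i\<in>A. (f i)\<^sup>2)) \<le> \<rho>} f * ennreal \<bar>f b\<bar> \<partial>?P (insert b A))"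
    unfolding A(3) by (intro nn_integral_cong) (auto simp: indicator_def gnorm gin inner_commute[of b])
  also have "\<dots> = (\<integral>\<^sup>+y. (\<integral>\<^sup>+f. indicator {f. sqrt ((f b)\<^sup>2 + (\<Sum>i\<in>A. (f i)\<^sup>2)) \<le> \<rho>} (f(b:=y))
       * ennreal \<bar>(f(b:=y)) b\<bar> \<partial>?P A) \<partial>lborel)"
    by (rule product_nn_integral_insert_rev[OF A(1,2)])
       (use A in \<open>measurable; auto\<close>)
  also have "\<dots> = (\<integral>\<^sup>+y. (\<integral>\<^sup>+f. (indicator {-\<rho>..\<rho>} y * ennreal \<bar>y\<bar>) *
       indicator ({f. sqrt (\<Sum>i\<in>A. (f i)\<^sup>2) \<le> sqrt (\<rho>\<^sup>2 - y\<^sup>2)} \<inter> space (?P A)) f \<partial>?P A) \<partial>lborel)"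
  proof (intro nn_integral_cong, goal_cases)
    case (1 y f)
    have *: "y \<in> {-\<rho>..\<rho>}" if "c \<le> \<rho> ^ 2 - y ^ 2" "c \<ge> 0" for c
    proof -
      have "y ^ 2 \<le> \<rho> ^ 2" using that by simp
      then show ?thesis
        using \<open>\<rho> > 0\<close> by (simp add: power2_le_iff_abs_le abs_if split: if_splits)
    qed
    have "(\<Sum>x\<in>A. (if x = b then y else f x)\<^sup>2) = (\<Sum>x\<in>A. (f x)\<^sup>2)"
      using A by (intro sum.cong) auto
    moreover have "(\<Sum>x\<in>A. (f x)\<^sup>2) \<ge> 0" by (simp add: sum_nonneg)
    ultimately show ?case using 1 \<open>\<rho> > 0\<close> *[of "\<Sum>x\<in>A. (f x)\<^sup>2"]
      by (auto simp: real_sqrt_le_iff' indicator_def PiE_def space_PiM)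
  qed
  also have "\<dots> = (\<integral>\<^sup>+y. (indicator {-\<rho>..\<rho>} y * ennreal \<bar>y\<bar>) *
      emeasure (?P A) ({f. sqrt (\<Sum>i\<in>A. (f i)\<^sup>2) \<le> sqrt (\<rho>\<^sup>2 - y\<^sup>2)} \<inter> space (?P A)) \<partial>lborel)"
    using A(1) by (intro nn_integral_cong, subst nn_integral_cmult) auto
  also have "\<dots> = (\<integral>\<^sup>+y. ennreal ?w * (indicator {-\<rho>..\<rho>} y * ennreal (\<bar>y\<bar> * sqrt (\<rho>\<^sup>2 - y\<^sup>2) ^ card A)) \<partial>lborel)"
  proof (intro nn_integral_cong_AE, goal_cases)
    case 1
    \<comment> \<open>At the two poles the slice has radius 0; they form a null set, so the volume
      formula is applied to positive radii only.\<close>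
    have "AE y in lborel. y \<notin> {-\<rho>,\<rho>}"
      by (intro AE_not_in countable_imp_null_set_lborel) auto
    thus ?case
    proof eventually_elim
      case (elim y)
      show ?case
      proof (cases "y \<in> {-\<rho><..<\<rho>}")
        case True
        hence "y\<^sup>2 < \<rho>\<^sup>2" by (subst real_sqrt_less_iff [symmetric]) auto
        thus ?thesis
          by (subst emeasure_cball_aux) (use A in \<open>auto simp: ennreal_mult mult_ac\<close>)
      qed (insert elim, auto)
    qed
  qed
  also have "\<dots> = ennreal ?w * ennreal (2 * \<rho> ^ (card A + 2) / (card A + 2))"
    by (subst nn_integral_cmult) (auto simp: moment_1d[OF \<rho>])
  also have "\<dots> = ennreal (?w * (2 * \<rho> ^ (card A + 2) / (card A + 2)))"
    by (rule ennreal_mult[symmetric]) (use \<rho> in auto)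
  also have "?w * (2 * \<rho> ^ (card A + 2) / (card A + 2)) =
      2 * unit_ball_vol (real DIM('a) - 1) / (real DIM('a) + 1) * \<rho> ^ (DIM('a) + 1)"
    by (simp add: dim[symmetric] add_ac)
  finally show ?thesis .
qed

text \<open>By isotropy \<open>v\<close> may be moved onto a coordinate axis. The reflection that
  does so is self-adjoint, hence \<open>v \<bullet> T h = T v \<bullet> h\<close>, and it preserves
  both the ball and the measure.\<close>

lemma ball_moment:
  fixes v :: "'a::euclidean_space"
  assumes \<rho>: "\<rho> > 0"
  shows "(\<integral>\<^sup>+h. indicator (cball 0 \<rho>) h * ennreal \<bar>v \<bullet> h\<bar> \<partial>lborel)
    = ennreal (2 * unit_ball_vol (real DIM('a) - 1) / (real DIM('a) + 1) * \<rho> ^ (DIM('a) + 1) * norm v)"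
proof -
  obtain b :: 'a where b: "b \<in> Basis" using nonempty_Basis by blast
  define T where "T = householder (v - norm v *\<^sub>R b)"
  have T: "T v = norm v *\<^sub>R b"
    unfolding T_def by (rule householder_swap) (use b in simp)
  have dT: "distr lborel borel T = lborel" unfolding T_def
    by (rule lborel_distr_linear_isometry[OF householder_linear householder_norm householder_involution])
  have [measurable]: "T \<in> borel_measurable borel"
    unfolding T_def householder_def by measurable
  have "(\<integral>\<^sup>+h. indicator (cball 0 \<rho>) h * ennreal \<bar>v \<bullet> h\<bar> \<partial>lborel)
      = (\<integral>\<^sup>+h. indicator (cball 0 \<rho>) h * ennreal \<bar>v \<bullet> h\<bar> \<partial>distr lborel borel T)"
    by (simp only: dT)
  also have "\<dots> = (\<integral>\<^sup>+h. indicator (cball 0 \<rho>) (T h) * ennreal \<bar>v \<bullet> T h\<bar> \<partial>lborel)"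
    by (rule nn_integral_distr) auto
  also have "\<dots> = (\<integral>\<^sup>+h. ennreal (norm v) * (indicator (cball 0 \<rho>) h * ennreal \<bar>b \<bullet> h\<bar>) \<partial>lborel)"
  proof (rule nn_integral_cong)
    fix h
    have "v \<bullet> T h = norm v * (b \<bullet> h)"
      using T householder_self_adjoint[of "v - norm v *\<^sub>R b" v h] by (simp add: T_def)
    moreover have "norm (T h) = norm h" by (simp add: T_def householder_norm)
    ultimately show "indicator (cball 0 \<rho>) (T h) * ennreal \<bar>v \<bullet> T h\<bar>
        = ennreal (norm v) * (indicator (cball 0 \<rho>) h * ennreal \<bar>b \<bullet> h\<bar>)"
      by (auto simp: indicator_def abs_mult ennreal_mult)
  qed
  also have "\<dots> = ennreal (norm v) * ennreal (2 * unit_ball_vol (real DIM('a) - 1) / (real DIM('a) + 1) * \<rho> ^ (DIM('a) + 1))"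
    by (subst nn_integral_cmult) (auto simp: ball_moment_Basis[OF b \<rho>])
  also have "\<dots> = ennreal (2 * unit_ball_vol (real DIM('a) - 1) / (real DIM('a) + 1) * \<rho> ^ (DIM('a) + 1) * norm v)"
    using \<rho> DIM_positive[where 'a='a]
    by (subst ennreal_mult[symmetric]) (auto simp: mult_ac intro!: mult_nonneg_nonneg divide_nonneg_nonneg)
  finally show ?thesis .
qed

subsection \<open>Uniformly smooth functions and convolution\<close>

text \<open>Bounded functions \<open>K\<close> with a bounded, uniformly continuous derivative \<open>D\<close>. Uniformity makes the
  class stable under convolution with integrable functions without any use of dominated convergence.\<close>

definition C1b :: "('a::euclidean_space \<Rightarrow> 'b::euclidean_space) \<Rightarrow> ('a \<Rightarrow> 'a \<Rightarrow> 'b) \<Rightarrow> bool" where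
  "C1b K D \<longleftrightarrow> (\<forall>x. (K has_derivative D x) (at x)) \<and> (\<exists>B. \<forall>x. norm (K x) \<le> B)
     \<and> (\<exists>B. \<forall>x h. norm (D x h) \<le> B * norm h)
     \<and> (\<forall>e>0. \<exists>\<delta>>0. \<forall>x y h. dist x y < \<delta> \<longrightarrow> norm (D x h - D y h) \<le> e * norm h)"

lemma C1bD:
  assumes "C1b K D"
  shows "(K has_derivative D x) (at x)" "linear (D x)"
  using assms unfolding C1b_def by (auto intro: has_derivative_linear)

lemma C1b_bound:
  assumes "C1b K D"
  obtains B where "B > 0" "\<And>x. norm (K x) \<le> B" "\<And>x h. norm (D x h) \<le> B * norm h"
proof -
  from assms obtain B1 B2 where B: "\<And>x. norm (K x) \<le> B1" "\<And>x h. norm (D x h) \<le> B2 * norm h"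
    unfolding C1b_def by blast
  have "norm (K x) \<le> \<bar>B1\<bar> + \<bar>B2\<bar> + 1" for x using B(1)[of x] by linarith
  moreover have "norm (D x h) \<le> (\<bar>B1\<bar> + \<bar>B2\<bar> + 1) * norm h" for x h
    by (rule order_trans[OF B(2)]) (auto intro!: mult_right_mono)
  ultimately show ?thesis using that[of "\<bar>B1\<bar> + \<bar>B2\<bar> + 1"] by auto
qed

lemma C1b_modulus:
  assumes "C1b K D" "e > 0"
  obtains \<delta> where "\<delta> > 0" "\<And>x y h. dist x y < \<delta> \<Longrightarrow> norm (D x h - D y h) \<le> e * norm h"
  using assms unfolding C1b_def by metis

lemma C1b_continuous:
  assumes "C1b K D"
  shows "continuous_on UNIV K" "continuous_on UNIV (\<lambda>x. D x h)"
proof -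
  show "continuous_on UNIV K"
    using C1bD(1)[OF assms] by (auto intro!: continuous_at_imp_continuous_on has_derivative_continuous)
  show "continuous_on UNIV (\<lambda>x. D x h)"
    unfolding continuous_on_iff
  proof (intro ballI allI impI)
    fix x :: 'a and e :: real assume "e > 0"
    then have "e / (norm h + 1) > 0" by (simp add: add_nonneg_pos)
    then obtain \<delta> where d: "\<delta> > 0" "\<And>x y. dist x y < \<delta> \<Longrightarrow> norm (D x h - D y h) \<le> e / (norm h + 1) * norm h"
      using C1b_modulus[OF assms] by metis
    have "e / (norm h + 1) * norm h < e"
      using \<open>e > 0\<close> norm_ge_zero[of h] by (simp add: divide_less_eq add_nonneg_pos)
    then show "\<exists>d>0. \<forall>x'\<in>UNIV. dist x' x < d \<longrightarrow> dist (D x' h) (D x h) < e"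
      using d by (intro exI[of _ \<delta>]) (auto simp: dist_norm intro: le_less_trans)
  qed
qed

lemma C1b_measurable [measurable_dest]:
  assumes "C1b K D"
  shows "K \<in> borel_measurable borel" "(\<lambda>x. D x h) \<in> borel_measurable borel"
  using C1b_continuous[OF assms] by (auto intro: borel_measurable_continuous_onI)

text \<open>The mean value inequality for \<open>K\<close> minus its linearisation at
  \<open>x\<close>. What matters is that \<open>\<delta>\<close> does not depend on
  \<open>x\<close>: the remainder can then be integrated over \<open>x\<close> or against an
  integrable function.\<close>

lemma C1b_taylor:
  assumes K: "C1b K D" and "e > 0"
  obtains \<delta> where "\<delta> > 0" "\<And>x h. norm h < \<delta> \<Longrightarrow> norm (K (x + h) - K x - D x h) \<le> e * norm h"
proof -
  obtain \<delta> where d: "\<delta> > 0" "\<And>x y h. dist x y < \<delta> \<Longrightarrow> norm (D x h - D y h) \<le> e * norm h"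
    using C1b_modulus[OF K \<open>e > 0\<close>] by metis
  have "norm (K (x + h) - K x - D x h) \<le> e * norm h" if h: "norm h < \<delta>" for x h
  proof -
    have "norm (K (x + h) - K x - D x (x + h - x)) \<le> norm (x + h - x) * e"
    proof (rule differentiable_bound_linearization[where S="ball x \<delta>" and f'=D])
      fix t :: real assume "t \<in> {0..1}"
      then have "norm (t *\<^sub>R h) \<le> norm h" by (simp add: mult_left_le_one_le)
      then show "x + t *\<^sub>R (x + h - x) \<in> ball x \<delta>" using h by (simp add: dist_norm)
    next
      fix y assume "y \<in> ball x \<delta>"
      then show "onorm (D y - D x) \<le> e"
        using d(2)[of y x] by (intro onorm_bound) (use \<open>e > 0\<close> in \<open>auto simp: dist_commute\<close>)
    qed (use d(1) C1bD(1)[OF K] in \<open>auto intro: has_derivative_at_withinI\<close>)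
    then show ?thesis by (simp add: mult.commute)
  qed
  with d(1) that show ?thesis by blast
qed

text \<open>In finite dimension, bounds and moduli of continuity for the columns
  \<open>D x i\<close> give those for the operators \<open>D x\<close>, at the price of a factor
  \<open>DIM('a)\<close>.\<close>

lemma C1bI:
  assumes der: "\<And>x. (K has_derivative D x) (at x)" and bdd: "\<And>x. norm (K x) \<le> B"
    and cont: "\<And>i. i \<in> Basis \<Longrightarrow> uniformly_continuous_on UNIV (\<lambda>x. D x i)"
    and bD: "\<And>i x. i \<in> Basis \<Longrightarrow> norm (D x i) \<le> B"
  shows "C1b K D"
proof -
  have lin: "linear (D x)" for x using der[of x] by (rule has_derivative_linear)
  have rep: "D x h = (\<Sum>i\<in>Basis. (h \<bullet> i) *\<^sub>R D x i)" for x h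
    using linear_sum[OF lin[of x], of "\<lambda>i. (h \<bullet> i) *\<^sub>R i" Basis]
    by (simp add: euclidean_representation linear_scale[OF lin])
  have bd: "norm (D x h) \<le> (real DIM('a) * B) * norm h" for x h
  proof -
    have "norm (D x h) \<le> (\<Sum>i\<in>Basis. norm ((h \<bullet> i) *\<^sub>R D x i))"
      unfolding rep[of x h] by (rule norm_sum)
    also have "\<dots> \<le> (\<Sum>i\<in>(Basis::'a set). norm h * B)"
      by (rule sum_mono) (auto intro!: mult_mono Basis_le_norm bD)
    finally show ?thesis by (simp add: mult_ac)
  qed
  have "\<exists>\<delta>>0. \<forall>x y h. dist x y < \<delta> \<longrightarrow> norm (D x h - D y h) \<le> e * norm h" if "e > 0" for e
  proof -
    define e' where "e' = e / real DIM('a)"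
    have "e' > 0" using that by (simp add: e'_def)
    then have "\<forall>i\<in>Basis. \<exists>\<delta>>0. \<forall>x y. dist x y < \<delta> \<longrightarrow> norm (D x i - D y i) < e'"
      using cont unfolding uniformly_continuous_on_def by (simp add: dist_norm) (metis norm_minus_commute)
    then obtain dl where dl: "\<And>i. i \<in> Basis \<Longrightarrow> dl i > 0"
        "\<And>i x y. i \<in> Basis \<Longrightarrow> dist x y < dl i \<Longrightarrow> norm (D x i - D y i) < e'"
      by metis
    define \<delta> where "\<delta> = Min (dl ` Basis)"
    have "\<delta> > 0" unfolding \<delta>_def using dl(1) by (subst Min_gr_iff) auto
    moreover have "norm (D x h - D y h) \<le> e * norm h" if xy: "dist x y < \<delta>" for x y h
    proof -
      have "D x h - D y h = (\<Sum>i\<in>Basis. (h \<bullet> i) *\<^sub>R (D x i - D y i))"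
        unfolding rep[of x h] rep[of y h] by (simp add: sum_subtractf scaleR_diff_right)
      also have "norm \<dots> \<le> (\<Sum>i\<in>Basis. norm ((h \<bullet> i) *\<^sub>R (D x i - D y i)))" by (rule norm_sum)
      also have "\<dots> \<le> (\<Sum>i\<in>(Basis::'a set). norm h * e')"
      proof (rule sum_mono)
        fix i :: 'a assume i: "i \<in> Basis"
        have "\<delta> \<le> dl i" unfolding \<delta>_def using i by (intro Min_le) auto
        then have "norm (D x i - D y i) \<le> e'" using dl(2)[OF i] xy by (intro less_imp_le) auto
        then show "norm ((h \<bullet> i) *\<^sub>R (D x i - D y i)) \<le> norm h * e'"
          using i by (auto intro!: mult_mono Basis_le_norm)
      qed
      also have "\<dots> = e * norm h" by (simp add: e'_def)
      finally show ?thesis .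
    qed
    ultimately show ?thesis by blast
  qed
  then show ?thesis unfolding C1b_def using der bdd bd by blast
qed

section \<open>Compactly supported functions\<close>

lemma compact_support_uniformly_continuous:
  fixes f :: "'a::euclidean_space \<Rightarrow> 'b::real_normed_vector"
  assumes f: "continuous_on UNIV f" and R: "\<And>x. norm x > R \<Longrightarrow> f x = 0"
  shows "uniformly_continuous_on UNIV f"
proof -
  have uc: "uniformly_continuous_on (cball 0 (R + 1)) f"
    by (rule compact_uniformly_continuous) (auto intro: continuous_on_subset[OF f])
  show ?thesis
    unfolding uniformly_continuous_on_def
  proof (intro allI impI)
    fix e :: real assume "e > 0"
    with uc obtain d where d: "d > 0"
      "\<And>x y. x \<in> cball 0 (R + 1) \<Longrightarrow> y \<in> cball 0 (R + 1) \<Longrightarrow> dist y x < d \<Longrightarrow> dist (f y) (f x) < e"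
      unfolding uniformly_continuous_on_def by metis
    \<comment> \<open>The margin 1 in the radius \<open>R + 1\<close>: if one of two points at
      distance below 1 leaves the larger ball, both lie outside the smaller one, where
      \<open>f\<close> vanishes.\<close>
    have "dist (f y) (f x) < e" if "dist y x < min d 1" for x y
    proof (cases "x \<in> cball 0 (R + 1) \<and> y \<in> cball 0 (R + 1)")
      case True
      then show ?thesis using d(2) that by auto
    next
      case False
      have "norm x \<le> norm y + dist y x" "norm y \<le> norm x + dist y x"
        by (metis dist_commute dist_norm norm_triangle_sub add.commute)
           (metis dist_commute dist_norm norm_triangle_sub add.commute)
      then have "norm x > R" "norm y > R" using False that by auto
      then show ?thesis using R \<open>e > 0\<close> by simp
    qed
    then show "\<exists>d>0. \<forall>x\<in>UNIV. \<forall>x'\<in>UNIV. dist x' x < d \<longrightarrow> dist (f x') (f x) < e"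
      using d(1) by (intro exI[of _ "min d 1"]) auto
  qed
qed

lemma compact_support_bounded:
  fixes f :: "'a::euclidean_space \<Rightarrow> 'b::real_normed_vector"
  assumes f: "continuous_on UNIV f" and R: "\<And>x. norm x > R \<Longrightarrow> f x = 0"
  obtains B where "\<And>x. norm (f x) \<le> B"
proof -
  have "compact (f ` cball 0 R)"
    by (rule compact_continuous_image) (auto intro: continuous_on_subset[OF f])
  then obtain B where B: "\<And>x. x \<in> cball 0 R \<Longrightarrow> norm (f x) \<le> B"
    by (metis bounded_iff compact_imp_bounded imageI)
  \<comment> \<open>The bound must also cover the value 0 outside the ball, and \<open>B\<close> may
    be negative when \<open>R < 0\<close> makes the ball empty.\<close>
  have "norm (f x) \<le> max B 0" for x
    using B[of x] R[of x] by (cases "norm x > R") auto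
  with that show ?thesis by blast
qed

lemma has_derivative_zero_outside:
  fixes K :: "'a::euclidean_space \<Rightarrow> 'b::euclidean_space"
  assumes "(K has_derivative D) (at x)" "\<And>x. norm x > R \<Longrightarrow> K x = 0" "norm x > R"
  shows "D h = 0"
proof -
  have op: "open {x::'a. norm x > R}" by (intro open_Collect_less continuous_intros)
  have "(K has_derivative (\<lambda>_. 0)) (at x)"
    by (rule has_derivative_transform_within_open[OF has_derivative_const op, of x 0])
       (use assms in auto)
  with assms(1) have "D = (\<lambda>_. 0)" by (rule has_derivative_unique)
  then show ?thesis by simp
qed

lemma C1b_compact_support:
  assumes der: "\<And>x. (K has_derivative D x) (at x)"
    and cont: "\<And>i. i \<in> Basis \<Longrightarrow> continuous_on UNIV (\<lambda>x. D x i)"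
    and R: "\<And>x. norm x > R \<Longrightarrow> K x = 0"
  shows "C1b K D"
proof -
  have DR: "D x h = 0" if "norm x > R" for x h
    by (rule has_derivative_zero_outside[OF der R that])
  have "continuous_on UNIV K"
    using der by (auto intro!: continuous_at_imp_continuous_on has_derivative_continuous)
  then obtain B0 where B0: "\<And>x. norm (K x) \<le> B0"
    using compact_support_bounded[of K R] R by metis
  have "\<forall>i\<in>Basis. \<exists>B. \<forall>x. norm (D x i) \<le> B"
    using compact_support_bounded[OF cont, of _ R] DR by metis
  then obtain B1 where B1: "\<And>i x. i \<in> Basis \<Longrightarrow> norm (D x i) \<le> B1 i" by metis
  show ?thesis
  proof (rule C1bI[where B="max B0 (Max (B1 ` Basis))"])
    show "uniformly_continuous_on UNIV (\<lambda>x. D x i)" if "i \<in> Basis" for i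
      by (rule compact_support_uniformly_continuous[OF cont[OF that]]) (rule DR)
    show "norm (D x i) \<le> max B0 (Max (B1 ` Basis))" if "i \<in> Basis" for i x
    proof -
      have "norm (D x i) \<le> B1 i" using B1 that by blast
      also have "\<dots> \<le> Max (B1 ` Basis)" using that by (intro Max_ge) auto
      finally show ?thesis by simp
    qed
  qed (use der B0 in \<open>auto intro: max.coboundedI1\<close>)
qed

section \<open>Convolution of an integrable function with a smooth kernel\<close>

lemma integrable_conv:
  fixes f :: "'a::euclidean_space \<Rightarrow> real" and K :: "'a \<Rightarrow> 'b::euclidean_space"
  assumes f: "integrable lborel f" and [measurable]: "K \<in> borel_measurable borel"
    and B: "\<And>x. norm (K x) \<le> B"
  shows "integrable lborel (\<lambda>y. f y *\<^sub>R K (x - y))"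
proof (rule Bochner_Integration.integrable_bound)
  show "integrable lborel (\<lambda>y. B * \<bar>f y\<bar>)" using f by simp
  show "(\<lambda>y. f y *\<^sub>R K (x - y)) \<in> borel_measurable lborel"
    using borel_measurable_integrable[OF f] by measurable
  have "B \<ge> 0" using B[of 0] norm_ge_zero[of "K 0"] by linarith
  then show "AE y in lborel. norm (f y *\<^sub>R K (x - y)) \<le> norm (B * \<bar>f y\<bar>)"
    using B by (auto simp: abs_mult mult.commute[of B] intro!: mult_left_mono)
qed

lemma norm_conv_le:
  fixes f :: "'a::euclidean_space \<Rightarrow> real" and K :: "'a \<Rightarrow> 'b::euclidean_space"
  assumes f: "integrable lborel f" and B: "\<And>x. norm (K x) \<le> B"
  shows "norm (\<integral>y. f y *\<^sub>R K y \<partial>lborel) \<le> B * (\<integral>y. \<bar>f y\<bar> \<partial>lborel)"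
proof -
  have "B \<ge> 0" using B[of 0] norm_ge_zero[of "K 0"] by linarith
  \<comment> \<open>A product that is not integrable has integral 0 by convention, so the bound
    survives in that case.\<close>
  show ?thesis
  proof (cases "integrable lborel (\<lambda>y. f y *\<^sub>R K y)")
    case True
    have "norm (\<integral>y. f y *\<^sub>R K y \<partial>lborel) \<le> (\<integral>y. B * \<bar>f y\<bar> \<partial>lborel)"
      by (rule Bochner_Integration.integral_norm_bound_integral[OF True])
         (use f B in \<open>auto simp: mult.commute[of B] intro!: mult_left_mono\<close>)
    then show ?thesis by simp
  qed (use \<open>B \<ge> 0\<close> in \<open>simp add: not_integrable_integral_eq\<close>)
qed

text \<open>Differentiation under the integral: the Taylor remainder of \<open>K\<close> is at most
  \<open>e * norm h\<close> uniformly in the base point, so integrating it against \<open>f\<close>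
  costs only the factor \<open>?L\<close>, the L1 norm of \<open>f\<close>. The modulus of
  continuity of \<open>D\<close> passes through the integral in the same way.\<close>

lemma C1b_conv:
  fixes f :: "'a::euclidean_space \<Rightarrow> real" and K :: "'a \<Rightarrow> 'b::euclidean_space"
  assumes f: "integrable lborel f" and K: "C1b K D"
  shows "C1b (\<lambda>x. \<integral>y. f y *\<^sub>R K (x - y) \<partial>lborel) (\<lambda>x h. \<integral>y. f y *\<^sub>R D (x - y) h \<partial>lborel)"
proof -
  obtain B where B: "B > 0" "\<And>x. norm (K x) \<le> B" "\<And>x h. norm (D x h) \<le> B * norm h"
    using C1b_bound[OF K] by metis
  note [measurable] = C1b_measurable[OF K] borel_measurable_integrable[OF f]
  let ?L = "\<integral>y. \<bar>f y\<bar> \<partial>lborel"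
  have L: "?L \<ge> 0" by simp
  have iK: "integrable lborel (\<lambda>y. f y *\<^sub>R K (x - y))" for x
    by (rule integrable_conv[OF f _ B(2)]) measurable
  have iD: "integrable lborel (\<lambda>y. f y *\<^sub>R D (x - y) h)" for x h
    by (rule integrable_conv[OF f _ B(3)[of _ h]]) measurable
  have linD: "D x (h + h') = D x h + D x h'" "D x (c *\<^sub>R h) = c *\<^sub>R D x h" for x h h' c
    using C1bD(2)[OF K, of x] by (auto simp: linear_add linear_scale)
  have bD: "norm (\<integral>y. f y *\<^sub>R D (x - y) h \<partial>lborel) \<le> (B * ?L) * norm h" for x h
    using norm_conv_le[OF f, where K="\<lambda>y. D (x - y) h" and B="B * norm h"] B(3) by (simp add: mult_ac)
  have blD: "bounded_linear (\<lambda>h. \<integral>y. f y *\<^sub>R D (x - y) h \<partial>lborel)" for x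
  proof (rule bounded_linear_intro[where K="B * ?L"])
    show "(\<integral>y. f y *\<^sub>R D (x - y) (h + h') \<partial>lborel)
        = (\<integral>y. f y *\<^sub>R D (x - y) h \<partial>lborel) + (\<integral>y. f y *\<^sub>R D (x - y) h' \<partial>lborel)" for h h'
      using iD by (simp add: linD scaleR_add_right)
    show "(\<integral>y. f y *\<^sub>R D (x - y) (c *\<^sub>R h) \<partial>lborel) = c *\<^sub>R (\<integral>y. f y *\<^sub>R D (x - y) h \<partial>lborel)" for c h
    proof -
      have "(\<integral>y. f y *\<^sub>R D (x - y) (c *\<^sub>R h) \<partial>lborel) = (\<integral>y. c *\<^sub>R (f y *\<^sub>R D (x - y) h) \<partial>lborel)"
        by (simp only: linD scaleR_scaleR mult.commute)
      also have "\<dots> = c *\<^sub>R (\<integral>y. f y *\<^sub>R D (x - y) h \<partial>lborel)"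
        by (rule integral_scaleR_right)
      finally show ?thesis .
    qed
    show "norm (\<integral>y. f y *\<^sub>R D (x - y) h \<partial>lborel) \<le> norm h * (B * ?L)" for h
      using bD[of x h] by (simp only: mult.commute)
  qed
  \<comment> \<open>The summand 1 prevents a division by zero when \<open>f\<close> vanishes almost
    everywhere.\<close>
  have modulus: "e / (?L + 1) > 0" "e / (?L + 1) * c * ?L \<le> e * c" if "e > 0" "c \<ge> 0" for e c :: real
  proof -
    show "e / (?L + 1) > 0" using that L by (intro divide_pos_pos) linarith+
    have "e * c * ?L \<le> e * c * (?L + 1)" using that L by (intro mult_left_mono) auto
    then have "e * c * ?L / (?L + 1) \<le> e * c"
      using L by (subst pos_divide_le_eq) linarith+
    then show "e / (?L + 1) * c * ?L \<le> e * c" by simp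
  qed
  have der: "((\<lambda>x. \<integral>y. f y *\<^sub>R K (x - y) \<partial>lborel) has_derivative (\<lambda>h. \<integral>y. f y *\<^sub>R D (x - y) h \<partial>lborel)) (at x)" for x
    unfolding has_derivative_at_alt
  proof (intro conjI blD allI impI)
    fix e :: real assume e: "e > 0"
    obtain \<delta> where d: "\<delta> > 0" "\<And>x h. norm h < \<delta> \<Longrightarrow> norm (K (x + h) - K x - D x h) \<le> e / (?L + 1) * norm h"
      using C1b_taylor[OF K modulus(1)[OF e order.refl]] by metis
    show "\<exists>d>0. \<forall>z. norm (z - x) < d \<longrightarrow>
       norm ((\<integral>y. f y *\<^sub>R K (z - y) \<partial>lborel) - (\<integral>y. f y *\<^sub>R K (x - y) \<partial>lborel) - (\<integral>y. f y *\<^sub>R D (x - y) (z - x) \<partial>lborel))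
        \<le> e * norm (z - x)"
    proof (intro exI conjI allI impI)
      show "\<delta> > 0" by fact
      fix z assume z: "norm (z - x) < \<delta>"
      have "(\<integral>y. f y *\<^sub>R K (z - y) \<partial>lborel) - (\<integral>y. f y *\<^sub>R K (x - y) \<partial>lborel) - (\<integral>y. f y *\<^sub>R D (x - y) (z - x) \<partial>lborel)
         = (\<integral>y. f y *\<^sub>R (K (z - y) - K (x - y) - D (x - y) (z - x)) \<partial>lborel)"
        using iK iD by (simp add: scaleR_diff_right)
      also have "norm \<dots> \<le> e / (?L + 1) * norm (z - x) * ?L"
      proof (rule norm_conv_le[OF f])
        fix y
        have "z - y = (x - y) + (z - x)" by simp
        then show "norm (K (z - y) - K (x - y) - D (x - y) (z - x)) \<le> e / (?L + 1) * norm (z - x)"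
          using d(2)[OF z, of "x - y"] by metis
      qed
      also have "\<dots> \<le> e * norm (z - x)" by (rule modulus(2)[OF e]) simp
      finally show "norm ((\<integral>y. f y *\<^sub>R K (z - y) \<partial>lborel) - (\<integral>y. f y *\<^sub>R K (x - y) \<partial>lborel) - (\<integral>y. f y *\<^sub>R D (x - y) (z - x) \<partial>lborel))
        \<le> e * norm (z - x)" .
    qed
  qed
  have "\<exists>\<delta>>0. \<forall>x z h. dist x z < \<delta> \<longrightarrow>
      norm ((\<integral>y. f y *\<^sub>R D (x - y) h \<partial>lborel) - (\<integral>y. f y *\<^sub>R D (z - y) h \<partial>lborel)) \<le> e * norm h"
    if e: "e > 0" for e
  proof -
    obtain \<delta> where d: "\<delta> > 0" "\<And>x y h. dist x y < \<delta> \<Longrightarrow> norm (D x h - D y h) \<le> e / (?L + 1) * norm h"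
      using C1b_modulus[OF K modulus(1)[OF e order.refl]] by metis
    have "norm ((\<integral>y. f y *\<^sub>R D (x - y) h \<partial>lborel) - (\<integral>y. f y *\<^sub>R D (z - y) h \<partial>lborel)) \<le> e * norm h"
      if "dist x z < \<delta>" for x z h
    proof -
      have "(\<integral>y. f y *\<^sub>R D (x - y) h \<partial>lborel) - (\<integral>y. f y *\<^sub>R D (z - y) h \<partial>lborel)
        = (\<integral>y. f y *\<^sub>R (D (x - y) h - D (z - y) h) \<partial>lborel)"
        using iD by (simp add: scaleR_diff_right)
      also have "norm \<dots> \<le> e / (?L + 1) * norm h * ?L"
        by (rule norm_conv_le[OF f], rule d(2)) (use that in \<open>simp add: dist_norm\<close>)
      also have "\<dots> \<le> e * norm h" by (rule modulus(2)[OF e]) simp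
      finally show ?thesis .
    qed
    with d(1) show ?thesis by blast
  qed
  moreover have "norm (\<integral>y. f y *\<^sub>R K (x - y) \<partial>lborel) \<le> B * ?L" for x
    by (rule norm_conv_le[OF f]) (rule B(2))
  ultimately show ?thesis
    unfolding C1b_def using der bD by blast
qed

subsection \<open>Mollifiers\<close>

text \<open>Away from 0 the function is locally a power or zero. At the kink the difference quotient
  lies between 0 and \<open>\<bar>h\<bar> ^ n\<close>, which tends to 0 because
  \<open>n \<ge> 1\<close>.\<close>

lemma DERIV_pos_part_power:
  assumes "n \<ge> 1"
  shows "((\<lambda>u::real. max 0 u ^ Suc n) has_real_derivative real (Suc n) * max 0 u ^ n) (at u)"
proof -
  consider "u > 0" | "u < 0" | "u = 0" by linarith
  then show ?thesis
  proof cases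
    case 1
    have "((\<lambda>u. u ^ Suc n) has_real_derivative real (Suc n) * u ^ n) (at u)"
      using DERIV_pow[of "Suc n" u] by simp
    then have "((\<lambda>u. max 0 u ^ Suc n) has_real_derivative real (Suc n) * u ^ n) (at u)"
      by (rule has_field_derivative_transform_within_open[where S="{0<..}"]) (use 1 in \<open>auto simp: max_def\<close>)
    then show ?thesis using 1 by (simp add: max_def)
  next
    case 2
    have "((\<lambda>u::real. 0) has_real_derivative 0) (at u)" by simp
    then have "((\<lambda>u. max 0 u ^ Suc n) has_real_derivative 0) (at u)"
      by (rule has_field_derivative_transform_within_open[where S="{..<0}"]) (use 2 in \<open>auto simp: max_def\<close>)
    then show ?thesis using 2 assms by (simp add: max_def power_0_left)
  next
    case 3
    have "((\<lambda>h::real. max 0 h ^ Suc n / h) \<longlongrightarrow> 0) (at 0)"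
    proof (rule tendsto_sandwich[where f="\<lambda>_. 0" and h="\<lambda>h. \<bar>h\<bar> ^ n"])
      show "((\<lambda>h::real. \<bar>h\<bar> ^ n) \<longlongrightarrow> 0) (at 0)"
        using assms by (auto intro!: tendsto_eq_intros)
      show "\<forall>\<^sub>F h in at (0::real). max 0 h ^ Suc n / h \<le> \<bar>h\<bar> ^ n"
        by (intro always_eventually allI) (auto simp: max_def)
      show "\<forall>\<^sub>F h in at (0::real). 0 \<le> max 0 h ^ Suc n / h"
        by (intro always_eventually allI) (auto simp: max_def)
    qed simp
    then show ?thesis using 3 assms by (simp add: DERIV_def power_0_left)
  qed
qed

text \<open>The cube makes \<open>bump R\<close> twice continuously differentiable, which is all the smoothness needed.\<close>

definition bump :: "real \<Rightarrow> 'a::euclidean_space \<Rightarrow> real" where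
  "bump R x = max 0 (1 - (x \<bullet> x) / R\<^sup>2) ^ 3"

definition bump_grad :: "real \<Rightarrow> 'a::euclidean_space \<Rightarrow> 'a" where
  "bump_grad R x = (- 6 / R\<^sup>2 * max 0 (1 - (x \<bullet> x) / R\<^sup>2) ^ 2) *\<^sub>R x"

text \<open>Product rule on \<open>bump_grad\<close>: differentiating the square gives
  \<open>- 4 / R\<^sup>2\<close>, and \<open>- 6 / R\<^sup>2\<close> times it gives
  \<open>24 / R ^ 4\<close>. The positive part remains to the first power, continuous but no longer
  differentiable at the boundary of the ball.\<close>

definition bump_hess :: "real \<Rightarrow> 'a::euclidean_space \<Rightarrow> 'a \<Rightarrow> 'a" where
  "bump_hess R x h = (24 / R ^ 4 * max 0 (1 - (x \<bullet> x) / R\<^sup>2) * (x \<bullet> h)) *\<^sub>R x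
     + (- 6 / R\<^sup>2 * max 0 (1 - (x \<bullet> x) / R\<^sup>2) ^ 2) *\<^sub>R h"

lemma has_derivative_pos_part_quadratic:
  assumes "n \<ge> 1" "m = Suc n"
  shows "((\<lambda>x::'a::euclidean_space. max 0 (1 - (x \<bullet> x) / R\<^sup>2) ^ m) has_derivative
     (\<lambda>h. (- 2 * real m / R\<^sup>2 * max 0 (1 - (x \<bullet> x) / R\<^sup>2) ^ n) * (x \<bullet> h))) (at x)"
proof -
  have q: "((\<lambda>x. 1 - (x \<bullet> x) / R\<^sup>2) has_derivative (\<lambda>h. - (2 * (x \<bullet> h)) / R\<^sup>2)) (at x)"
  proof -
    have "((\<lambda>x. x \<bullet> x) has_derivative (\<lambda>h. 2 * (x \<bullet> h))) (at x)"
      by (auto intro!: derivative_eq_intros simp: inner_commute)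
    from has_derivative_diff[OF has_derivative_const bounded_linear.has_derivative[OF bounded_linear_divide this]]
    show ?thesis by simp
  qed
  have p: "((\<lambda>u. max 0 u ^ Suc n) has_derivative (*) (real (Suc n) * max 0 (1 - (x \<bullet> x) / R\<^sup>2) ^ n))
     (at (1 - (x \<bullet> x) / R\<^sup>2))"
    using DERIV_pos_part_power[OF assms(1)] by (simp add: has_field_derivative_def)
  show ?thesis
    using has_derivative_compose[OF q p]
    unfolding assms(2) by (rule has_derivative_eq_rhs) (simp add: fun_eq_iff divide_inverse algebra_simps)
qed

lemma bump_outside: "R > 0 \<Longrightarrow> norm x > R \<Longrightarrow> bump R x = 0"
  and bump_grad_outside: "R > 0 \<Longrightarrow> norm x > R \<Longrightarrow> bump_grad R x = 0"
proof -
  have "max 0 (1 - (x \<bullet> x) / R\<^sup>2) = 0" if "R > 0" "norm x > R"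
  proof -
    have "R\<^sup>2 \<le> (norm x)\<^sup>2" using that by (intro power_mono) auto
    then show ?thesis using that by (simp add: dot_square_norm max_def)
  qed
  then show "R > 0 \<Longrightarrow> norm x > R \<Longrightarrow> bump R x = 0" "R > 0 \<Longrightarrow> norm x > R \<Longrightarrow> bump_grad R x = 0"
    by (auto simp: bump_def bump_grad_def)
qed

lemma bump_nonneg: "bump R x \<ge> 0" and bump_le_1: "bump R x \<le> 1"
  by (auto simp: bump_def intro!: power_le_one)

lemma bump_even: "bump R (- x) = bump R x"
  by (simp add: bump_def)

lemma C1b_bump:
  assumes "R > 0"
  shows "C1b (bump R) (\<lambda>x h. bump_grad R x \<bullet> h)"
proof (rule C1b_compact_support[where R=R])
  show "(bump R has_derivative (\<lambda>h. bump_grad R x \<bullet> h)) (at x)" for x :: 'a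
    using has_derivative_pos_part_quadratic[of 2 3 R x]
    unfolding bump_def[abs_def] bump_grad_def by simp
  show "continuous_on UNIV (\<lambda>x. bump_grad R x \<bullet> i)" for i :: 'a
    unfolding bump_grad_def using assms by (intro continuous_intros) auto
qed (use bump_outside assms in auto)

text \<open>The second derivative is wanted because the gradient of a mollification is itself turned
  into a test field, which has to be continuously differentiable.\<close>

lemma C1b_bump_grad:
  assumes "R > 0"
  shows "C1b (bump_grad R) (bump_hess R)"
proof (rule C1b_compact_support[where R=R])
  show "(bump_grad R has_derivative bump_hess R x) (at x)" for x :: 'a
  proof -
    have "((\<lambda>x. max 0 (1 - (x \<bullet> x) / R\<^sup>2) ^ 2) has_derivative
      (\<lambda>h. - 4 / R\<^sup>2 * max 0 (1 - (x \<bullet> x) / R\<^sup>2) * (x \<bullet> h))) (at x)"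
      using has_derivative_pos_part_quadratic[of 1 2 R x] by simp
    then have "(bump_grad R has_derivative (\<lambda>h. (- 6 / R\<^sup>2 * max 0 (1 - (x \<bullet> x) / R\<^sup>2) ^ 2) *\<^sub>R h
       + (- 6 / R\<^sup>2 * (- 4 / R\<^sup>2 * max 0 (1 - (x \<bullet> x) / R\<^sup>2) * (x \<bullet> h))) *\<^sub>R x)) (at x)"
      unfolding bump_grad_def[abs_def]
      by (intro has_derivative_scaleR has_derivative_mult_right has_derivative_ident)
    moreover have "- 6 / R\<^sup>2 * (- 4 / R\<^sup>2 * max 0 (1 - (x \<bullet> x) / R\<^sup>2) * (x \<bullet> h)) =
       24 / R ^ 4 * max 0 (1 - (x \<bullet> x) / R\<^sup>2) * (x \<bullet> h)" for h
      by (simp add: power4_eq_xxxx power2_eq_square)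
    ultimately show ?thesis
      unfolding bump_hess_def[abs_def] by (simp only: add.commute)
  qed
  show "continuous_on UNIV (\<lambda>x. bump_hess R x i)" for i :: 'a
    unfolding bump_hess_def using assms by (intro continuous_intros) auto
qed (use bump_grad_outside assms in auto)

section \<open>Normalisation of the mollifier\<close>

lemma integrable_compact_support:
  fixes f :: "'a::euclidean_space \<Rightarrow> 'b::euclidean_space"
  assumes f: "continuous_on UNIV f" and R: "\<And>x. norm x > R \<Longrightarrow> f x = 0"
  shows "integrable lborel f"
proof -
  have "integrable lborel (\<lambda>x. indicator (cball 0 R) x *\<^sub>R f x)"
    by (rule borel_integrable_compact) (auto intro: continuous_on_subset[OF f])
  also have "(\<lambda>x. indicator (cball 0 R) x *\<^sub>R f x) = f"
    using R by (auto simp: indicator_def fun_eq_iff)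
  finally show ?thesis .
qed

lemma integrable_bump: "R > 0 \<Longrightarrow> integrable lborel (bump R)"
  by (rule integrable_compact_support[where R=R])
     (use C1b_continuous(1)[OF C1b_bump] bump_outside in auto)

lemma integral_bump_pos:
  assumes "R > 0"
  shows "integral\<^sup>L lborel (bump R :: 'a::euclidean_space \<Rightarrow> real) > 0"
proof -
  have fin: "emeasure lborel (cball 0 (R / 2) :: 'a set) < \<infinity>"
    using assms by (subst emeasure_cball) auto
  \<comment> \<open>On the ball of half the radius the base of the cube is at least 3/4; the cruder
    value 1/2 suffices.\<close>
  have "0 < (1/2) ^ 3 * measure lborel (cball 0 (R / 2) :: 'a set)"
    using assms content_cball_gt_0_iff[of "0::'a" "R/2"] by simp
  also have "\<dots> = (\<integral>x. (1/2) ^ 3 * indicator (cball 0 (R / 2)) (x::'a) \<partial>lborel)" by simp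
  also have "\<dots> \<le> integral\<^sup>L lborel (bump R :: 'a \<Rightarrow> real)"
  proof (rule integral_mono)
    show "integrable lborel (\<lambda>x::'a. (1/2) ^ 3 * indicator (cball 0 (R / 2)) x :: real)"
      using fin by (intro integrable_mult_right integrable_real_indicator) auto
    fix x :: 'a
    show "(1/2) ^ 3 * indicator (cball 0 (R / 2)) x \<le> bump R x"
    proof (cases "norm x \<le> R / 2")
      case True
      then have "(norm x)\<^sup>2 \<le> (R / 2)\<^sup>2" by (intro power_mono) auto
      then have "(x \<bullet> x) / R\<^sup>2 \<le> 1 / 4" using assms
        by (simp add: dot_square_norm power_divide field_simps)
      then have "1 / 2 \<le> max 0 (1 - (x \<bullet> x) / R\<^sup>2)" by linarith
      then have "(1/2) ^ 3 \<le> bump R x" unfolding bump_def by (rule power_mono) simp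
      with True show ?thesis by (simp add: indicator_def)
    qed (simp add: bump_nonneg)
  qed (rule integrable_bump[OF assms])
  finally show ?thesis .
qed

definition moll :: "real \<Rightarrow> 'a::euclidean_space \<Rightarrow> real" where
  "moll R x = bump R x / integral\<^sup>L lborel (bump R :: 'a \<Rightarrow> real)"

definition moll_grad :: "real \<Rightarrow> 'a::euclidean_space \<Rightarrow> 'a" where
  "moll_grad R x = bump_grad R x /\<^sub>R (integral\<^sup>L lborel (bump R :: 'a \<Rightarrow> real))"

lemma C1b_scaleR:
  assumes "C1b K D"
  shows "C1b (\<lambda>x. c *\<^sub>R K x) (\<lambda>x h. c *\<^sub>R D x h)"
proof -
  obtain B where B: "B > 0" "\<And>x. norm (K x) \<le> B" "\<And>x h. norm (D x h) \<le> B * norm h"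
    using C1b_bound[OF assms] by metis
  have "\<exists>\<delta>>0. \<forall>x y h. dist x y < \<delta> \<longrightarrow> norm (c *\<^sub>R D x h - c *\<^sub>R D y h) \<le> e * norm h" if e: "e > 0" for e
  proof -
    obtain \<delta> where d: "\<delta> > 0" "\<And>x y h. dist x y < \<delta> \<Longrightarrow> norm (D x h - D y h) \<le> e / (\<bar>c\<bar> + 1) * norm h"
      using C1b_modulus[OF assms, of "e / (\<bar>c\<bar> + 1)"] e by (metis abs_ge_zero add_nonneg_pos divide_pos_pos zero_less_one)
    have "norm (c *\<^sub>R D x h - c *\<^sub>R D y h) \<le> e * norm h" if "dist x y < \<delta>" for x y h
    proof -
      have "norm (c *\<^sub>R D x h - c *\<^sub>R D y h) = \<bar>c\<bar> * norm (D x h - D y h)"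
        by (metis norm_scaleR scaleR_diff_right)
      also have "\<dots> \<le> (\<bar>c\<bar> + 1) * (e / (\<bar>c\<bar> + 1) * norm h)"
        using d(2)[OF that] by (intro mult_mono) auto
      also have "\<dots> = e * norm h" by simp
      finally show ?thesis .
    qed
    with d(1) show ?thesis by blast
  qed
  moreover have "norm (c *\<^sub>R K x) \<le> \<bar>c\<bar> * B" "norm (c *\<^sub>R D x h) \<le> (\<bar>c\<bar> * B) * norm h" for x h
    using B(2)[of x] B(3)[of x h] by (auto simp: mult.assoc intro!: mult_left_mono)
  ultimately show ?thesis
    unfolding C1b_def using C1bD(1)[OF assms] by (blast intro: has_derivative_scaleR_right)
qed

lemma
  assumes "R > 0"
  shows C1b_moll: "C1b (moll R :: 'a::euclidean_space \<Rightarrow> real) (\<lambda>x h. moll_grad R x \<bullet> h)"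
    and C1b_moll_grad: "\<exists>D. C1b (moll_grad R :: 'a \<Rightarrow> 'a) D"
    and moll_nonneg: "moll R (x::'a) \<ge> 0"
    and moll_outside: "norm (x::'a) > R \<Longrightarrow> moll R x = 0"
    and moll_even: "moll R (- x) = moll R (x::'a)"
    and integrable_moll: "integrable lborel (moll R :: 'a \<Rightarrow> real)"
    and integral_moll: "integral\<^sup>L lborel (moll R :: 'a \<Rightarrow> real) = 1"
proof -
  let ?Z = "integral\<^sup>L lborel (bump R :: 'a \<Rightarrow> real)"
  have Z: "?Z > 0" by (rule integral_bump_pos[OF assms])
  show "C1b (moll R :: 'a \<Rightarrow> real) (\<lambda>x h. moll_grad R x \<bullet> h)"
    using C1b_scaleR[OF C1b_bump[OF assms], of "inverse ?Z"]
    by (simp add: moll_def[abs_def] moll_grad_def divide_inverse mult.commute)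
  show "\<exists>D. C1b (moll_grad R :: 'a \<Rightarrow> 'a) D"
    using C1b_scaleR[OF C1b_bump_grad[OF assms], of "inverse ?Z"]
    by (auto simp: moll_grad_def[abs_def])
  show "moll R x \<ge> 0" using Z by (simp add: moll_def bump_nonneg)
  show "norm x > R \<Longrightarrow> moll R x = 0" by (simp add: moll_def bump_outside assms)
  show "moll R (- x) = moll R x" by (simp add: moll_def bump_even)
  show "integrable lborel (moll R :: 'a \<Rightarrow> real)" unfolding moll_def[abs_def]
    using integrable_bump[OF assms, where 'a='a] by simp
  show "integral\<^sup>L lborel (moll R :: 'a \<Rightarrow> real) = 1" using Z by (simp add: moll_def[abs_def])
qed

subsection \<open>Divergence and integration by parts\<close>

text \<open>Translation invariance replaces the divergence theorem. The integral of
  \<open>u (x + k) - u x\<close> is 0, so the integral of \<open>D x k\<close> is, up to sign, that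
  of the Taylor remainder and hence \<open>o(norm k)\<close>. Being linear in \<open>k\<close>, it
  vanishes.\<close>

lemma integral_derivative_eq_0:
  fixes u :: "'a::euclidean_space \<Rightarrow> 'b::euclidean_space"
  assumes u: "C1b u D" and R: "\<And>x. norm x > R \<Longrightarrow> u x = 0"
  shows "(\<integral>x. D x h \<partial>lborel) = 0"
proof (rule ccontr)
  let ?I = "\<integral>x. D x h \<partial>lborel"
  assume I: "?I \<noteq> 0"
  note [measurable] = C1b_measurable[OF u]
  have DR: "D x k = 0" if "norm x > R" for x k
    by (rule has_derivative_zero_outside[OF C1bD(1)[OF u] R that])
  have iu: "integrable lborel u" by (rule integrable_compact_support[OF C1b_continuous(1)[OF u] R])
  have iD: "integrable lborel (\<lambda>x. D x k)" for k
    by (rule integrable_compact_support[OF C1b_continuous(2)[OF u] DR])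
  \<comment> \<open>Large enough to contain the supports of \<open>u\<close>, of \<open>D\<close>,
    and of every translate of \<open>u\<close> by a \<open>k\<close> with
    \<open>norm k \<le> norm h\<close>.\<close>
  let ?B = "cball 0 (R + norm h) :: 'a set"
  define V where "V = measure lborel ?B"
  have V: "V \<ge> 0" by (simp add: V_def)
  have iB: "integrable lborel (indicator ?B :: 'a \<Rightarrow> real)"
    by (rule integrable_real_indicator) (simp, rule emeasure_lborel_cball_finite)
  \<comment> \<open>The remainder will be bounded by \<open>e * W\<close>; \<open>e\<close> makes
    this half of \<open>norm ?I\<close>, which is the contradiction. The summand 1 keeps
    \<open>W\<close> positive when \<open>h = 0\<close> or \<open>V = 0\<close>.\<close>
  define W where "W = norm h * V + 1"
  have W: "W > 0" using V by (simp add: W_def add_nonneg_pos)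
  define e where "e = norm ?I / (2 * W)"
  have e: "e > 0" "e * W = norm ?I / 2" using I W by (auto simp: e_def)
  obtain \<delta> where d: "\<delta> > 0" "\<And>x h. norm h < \<delta> \<Longrightarrow> norm (u (x + h) - u x - D x h) \<le> e * norm h"
    using C1b_taylor[OF u e(1)] by metis
  \<comment> \<open>The bound 1 keeps the translate inside \<open>?B\<close>, the other bound puts
    \<open>t *\<^sub>R h\<close> within the range of the Taylor estimate.\<close>
  define t where "t = min 1 (\<delta> / (2 * (norm h + 1)))"
  have t: "0 < t" "t \<le> 1" using d(1) by (auto simp: t_def add_nonneg_pos)
  have td: "t * norm h < \<delta>"
  proof -
    have "t * norm h \<le> \<delta> / (2 * (norm h + 1)) * norm h" by (intro mult_right_mono) (auto simp: t_def)
    also have "\<dots> < \<delta>" using d(1) norm_ge_zero[of h]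
      by (simp add: divide_less_eq add_nonneg_pos)
    finally show ?thesis .
  qed
  define k where "k = t *\<^sub>R h"
  have k: "norm k < \<delta>" "norm k \<le> norm h" using t td by (auto simp: k_def mult_left_le_one_le)
  have "(\<integral>x. u (x + k) - u x - D x k \<partial>lborel) = (\<integral>x. u (k + x) \<partial>lborel) - (\<integral>x. u x \<partial>lborel) - (\<integral>x. D x k \<partial>lborel)"
    using integrable_lborel_translate[OF iu, of k] iu iD[of k]
    by (simp add: add.commute)
  also have "(\<integral>x. u (k + x) \<partial>lborel) = (\<integral>x. u x \<partial>lborel)"
    by (rule integral_lborel_translate) measurable
  also have "(\<integral>x. D x k \<partial>lborel) = t *\<^sub>R ?I"
    by (simp add: k_def linear_scale[OF C1bD(2)[OF u]])
  finally have "t * norm ?I = norm (\<integral>x. u (x + k) - u x - D x k \<partial>lborel)" using t by simp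
  also have "\<dots> \<le> (\<integral>x. e * norm k * indicator ?B x \<partial>lborel)"
  proof (rule Bochner_Integration.integral_norm_bound_integral)
    show "integrable lborel (\<lambda>x. u (x + k) - u x - D x k)"
      using integrable_lborel_translate[OF iu, of k] iu iD[of k] by (simp add: add.commute)
    show "integrable lborel (\<lambda>x. e * norm k * indicator ?B x)" using iB by simp
    fix x
    show "norm (u (x + k) - u x - D x k) \<le> e * norm k * indicator ?B x"
    proof (cases "x \<in> ?B")
      case True
      then show ?thesis using d(2)[OF k(1), of x] by simp
    next
      case False
      then have 0: "norm x > R + norm h" by simp
      then have 1: "norm x > R" using norm_ge_zero[of h] by linarith
      have "norm x \<le> norm (x + k) + norm k" using norm_triangle_sub[of x "x+k"] by simp
      then have 2: "norm (x + k) > R" using 0 k(2) by linarith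
      show ?thesis using R[OF 1] R[OF 2] DR[OF 1] False by simp
    qed
  qed
  also have "\<dots> = e * (t * norm h) * V" using t iB by (simp add: V_def k_def)
  finally have "t * norm ?I \<le> t * (e * (norm h * V))" by (simp add: mult_ac)
  then have "norm ?I \<le> e * (norm h * V)" using t by simp
  also have "\<dots> \<le> e * W" using e by (intro mult_left_mono) (auto simp: W_def)
  also have "\<dots> = norm ?I / 2" by (rule e(2))
  finally show False using I by simp
qed

text \<open>The product of \<open>u\<close> and \<open>\<phi>\<close> has compact support because
  \<open>\<phi>\<close> does, so each of its partial derivatives integrates to 0; the diagonal
  components are summed.\<close>

lemma integration_by_parts_divergence:
  fixes u :: "'a::euclidean_space \<Rightarrow> real"
  assumes u: "C1b u (\<lambda>x h. v x \<bullet> h)" and v: "continuous_on UNIV v"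
    and \<phi>: "C1b \<phi> D" and R: "\<And>x. norm x > R \<Longrightarrow> \<phi> x = 0"
  shows "(\<integral>x. u x * (\<Sum>i\<in>Basis. D x i \<bullet> i) \<partial>lborel) = - (\<integral>x. v x \<bullet> \<phi> x \<partial>lborel)"
proof -
  note [continuous_intros] = C1b_continuous[OF \<phi>] C1b_continuous(1)[OF u] v
  define DF where "DF x h = u x *\<^sub>R D x h + (v x \<bullet> h) *\<^sub>R \<phi> x" for x h
  have DR: "D x k = 0" if "norm x > R" for x k
    by (rule has_derivative_zero_outside[OF C1bD(1)[OF \<phi>] R that])
  have F: "C1b (\<lambda>x. u x *\<^sub>R \<phi> x) DF"
  proof (rule C1b_compact_support[where R=R])
    show "((\<lambda>x. u x *\<^sub>R \<phi> x) has_derivative DF x) (at x)" for x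
      unfolding DF_def using has_derivative_scaleR[OF C1bD(1)[OF u] C1bD(1)[OF \<phi>], of x] .
    show "continuous_on UNIV (\<lambda>x. DF x i)" for i
      unfolding DF_def by (intro continuous_intros)
  qed (use R in auto)
  have z: "(\<integral>x. DF x i \<bullet> i \<partial>lborel) = 0" for i
  proof -
    have "integrable lborel (\<lambda>x. DF x i)"
      unfolding DF_def
      by (rule integrable_compact_support[where R=R], intro continuous_intros) (use R DR in auto)
    then have "(\<integral>x. DF x i \<bullet> i \<partial>lborel) = (\<integral>x. DF x i \<partial>lborel) \<bullet> i"
      by simp
    also have "(\<integral>x. DF x i \<partial>lborel) = 0"
      by (rule integral_derivative_eq_0[OF F, of R]) (use R in auto)
    finally show ?thesis by simp
  qed
  have i1: "integrable lborel (\<lambda>x. u x * (D x i \<bullet> i))" for i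
    by (rule integrable_compact_support[where R=R], intro continuous_intros) (use R DR in auto)
  have i2: "integrable lborel (\<lambda>x. (v x \<bullet> i) * (\<phi> x \<bullet> i))" for i
    by (rule integrable_compact_support[where R=R], intro continuous_intros) (use R DR in auto)
  have s: "(\<integral>x. u x * (D x i \<bullet> i) \<partial>lborel) + (\<integral>x. (v x \<bullet> i) * (\<phi> x \<bullet> i) \<partial>lborel) = 0" for i
    using z[of i] i1[of i] i2[of i] by (simp add: DF_def inner_add_left)
  have "(\<integral>x. u x * (\<Sum>i\<in>Basis. D x i \<bullet> i) \<partial>lborel) + (\<integral>x. v x \<bullet> \<phi> x \<partial>lborel)
     = (\<integral>x. (\<Sum>i\<in>Basis. u x * (D x i \<bullet> i)) \<partial>lborel) + (\<integral>x. (\<Sum>i\<in>Basis. (v x \<bullet> i) * (\<phi> x \<bullet> i)) \<partial>lborel)"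
    by (simp only: sum_distrib_left euclidean_inner[symmetric])
  also have "\<dots> = (\<Sum>i\<in>Basis. (\<integral>x. u x * (D x i \<bullet> i) \<partial>lborel) + (\<integral>x. (v x \<bullet> i) * (\<phi> x \<bullet> i) \<partial>lborel))"
    using i1 i2 by (simp add: sum.distrib)
  also have "\<dots> = 0" by (simp add: s)
  finally show ?thesis by simp
qed

section \<open>Passage between the test fields of the perimeter and \<open>C1b\<close>
  fields\<close>

lemma C1c_fields_C1b:
  fixes \<phi> :: "'a::euclidean_space \<Rightarrow> 'a"
  assumes "\<phi> \<in> C1c_fields"
  obtains D R where "C1b \<phi> D" "\<And>x. norm x > R \<Longrightarrow> \<phi> x = 0"
    "\<And>x. divergence \<phi> x = (\<Sum>i\<in>Basis. D x i \<bullet> i)"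
proof -
  from assms obtain D where D: "continuous_on UNIV D" "\<And>x. (\<phi> has_derivative blinfun_apply (D x)) (at x)"
    and c: "compact (closure {x. \<phi> x \<noteq> 0})"
    unfolding C1c_fields_def by blast
  from c obtain R where R: "\<And>x. x \<in> closure {x. \<phi> x \<noteq> 0} \<Longrightarrow> norm x \<le> R"
    by (metis bounded_iff compact_imp_bounded)
  have R': "\<phi> x = 0" if "norm x > R" for x
    using R[of x] that closure_subset[of "{x. \<phi> x \<noteq> 0}"] by force
  have "C1b \<phi> (\<lambda>x. blinfun_apply (D x))"
    by (rule C1b_compact_support[OF D(2) _ R']) (use D(1) in \<open>auto intro!: continuous_intros\<close>)
  moreover have "divergence \<phi> x = (\<Sum>i\<in>Basis. blinfun_apply (D x) i \<bullet> i)" for x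
    unfolding divergence_def using frechet_derivative_at[OF D(2), of x] by simp
  ultimately show ?thesis using that R' by blast
qed

lemma C1b_C1c_fields:
  fixes \<phi> :: "'a::euclidean_space \<Rightarrow> 'a"
  assumes \<phi>: "C1b \<phi> D" and R: "\<And>x. norm x > R \<Longrightarrow> \<phi> x = 0"
  shows "\<phi> \<in> C1c_fields" "divergence \<phi> x = (\<Sum>i\<in>Basis. D x i \<bullet> i)"
proof -
  show "divergence \<phi> x = (\<Sum>i\<in>Basis. D x i \<bullet> i)"
    unfolding divergence_def using frechet_derivative_at[OF C1bD(1)[OF \<phi>], of x] by simp
  have app: "blinfun_apply (Blinfun (D x)) = D x" for x
    using C1bD(2)[OF \<phi>, of x] by (simp add: bounded_linear_Blinfun_apply linear_conv_bounded_linear)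
  have "continuous_on UNIV (\<lambda>x. Blinfun (D x))"
    unfolding continuous_on_iff
  proof (intro ballI allI impI)
    fix x :: 'a and e :: real assume "e > 0"
    then obtain \<delta> where d: "\<delta> > 0" "\<And>x y h. dist x y < \<delta> \<Longrightarrow> norm (D x h - D y h) \<le> e / 2 * norm h"
      using C1b_modulus[OF \<phi>, of "e / 2"] by (metis half_gt_zero)
    have "dist (Blinfun (D y)) (Blinfun (D x)) < e" if "dist y x < \<delta>" for y
    proof -
      have "norm (Blinfun (D y) - Blinfun (D x)) \<le> e / 2"
        by (rule norm_blinfun_bound) (use d(2)[OF that] \<open>e > 0\<close> in \<open>auto simp: blinfun.diff_left app\<close>)
      then show ?thesis using \<open>e > 0\<close> by (simp add: dist_norm)
    qed
    then show "\<exists>d>0. \<forall>x'\<in>UNIV. dist x' x < d \<longrightarrow> dist (Blinfun (D x')) (Blinfun (D x)) < e"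
      using d(1) by blast
  qed
  moreover have "(\<phi> has_derivative blinfun_apply (Blinfun (D x))) (at x)" for x
    using C1bD(1)[OF \<phi>] by (simp add: app)
  moreover have "compact (closure {x. \<phi> x \<noteq> 0})"
  proof -
    have "norm x \<le> R" if "\<phi> x \<noteq> 0" for x using R[of x] that by force
    then have "bounded {x. \<phi> x \<noteq> 0}" by (auto simp: bounded_iff)
    then show ?thesis by simp
  qed
  ultimately show "\<phi> \<in> C1c_fields" unfolding C1c_fields_def by blast
qed

lemma integrable_times_lborel:
  fixes f :: "'a::euclidean_space \<Rightarrow> real" and g :: "'b::euclidean_space \<Rightarrow> real"
  assumes f: "integrable lborel f" and g: "integrable lborel g"
  shows "integrable (lborel \<Otimes>\<^sub>M lborel) (\<lambda>(x, y). f x * g y)"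
proof (rule lborel_pair.Fubini_integrable)
  note [measurable] = borel_measurable_integrable[OF f] borel_measurable_integrable[OF g]
  show "(\<lambda>(x, y). f x * g y) \<in> borel_measurable (lborel \<Otimes>\<^sub>M lborel)" by measurable
  show "integrable lborel (\<lambda>x. \<integral>y. norm (case (x, y) of (x, y) \<Rightarrow> f x * g y) \<partial>lborel)"
    using f by (simp add: abs_mult)
  show "AE x in lborel. integrable lborel (\<lambda>y. case (x, y) of (x, y) \<Rightarrow> f x * g y)"
    using g by simp
qed

text \<open>Convolution with an even kernel is self-adjoint: Fubini, with
  \<open>B * \<bar>f x\<bar> * \<bar>q z\<bar>\<close> as an integrable majorant. This moves a
  mollifier from a test function onto \<open>f\<close>.\<close>

lemma conv_swap:
  fixes f m q :: "'a::euclidean_space \<Rightarrow> real"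
  assumes f: "integrable lborel f" and q: "integrable lborel q"
    and [measurable]: "m \<in> borel_measurable borel" and B: "\<And>x. \<bar>m x\<bar> \<le> B" and even: "\<And>x. m (- x) = m x"
  shows "(\<integral>x. f x * (\<integral>y. m y * q (x - y) \<partial>lborel) \<partial>lborel) = (\<integral>z. (\<integral>x. f x * m (z - x) \<partial>lborel) * q z \<partial>lborel)"
proof -
  note [measurable] = borel_measurable_integrable[OF f] borel_measurable_integrable[OF q]
  have int: "integrable (lborel \<Otimes>\<^sub>M lborel) (\<lambda>(x, z). f x * m (z - x) * q z)"
  proof (rule Bochner_Integration.integrable_bound)
    show "integrable (lborel \<Otimes>\<^sub>M lborel) (\<lambda>(x, z). (B * \<bar>f x\<bar>) * \<bar>q z\<bar>)"
      by (rule integrable_times_lborel) (use f q in auto)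
    show "(\<lambda>(x, z). f x * m (z - x) * q z) \<in> borel_measurable (lborel \<Otimes>\<^sub>M lborel)" by measurable
    have "\<bar>f x * m w * q z\<bar> \<le> \<bar>B * \<bar>f x\<bar> * \<bar>q z\<bar>\<bar>" for w x z
    proof -
      have "\<bar>f x * m w * q z\<bar> = \<bar>m w\<bar> * (\<bar>f x\<bar> * \<bar>q z\<bar>)" by (simp add: abs_mult)
      also have "\<dots> \<le> \<bar>B\<bar> * (\<bar>f x\<bar> * \<bar>q z\<bar>)" using B[of w] by (intro mult_right_mono) auto
      finally show ?thesis by (simp add: abs_mult)
    qed
    then show "AE p in lborel \<Otimes>\<^sub>M lborel. norm (case p of (x, z) \<Rightarrow> f x * m (z - x) * q z)
       \<le> norm (case p of (x, z) \<Rightarrow> (B * \<bar>f x\<bar>) * \<bar>q z\<bar>)"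
      by (intro AE_I2) (simp only: split_beta real_norm_def)
  qed
  have "(\<integral>x. f x * (\<integral>y. m y * q (x - y) \<partial>lborel) \<partial>lborel) = (\<integral>x. (\<integral>z. f x * m (z - x) * q z \<partial>lborel) \<partial>lborel)"
  proof (rule Bochner_Integration.integral_cong[OF refl])
    fix x
    have "(\<integral>y. m y * q (x - y) \<partial>lborel) = (\<integral>z. m (x - z) * q (x - (x - z)) \<partial>lborel)"
      by (rule integral_lborel_reflect[symmetric]) measurable
    also have "\<dots> = (\<integral>z. m (z - x) * q z \<partial>lborel)"
      using even by (simp add: minus_diff_eq[symmetric, of x] del: minus_diff_eq)
    finally show "f x * (\<integral>y. m y * q (x - y) \<partial>lborel) = (\<integral>z. f x * m (z - x) * q z \<partial>lborel)"
      by (simp add: mult.assoc)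
  qed
  also have "\<dots> = (\<integral>z. (\<integral>x. f x * m (z - x) * q z \<partial>lborel) \<partial>lborel)"
    by (rule lborel_pair.Fubini_integral[symmetric]) (use int in simp)
  also have "\<dots> = (\<integral>z. (\<integral>x. f x * m (z - x) \<partial>lborel) * q z \<partial>lborel)" by simp
  finally show ?thesis .
qed

subsection \<open>Translation differences and mollification\<close>

definition moment_const :: "nat \<Rightarrow> real" where
  "moment_const d = 2 * unit_ball_vol (real d - 1) / (real d + 1)"

lemma moment_const_nonneg: "d \<ge> 1 \<Longrightarrow> moment_const d \<ge> 0"
  by (simp add: moment_const_def)

definition shift_diff :: "('a::euclidean_space \<Rightarrow> real) \<Rightarrow> 'a \<Rightarrow> ennreal" where
  "shift_diff f h = (\<integral>\<^sup>+x. ennreal \<bar>f (x + h) - f x\<bar> \<partial>lborel)"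

text \<open>This is \<open>Q(\<rho>)\<close>. Averaging over a whole ball of shifts is what makes
  the constant \<open>m\<close> independent of the direction of the gradient.\<close>

definition ball_diff :: "('a::euclidean_space \<Rightarrow> real) \<Rightarrow> real \<Rightarrow> ennreal" where
  "ball_diff f \<rho> = (\<integral>\<^sup>+h. indicator (cball 0 \<rho>) h * shift_diff f h \<partial>lborel)"

definition mollify :: "real \<Rightarrow> ('a::euclidean_space \<Rightarrow> real) \<Rightarrow> 'a \<Rightarrow> real" where
  "mollify e f x = (\<integral>y. f y * moll e (x - y) \<partial>lborel)"

definition mollify_grad :: "real \<Rightarrow> ('a::euclidean_space \<Rightarrow> real) \<Rightarrow> 'a \<Rightarrow> 'a" where
  "mollify_grad e f x = (\<integral>y. f y *\<^sub>R moll_grad e (x - y) \<partial>lborel)"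

lemma measurable_shift_diff [measurable]:
  assumes [measurable]: "f \<in> borel_measurable borel"
  shows "shift_diff f \<in> borel_measurable borel"
  unfolding shift_diff_def[abs_def] by measurable

lemma C1b_mollify:
  fixes f :: "'a::euclidean_space \<Rightarrow> real"
  assumes f: "integrable lborel f" and e: "e > 0"
  shows "C1b (mollify e f) (\<lambda>x h. mollify_grad e f x \<bullet> h)"
    and "\<exists>D. C1b (mollify_grad e f) D"
proof -
  obtain DG where DG: "C1b (moll_grad e :: 'a \<Rightarrow> 'a) DG" using C1b_moll_grad[OF e] by blast
  then show "\<exists>D. C1b (mollify_grad e f) D"
    unfolding mollify_grad_def[abs_def] using C1b_conv[OF f DG] by blast
  obtain B where B: "\<And>x. norm (moll_grad e (x::'a)) \<le> B" using C1b_bound[OF DG] by metis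
  have i: "integrable lborel (\<lambda>y. f y *\<^sub>R moll_grad e (x - y))" for x :: 'a
    by (rule integrable_conv[OF f C1b_measurable(1)[OF DG] B])
  have "(\<integral>y. f y *\<^sub>R (moll_grad e (x - y) \<bullet> h) \<partial>lborel) = mollify_grad e f x \<bullet> h" for x h
  proof -
    have "mollify_grad e f x \<bullet> h = (\<integral>y. (f y *\<^sub>R moll_grad e (x - y)) \<bullet> h \<partial>lborel)"
      unfolding mollify_grad_def using i[of x] by (intro integral_inner_left[symmetric]) auto
    then show ?thesis by simp
  qed
  then show "C1b (mollify e f) (\<lambda>x h. mollify_grad e f x \<bullet> h)"
    using C1b_conv[OF f C1b_moll[OF e]] unfolding mollify_def[abs_def] by simp
qed

lemma nn_integral_moll:
  assumes "e > 0"
  shows "(\<integral>\<^sup>+z. ennreal (moll e (z::'a::euclidean_space)) \<partial>lborel) = 1"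
  using nn_integral_eq_integral[OF integrable_moll[OF assms, where 'a='a]]
  by (simp add: moll_nonneg[OF assms] integral_moll[OF assms])

lemma measurable_moll:
  assumes "e > 0"
  shows "moll e \<in> borel_measurable (borel :: 'a::euclidean_space measure)"
  using C1b_measurable(1)[OF C1b_moll[OF assms]] .

lemma mollify_eq:
  fixes f :: "'a::euclidean_space \<Rightarrow> real"
  assumes [measurable]: "f \<in> borel_measurable borel" and e: "e > 0"
  shows "mollify e f x = (\<integral>z. moll e z * f (x - z) \<partial>lborel)"
proof -
  note [measurable] = measurable_moll[OF e]
  have "mollify e f x = (\<integral>z. f (x - z) * moll e (x - (x - z)) \<partial>lborel)"
    unfolding mollify_def by (rule integral_lborel_reflect[symmetric]) measurable
  then show ?thesis by (simp add: mult.commute)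
qed

lemma integrable_moll_mult:
  fixes f :: "'a::euclidean_space \<Rightarrow> real"
  assumes "f \<in> borel_measurable borel" "\<And>x. \<bar>f x\<bar> \<le> B" "e > 0"
  shows "integrable lborel (\<lambda>z. moll e z * f (x - z))"
  using integrable_conv[OF integrable_moll[OF assms(3)] assms(1), of B x] assms(2) by simp

text \<open>A mollification is an average of translates of \<open>f\<close> with weights of total
  mass 1, while \<open>shift_diff\<close> is convex and translation invariant.\<close>

lemma shift_diff_mollify_le:
  fixes f :: "'a::euclidean_space \<Rightarrow> real"
  assumes f[measurable]: "f \<in> borel_measurable borel" and B: "\<And>x. \<bar>f x\<bar> \<le> B" and e: "e > 0"
  shows "shift_diff (mollify e f) h \<le> shift_diff f h"
proof -
  note [measurable] = measurable_moll[OF e]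
  have "ennreal \<bar>mollify e f (x + h) - mollify e f x\<bar> \<le> (\<integral>\<^sup>+z. ennreal (moll e z) * ennreal \<bar>f (x - z + h) - f (x - z)\<bar> \<partial>lborel)" for x
  proof -
    have "mollify e f (x + h) - mollify e f x = (\<integral>z. moll e z * (f (x + h - z) - f (x - z)) \<partial>lborel)"
      using integrable_moll_mult[OF f B e] by (simp add: mollify_eq e right_diff_distrib)
    also have "ennreal \<bar>\<dots>\<bar> \<le> (\<integral>\<^sup>+z. norm (moll e z * (f (x + h - z) - f (x - z))) \<partial>lborel)"
      using integrable_moll_mult[OF f B e]
      by (subst real_norm_def[symmetric], intro integral_norm_bound_ennreal) (auto simp: right_diff_distrib)
    also have "\<dots> = (\<integral>\<^sup>+z. ennreal (moll e z) * ennreal \<bar>f (x - z + h) - f (x - z)\<bar> \<partial>lborel)"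
      by (intro nn_integral_cong) (auto simp: abs_mult ennreal_mult moll_nonneg[OF e] add_diff_eq diff_add_eq)
    finally show ?thesis .
  qed
  then have "shift_diff (mollify e f) h \<le>
      (\<integral>\<^sup>+x. (\<integral>\<^sup>+z. ennreal (moll e z) * ennreal \<bar>f (x - z + h) - f (x - z)\<bar> \<partial>lborel) \<partial>lborel)"
    unfolding shift_diff_def by (intro nn_integral_mono)
  also have "\<dots> = (\<integral>\<^sup>+z. (\<integral>\<^sup>+x. ennreal (moll e z) * ennreal \<bar>f (x - z + h) - f (x - z)\<bar> \<partial>lborel) \<partial>lborel)"
    by (rule lborel_pair.Fubini'[symmetric]) measurable
  also have "\<dots> = (\<integral>\<^sup>+z. ennreal (moll e (z::'a)) * shift_diff f h \<partial>lborel)"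
  proof (rule nn_integral_cong)
    fix z
    have "(\<integral>\<^sup>+x. ennreal (moll e z) * ennreal \<bar>f (x - z + h) - f (x - z)\<bar> \<partial>lborel)
      = ennreal (moll e z) * (\<integral>\<^sup>+x. ennreal \<bar>f (- z + x + h) - f (- z + x)\<bar> \<partial>lborel)"
      by (subst nn_integral_cmult) auto
    also have "(\<integral>\<^sup>+x. ennreal \<bar>f (- z + x + h) - f (- z + x)\<bar> \<partial>lborel) = shift_diff f h"
      unfolding shift_diff_def
      by (rule nn_integral_lborel_translate[where f="\<lambda>x. ennreal \<bar>f (x + h) - f x\<bar>"]) measurable
    finally show "(\<integral>\<^sup>+x. ennreal (moll e z) * ennreal \<bar>f (x - z + h) - f (x - z)\<bar> \<partial>lborel)
      = ennreal (moll e z) * shift_diff f h" .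
  qed
  also have "\<dots> = shift_diff f h"
    by (subst nn_integral_multc) (auto simp: nn_integral_moll[OF e])
  finally show ?thesis .
qed

text \<open>\<open>mollify e f - f\<close> is an average of the differences between \<open>f\<close>
  and its translates by vectors of norm at most \<open>e\<close>; longer vectors have weight
  0.\<close>

lemma mollify_L1_le:
  fixes f :: "'a::euclidean_space \<Rightarrow> real"
  assumes f[measurable]: "f \<in> borel_measurable borel" and B: "\<And>x. \<bar>f x\<bar> \<le> B" and e: "e > 0"
    and \<eta>: "\<And>z. norm z \<le> e \<Longrightarrow> shift_diff f z \<le> \<eta>"
  shows "(\<integral>\<^sup>+x. ennreal \<bar>mollify e f x - f x\<bar> \<partial>lborel) \<le> \<eta>"
proof -
  note [measurable] = measurable_moll[OF e]
  have "ennreal \<bar>mollify e f x - f x\<bar> \<le> (\<integral>\<^sup>+z. ennreal (moll e z) * ennreal \<bar>f (x + (- z)) - f x\<bar> \<partial>lborel)" for x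
  proof -
    have i: "integrable lborel (\<lambda>z. moll e (z::'a) * f x)" using integrable_moll[OF e, where 'a='a] by simp
    have "(\<integral>z. moll e (z::'a) * f x \<partial>lborel) = f x" by (simp add: integral_moll[OF e])
    then have "mollify e f x - f x = (\<integral>z. moll e z * f (x - z) \<partial>lborel) - (\<integral>z. moll e (z::'a) * f x \<partial>lborel)"
      by (simp add: mollify_eq e)
    also have "\<dots> = (\<integral>z. moll e z * (f (x - z) - f x) \<partial>lborel)"
      using integrable_moll_mult[OF f B e] i
      by (simp only: right_diff_distrib Bochner_Integration.integral_diff)
    also have "ennreal \<bar>\<dots>\<bar> \<le> (\<integral>\<^sup>+z. norm (moll e z * (f (x - z) - f x)) \<partial>lborel)"
      using integrable_moll_mult[OF f B e] i
      by (subst real_norm_def[symmetric], intro integral_norm_bound_ennreal) (auto simp: right_diff_distrib)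
    also have "\<dots> = (\<integral>\<^sup>+z. ennreal (moll e z) * ennreal \<bar>f (x + (- z)) - f x\<bar> \<partial>lborel)"
      by (intro nn_integral_cong) (auto simp: abs_mult ennreal_mult moll_nonneg[OF e])
    finally show ?thesis .
  qed
  then have "(\<integral>\<^sup>+x. ennreal \<bar>mollify e f x - f x\<bar> \<partial>lborel) \<le>
      (\<integral>\<^sup>+x. (\<integral>\<^sup>+z. ennreal (moll e z) * ennreal \<bar>f (x + (- z)) - f x\<bar> \<partial>lborel) \<partial>lborel)"
    by (intro nn_integral_mono)
  also have "\<dots> = (\<integral>\<^sup>+z. (\<integral>\<^sup>+x. ennreal (moll e z) * ennreal \<bar>f (x + (- z)) - f x\<bar> \<partial>lborel) \<partial>lborel)"
    by (rule lborel_pair.Fubini'[symmetric]) measurable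
  also have "\<dots> = (\<integral>\<^sup>+z. ennreal (moll e z) * shift_diff f (- z) \<partial>lborel)"
    unfolding shift_diff_def by (intro nn_integral_cong nn_integral_cmult) measurable
  also have "\<dots> \<le> (\<integral>\<^sup>+z. ennreal (moll e (z::'a)) * \<eta> \<partial>lborel)"
  proof (rule nn_integral_mono)
    fix z :: 'a
    show "ennreal (moll e z) * shift_diff f (- z) \<le> ennreal (moll e z) * \<eta>"
      using \<eta>[of "- z"] moll_outside[OF e, of z]
      by (cases "norm z \<le> e") (auto intro: mult_left_mono)
  qed
  also have "\<dots> = \<eta>"
    by (subst nn_integral_multc) (auto simp: nn_integral_moll[OF e])
  finally show ?thesis .
qed

text \<open>The triangle inequality through the mollification, whose L1 distance to \<open>f\<close>
  is paid twice, at \<open>x + h\<close> and at \<open>x\<close>.\<close>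

lemma shift_diff_le_mollify:
  fixes f :: "'a::euclidean_space \<Rightarrow> real"
  assumes f[measurable]: "f \<in> borel_measurable borel" and B: "\<And>x. \<bar>f x\<bar> \<le> B" and e: "e > 0"
    and fi: "integrable lborel f" and \<eta>: "\<And>z. norm z \<le> e \<Longrightarrow> shift_diff f z \<le> \<eta>"
  shows "shift_diff f h \<le> shift_diff (mollify e f) h + 2 * \<eta>"
proof -
  have [measurable]: "mollify e f \<in> borel_measurable borel"
    using C1b_measurable(1)[OF C1b_mollify(1)[OF fi e]] .
  let ?g = "\<lambda>x. ennreal \<bar>mollify e f x - f x\<bar>"
  have g: "(\<integral>\<^sup>+x. ?g x \<partial>lborel) \<le> \<eta>" by (rule mollify_L1_le[OF f B e \<eta>])
  have "shift_diff f h \<le> (\<integral>\<^sup>+x. ennreal \<bar>mollify e f (x + h) - mollify e f x\<bar> + (?g (h + x) + ?g x) \<partial>lborel)"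
    unfolding shift_diff_def
    by (intro nn_integral_mono)
       (auto simp: add.commute ennreal_plus[symmetric] simp del: ennreal_plus intro!: ennreal_leI)
  also have "\<dots> = shift_diff (mollify e f) h + ((\<integral>\<^sup>+x. ?g (h + x) \<partial>lborel) + (\<integral>\<^sup>+x. ?g x \<partial>lborel))"
    unfolding shift_diff_def by (subst nn_integral_add, measurable, subst nn_integral_add) auto
  also have "(\<integral>\<^sup>+x. ?g (h + x) \<partial>lborel) = (\<integral>\<^sup>+x. ?g x \<partial>lborel)"
    by (rule nn_integral_lborel_translate) measurable
  also have "shift_diff (mollify e f) h + ((\<integral>\<^sup>+x. ?g x \<partial>lborel) + (\<integral>\<^sup>+x. ?g x \<partial>lborel)) \<le> shift_diff (mollify e f) h + 2 * \<eta>"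
    unfolding mult_2 by (intro add_mono g order.refl)
  finally show ?thesis .
qed

lemma shift_diff_C1b_le:
  fixes u :: "'a::euclidean_space \<Rightarrow> real"
  assumes u: "C1b u (\<lambda>x h. v x \<bullet> h)" and v: "continuous_on UNIV v"
  shows "shift_diff u h \<le> (\<integral>\<^sup>+x. ennreal \<bar>v x \<bullet> h\<bar> \<partial>lborel)"
proof -
  have [measurable]: "v \<in> borel_measurable borel" using v by (rule borel_measurable_continuous_onI)
  have "ennreal \<bar>u (x + h) - u x\<bar> \<le> (\<integral>\<^sup>+t. indicator {0..1::real} t * ennreal \<bar>v (t *\<^sub>R h + x) \<bullet> h\<bar> \<partial>lborel)" for x
  proof -
    have der: "((\<lambda>t. u (t *\<^sub>R h + x)) has_vector_derivative v (t *\<^sub>R h + x) \<bullet> h) (at t within {0..1})" for t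
    proof -
      have "((\<lambda>t. t *\<^sub>R h + x) has_derivative (\<lambda>s. s *\<^sub>R h)) (at t within {0..1})"
        by (auto intro!: derivative_eq_intros)
      from has_derivative_compose[OF this C1bD(1)[OF u]]
      show ?thesis unfolding has_vector_derivative_def by (simp add: mult.commute)
    qed
    have cont: "continuous_on {0..1} (\<lambda>t. v (t *\<^sub>R h + x) \<bullet> h)"
      by (intro continuous_intros continuous_on_compose2[OF v]) auto
    have "u (x + h) - u x = (\<integral>t. indicator {0..1} t *\<^sub>R (v (t *\<^sub>R h + x) \<bullet> h) \<partial>lborel)"
      using integral_FTC_Icc[OF _ der cont] by (simp add: add.commute)
    also have "ennreal \<bar>\<dots>\<bar> \<le> (\<integral>\<^sup>+t. norm (indicator {0..1} t *\<^sub>R (v (t *\<^sub>R h + x) \<bullet> h)) \<partial>lborel)"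
      using borel_integrable_atLeastAtMost'[OF cont]
      by (subst real_norm_def[symmetric], intro integral_norm_bound_ennreal) (auto simp: set_integrable_def)
    also have "\<dots> = (\<integral>\<^sup>+t. indicator {0..1::real} t * ennreal \<bar>v (t *\<^sub>R h + x) \<bullet> h\<bar> \<partial>lborel)"
      by (intro nn_integral_cong) (auto simp: indicator_def)
    finally show ?thesis .
  qed
  then have "shift_diff u h \<le> (\<integral>\<^sup>+x. (\<integral>\<^sup>+t. indicator {0..1::real} t * ennreal \<bar>v (t *\<^sub>R h + x) \<bullet> h\<bar> \<partial>lborel) \<partial>lborel)"
    unfolding shift_diff_def by (intro nn_integral_mono)
  also have "\<dots> = (\<integral>\<^sup>+t. (\<integral>\<^sup>+x. indicator {0..1::real} t * ennreal \<bar>v (t *\<^sub>R h + x) \<bullet> h\<bar> \<partial>lborel) \<partial>lborel)"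
    by (rule lborel_pair.Fubini'[symmetric]) measurable
  also have "\<dots> = (\<integral>\<^sup>+t. indicator {0..1::real} t * (\<integral>\<^sup>+x. ennreal \<bar>v x \<bullet> h\<bar> \<partial>lborel) \<partial>lborel)"
  proof (rule nn_integral_cong)
    fix t :: real
    have "(\<integral>\<^sup>+x. indicator {0..1::real} t * ennreal \<bar>v (t *\<^sub>R h + x) \<bullet> h\<bar> \<partial>lborel) =
      indicator {0..1} t * (\<integral>\<^sup>+x. ennreal \<bar>v (t *\<^sub>R h + x) \<bullet> h\<bar> \<partial>lborel)"
      by (rule nn_integral_cmult) measurable
    also have "(\<integral>\<^sup>+x. ennreal \<bar>v (t *\<^sub>R h + x) \<bullet> h\<bar> \<partial>lborel) = (\<integral>\<^sup>+x. ennreal \<bar>v x \<bullet> h\<bar> \<partial>lborel)"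
      by (rule nn_integral_lborel_translate) measurable
    finally show "(\<integral>\<^sup>+x. indicator {0..1::real} t * ennreal \<bar>v (t *\<^sub>R h + x) \<bullet> h\<bar> \<partial>lborel) =
      indicator {0..1} t * (\<integral>\<^sup>+x. ennreal \<bar>v x \<bullet> h\<bar> \<partial>lborel)" .
  qed
  also have "\<dots> = (\<integral>\<^sup>+x. ennreal \<bar>v x \<bullet> h\<bar> \<partial>lborel)"
    by (subst nn_integral_multc) auto
  finally show ?thesis .
qed

text \<open>By Tonelli the moment formula is applied to the vector \<open>v x\<close> at each point.
  \<open>A\<close> is the whole space for the upper estimate and a ball for the lower one.\<close>

lemma ball_moment_nn_integral:
  fixes v :: "'a::euclidean_space \<Rightarrow> 'a"
  assumes [measurable]: "v \<in> borel_measurable borel" "A \<in> sets borel" and \<rho>: "\<rho> > 0"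
  shows "(\<integral>\<^sup>+h. indicator (cball 0 \<rho>) h * (\<integral>\<^sup>+x. indicator A x * ennreal \<bar>v x \<bullet> h\<bar> \<partial>lborel) \<partial>lborel)
    = ennreal (moment_const DIM('a) * \<rho> ^ (DIM('a) + 1)) * (\<integral>\<^sup>+x. indicator A x * ennreal (norm (v x)) \<partial>lborel)"
proof -
  have "(\<integral>\<^sup>+h. indicator (cball 0 \<rho>) h * (\<integral>\<^sup>+x. indicator A x * ennreal \<bar>v x \<bullet> h\<bar> \<partial>lborel) \<partial>lborel)
     = (\<integral>\<^sup>+h. (\<integral>\<^sup>+x. indicator (cball 0 \<rho>) h * (indicator A x * ennreal \<bar>v x \<bullet> h\<bar>) \<partial>lborel) \<partial>lborel)"
    by (intro nn_integral_cong nn_integral_cmult[symmetric]) measurable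
  also have "\<dots> = (\<integral>\<^sup>+x. (\<integral>\<^sup>+h. indicator (cball 0 \<rho>) h * (indicator A x * ennreal \<bar>v x \<bullet> h\<bar>) \<partial>lborel) \<partial>lborel)"
    by (rule lborel_pair.Fubini') measurable
  also have "\<dots> = (\<integral>\<^sup>+x. ennreal (moment_const DIM('a) * \<rho> ^ (DIM('a) + 1)) * (indicator A x * ennreal (norm (v x))) \<partial>lborel)"
  proof (rule nn_integral_cong)
    fix x
    have "(\<integral>\<^sup>+h. indicator (cball 0 \<rho>) h * (indicator A x * ennreal \<bar>v x \<bullet> h\<bar>) \<partial>lborel)
      = indicator A x * (\<integral>\<^sup>+h. indicator (cball 0 \<rho>) h * ennreal \<bar>v x \<bullet> h\<bar> \<partial>lborel)"
      by (subst nn_integral_cmult[symmetric]) (auto simp: mult_ac)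
    also have "\<dots> = ennreal (moment_const DIM('a) * \<rho> ^ (DIM('a) + 1)) * (indicator A x * ennreal (norm (v x)))"
      using \<rho> by (subst ball_moment[OF \<rho>], subst ennreal_mult)
        (auto simp: moment_const_def[symmetric] moment_const_nonneg mult_ac Suc_leI)
    finally show "(\<integral>\<^sup>+h. indicator (cball 0 \<rho>) h * (indicator A x * ennreal \<bar>v x \<bullet> h\<bar>) \<partial>lborel)
      = ennreal (moment_const DIM('a) * \<rho> ^ (DIM('a) + 1)) * (indicator A x * ennreal (norm (v x)))" .
  qed
  also have "\<dots> = ennreal (moment_const DIM('a) * \<rho> ^ (DIM('a) + 1)) * (\<integral>\<^sup>+x. indicator A x * ennreal (norm (v x)) \<partial>lborel)"
    by (rule nn_integral_cmult) measurable
  finally show ?thesis .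
qed

lemma ball_diff_C1b_le:
  fixes u :: "'a::euclidean_space \<Rightarrow> real"
  assumes u: "C1b u (\<lambda>x h. v x \<bullet> h)" and v: "continuous_on UNIV v" and \<rho>: "\<rho> > 0"
  shows "ball_diff u \<rho> \<le> ennreal (moment_const DIM('a) * \<rho> ^ (DIM('a) + 1)) * (\<integral>\<^sup>+x. ennreal (norm (v x)) \<partial>lborel)"
proof -
  have [measurable]: "v \<in> borel_measurable borel" using v by (rule borel_measurable_continuous_onI)
  have "ball_diff u \<rho> \<le> (\<integral>\<^sup>+h. indicator (cball 0 \<rho>) h * (\<integral>\<^sup>+x. indicator UNIV x * ennreal \<bar>v x \<bullet> h\<bar> \<partial>lborel) \<partial>lborel)"
    unfolding ball_diff_def
    by (intro nn_integral_mono mult_left_mono) (auto intro: shift_diff_C1b_le[OF u v])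
  also have "\<dots> = ennreal (moment_const DIM('a) * \<rho> ^ (DIM('a) + 1)) * (\<integral>\<^sup>+x. indicator UNIV x * ennreal (norm (v x)) \<partial>lborel)"
    by (rule ball_moment_nn_integral[OF _ _ \<rho>]) auto
  finally show ?thesis by simp
qed

text \<open>The Taylor remainder is small uniformly but need not be integrable over the whole space,
  so the gradient is integrated over a ball of radius \<open>R\<close> only.\<close>

lemma ball_diff_C1b_ge:
  fixes u :: "'a::euclidean_space \<Rightarrow> real"
  assumes u: "C1b u (\<lambda>x h. v x \<bullet> h)" and v: "continuous_on UNIV v" and \<eta>: "\<eta> > 0" and R: "R > 0"
  obtains \<delta> where "\<delta> > 0" "\<And>\<rho>. 0 < \<rho> \<Longrightarrow> \<rho> < \<delta> \<Longrightarrow>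
     ennreal (moment_const DIM('a) * \<rho> ^ (DIM('a) + 1)) * (\<integral>\<^sup>+x. indicator (cball 0 R) x * ennreal (norm (v x)) \<partial>lborel)
     \<le> ball_diff u \<rho> + ennreal (\<eta> * \<rho> ^ (DIM('a) + 1))"
proof -
  let ?d = "DIM('a)"
  let ?w = "unit_ball_vol (real ?d)"
  note [measurable] = C1b_measurable(1)[OF u]
  have [measurable]: "v \<in> borel_measurable borel" using v by (rule borel_measurable_continuous_onI)
  \<comment> \<open>A remainder of \<open>\<eta>' * \<rho>\<close> is integrated over a ball of
    radius \<open>R\<close> in \<open>x\<close> and one of radius \<open>\<rho>\<close> in
    \<open>h\<close>; dividing by the two volume constants leaves
    \<open>\<eta> * \<rho> ^ (?d + 1)\<close>.\<close>
  define \<eta>' where "\<eta>' = \<eta> / (?w * R ^ ?d * ?w)"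
  have w: "?w > 0" by simp
  have \<eta>': "\<eta>' > 0" using \<eta> R w by (simp add: \<eta>'_def del: unit_ball_vol_pos)
  obtain \<delta> where d: "\<delta> > 0" "\<And>x h. norm h < \<delta> \<Longrightarrow> norm (u (x + h) - u x - v x \<bullet> h) \<le> \<eta>' * norm h"
    using C1b_taylor[OF u \<eta>'] by metis
  have "ennreal (moment_const ?d * \<rho> ^ (?d + 1)) * (\<integral>\<^sup>+x. indicator (cball 0 R) x * ennreal (norm (v x)) \<partial>lborel)
     \<le> ball_diff u \<rho> + ennreal (\<eta> * \<rho> ^ (?d + 1))" if \<rho>: "0 < \<rho>" "\<rho> < \<delta>" for \<rho>
  proof -
    have "(\<integral>\<^sup>+x. indicator (cball 0 R) x * ennreal \<bar>v x \<bullet> h\<bar> \<partial>lborel)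
        \<le> shift_diff u h + ennreal (\<eta>' * \<rho> * (?w * R ^ ?d))" if h: "norm h \<le> \<rho>" for h
    proof -
      have "(\<integral>\<^sup>+x. indicator (cball 0 R) x * ennreal \<bar>v x \<bullet> h\<bar> \<partial>lborel)
        \<le> (\<integral>\<^sup>+x. ennreal \<bar>u (x + h) - u x\<bar> + ennreal (\<eta>' * \<rho>) * indicator (cball 0 R) x \<partial>lborel)"
      proof (rule nn_integral_mono)
        fix x
        have "\<eta>' * norm h \<le> \<eta>' * \<rho>" using \<eta>' h by (intro mult_left_mono) auto
        moreover have "norm (u (x + h) - u x - v x \<bullet> h) \<le> \<eta>' * norm h" using d(2)[of h x] h \<rho> by simp
        ultimately have "\<bar>v x \<bullet> h\<bar> \<le> \<bar>u (x + h) - u x\<bar> + \<eta>' * \<rho>" by (simp add: abs_if split: if_splits)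
        then have "ennreal \<bar>v x \<bullet> h\<bar> \<le> ennreal \<bar>u (x + h) - u x\<bar> + ennreal (\<eta>' * \<rho>)"
          using \<eta>' \<rho> by (subst ennreal_plus[symmetric]) (auto intro!: ennreal_leI simp del: ennreal_plus)
        then show "indicator (cball 0 R) x * ennreal \<bar>v x \<bullet> h\<bar> \<le> ennreal \<bar>u (x + h) - u x\<bar> + ennreal (\<eta>' * \<rho>) * indicator (cball 0 R) x"
          by (auto simp: indicator_def)
      qed
      also have "\<dots> = shift_diff u h + ennreal (\<eta>' * \<rho>) * emeasure lborel (cball 0 R :: 'a set)"
        unfolding shift_diff_def by (subst nn_integral_add) (auto simp: nn_integral_cmult)
      also have "ennreal (\<eta>' * \<rho>) * emeasure lborel (cball 0 R :: 'a set) = ennreal (\<eta>' * \<rho> * (?w * R ^ ?d))"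
        using R \<eta>' \<rho> by (subst emeasure_cball) (auto simp: ennreal_mult[symmetric])
      finally show ?thesis .
    qed
    then have "(\<integral>\<^sup>+h. indicator (cball 0 \<rho>) h * (\<integral>\<^sup>+x. indicator (cball 0 R) x * ennreal \<bar>v x \<bullet> h\<bar> \<partial>lborel) \<partial>lborel)
      \<le> (\<integral>\<^sup>+h. indicator (cball 0 \<rho>) h * shift_diff u h + ennreal (\<eta>' * \<rho> * (?w * R ^ ?d)) * indicator (cball 0 \<rho>) h \<partial>lborel)"
      by (intro nn_integral_mono) (auto simp: indicator_def)
    also have "\<dots> = ball_diff u \<rho> + ennreal (\<eta>' * \<rho> * (?w * R ^ ?d)) * emeasure lborel (cball 0 \<rho> :: 'a set)"
      unfolding ball_diff_def by (subst nn_integral_add) (auto simp: nn_integral_cmult)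
    also have "ennreal (\<eta>' * \<rho> * (?w * R ^ ?d)) * emeasure lborel (cball 0 \<rho> :: 'a set) = ennreal (\<eta>' * \<rho> * (?w * R ^ ?d) * (?w * \<rho> ^ ?d))"
      using R \<eta>' \<rho> by (subst emeasure_cball) (auto simp: ennreal_mult[symmetric])
    also have "\<eta>' * \<rho> * (?w * R ^ ?d) * (?w * \<rho> ^ ?d) = \<eta> * \<rho> ^ (?d + 1)"
    proof -
      have "?w * R ^ ?d * ?w \<noteq> 0" using R w by (simp del: unit_ball_vol_pos)
      then have "\<eta>' * (?w * R ^ ?d * ?w) = \<eta>" by (simp add: \<eta>'_def)
      moreover have "\<eta>' * \<rho> * (?w * R ^ ?d) * (?w * \<rho> ^ ?d) = \<eta>' * (?w * R ^ ?d * ?w) * \<rho> ^ (?d + 1)"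
        by (simp add: mult_ac)
      ultimately show ?thesis by simp
    qed
    finally show ?thesis by (subst ball_moment_nn_integral[symmetric]) (use \<rho> in auto)
  qed
  with d(1) that show ?thesis by blast
qed

subsection \<open>Approximation of finite measure sets\<close>

text \<open>The complement of an open set tightly enclosing \<open>- E\<close> is a closed subset of
  \<open>E\<close>. It is cut off by a large ball, outside of which little of the finite measure of
  \<open>E\<close> remains.\<close>

lemma finite_measure_inner_compact:
  fixes E :: "'a::euclidean_space set"
  assumes [measurable]: "E \<in> sets borel" and fin: "emeasure lborel E < \<infinity>" and \<eta>: "\<eta> > (0::real)"
  obtains K where "compact K" "K \<subseteq> E" "emeasure lborel (E - K) \<le> ennreal \<eta>"
proof -
  have "- E \<in> sets borel" by simp
  then obtain U where U: "open U" "- E \<subseteq> U" "emeasure lborel (U - - E) < ennreal (\<eta> / 2)"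
    by (rule outer_regular_lborel[of _ "\<eta> / 2"]) (use \<eta> in auto)
  let ?A = "\<lambda>n. E - cball 0 (real n)"
  have "(\<lambda>n. emeasure lborel (?A n)) \<longlonglongrightarrow> emeasure lborel (\<Inter>n. ?A n)"
  proof (rule Lim_emeasure_decseq)
    show "range ?A \<subseteq> sets lborel" by auto
    show "decseq ?A" by (auto simp: decseq_def)
    have "emeasure lborel (?A n) \<le> emeasure lborel E" for n by (rule emeasure_mono) auto
    then show "emeasure lborel (?A n) \<noteq> \<infinity>" for n using fin by (metis less_le_not_le top_unique infinity_ennreal_def)
  qed
  also have "(\<Inter>n. ?A n) = {}"
  proof -
    have "\<exists>n. norm x \<le> real n" for x :: 'a by (rule real_arch_simple)
    then show ?thesis by auto
  qed
  finally have lim: "(\<lambda>n. emeasure lborel (?A n)) \<longlonglongrightarrow> 0" by simp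
  have "\<forall>\<^sub>F n in sequentially. emeasure lborel (?A n) < ennreal (\<eta> / 2)"
    by (rule order_tendstoD(2)[OF lim]) (use \<eta> in auto)
  then obtain n where n: "emeasure lborel (?A n) < ennreal (\<eta> / 2)"
    by (auto simp: eventually_sequentially)
  define K where "K = - U \<inter> cball 0 (real n)"
  have "compact K" unfolding K_def using U(1) by (intro closed_Int_compact) auto
  moreover have "K \<subseteq> E" using U(2) by (auto simp: K_def)
  moreover have "emeasure lborel (E - K) \<le> ennreal \<eta>"
  proof -
    have [measurable]: "U \<in> sets borel" using U(1) by simp
    have "E - K = (U - - E) \<union> ?A n" by (auto simp: K_def)
    then have "emeasure lborel (E - K) \<le> emeasure lborel (U - - E) + emeasure lborel (?A n)"
      by (simp del: Diff_Compl) (intro emeasure_subadditive, auto)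
    also have "\<dots> \<le> ennreal (\<eta> / 2) + ennreal (\<eta> / 2)" using U(3) n by (intro add_mono less_imp_le)
    also have "\<dots> = ennreal \<eta>" using \<eta> by (simp add: ennreal_plus[symmetric] del: ennreal_plus)
    finally show ?thesis .
  qed
  ultimately show ?thesis using that by blast
qed

text \<open>Continuity of translations in L1 for indicators. Squeeze \<open>E\<close> between a
  compact \<open>K\<close> and an open \<open>U\<close> with \<open>U - K\<close> small. A shift
  shorter than the margin of \<open>K\<close> inside \<open>U\<close> keeps \<open>K\<close> in
  \<open>U\<close>, so wherever the indicator changes, \<open>x\<close> or \<open>x + z\<close> lies
  in \<open>U - K\<close>.\<close>

lemma shift_diff_indicator_small:
  fixes E :: "'a::euclidean_space set"
  assumes E[measurable]: "E \<in> sets borel" and fin: "emeasure lborel E < \<infinity>" and \<eta>: "\<eta> > (0::real)"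
  obtains e where "e > 0" "\<And>z. norm z \<le> e \<Longrightarrow> shift_diff (indicator E) z \<le> ennreal \<eta>"
proof -
  obtain K where K: "compact K" "K \<subseteq> E" "emeasure lborel (E - K) \<le> ennreal (\<eta> / 4)"
    using finite_measure_inner_compact[OF E fin, of "\<eta> / 4"] \<eta> by auto
  obtain U where U: "open U" "E \<subseteq> U" "emeasure lborel (U - E) < ennreal (\<eta> / 4)"
    using outer_regular_lborel[OF E, of "\<eta> / 4"] \<eta> by auto
  have [measurable]: "K \<in> sets borel" "U \<in> sets borel"
    using K(1) U(1) by (auto intro: borel_closed compact_imp_closed)
  have UK: "emeasure lborel (U - K) \<le> ennreal (\<eta> / 2)"
  proof -
    have "U - K = (U - E) \<union> (E - K)" using K U by auto
    then have "emeasure lborel (U - K) \<le> emeasure lborel (U - E) + emeasure lborel (E - K)"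
      by (simp only:) (intro emeasure_subadditive, auto)
    also have "\<dots> \<le> ennreal (\<eta> / 4) + ennreal (\<eta> / 4)" using U(3) K(3) by (intro add_mono) auto
    also have "\<dots> = ennreal (\<eta> / 2)" using \<eta> by (simp add: ennreal_plus[symmetric] del: ennreal_plus)
    finally show ?thesis .
  qed
  obtain e where e: "e > 0" "(\<Union>x\<in>K. cball x e) \<subseteq> U"
    using compact_subset_open_imp_cball_epsilon_subset[OF K(1) U(1)] K(2) U(2) by blast
  have "shift_diff (indicator E) z \<le> ennreal \<eta>" if z: "norm z \<le> e" for z
  proof -
    have "shift_diff (indicator E) z \<le> (\<integral>\<^sup>+x. indicator (U - K) (z + x) + indicator (U - K) x \<partial>lborel)"
      unfolding shift_diff_def
    proof (rule nn_integral_mono)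
      fix x
      have 1: "x + z \<in> U" if "x \<in> K"
      proof -
        have "x + z \<in> cball x e" using z by (simp add: dist_norm)
        then show ?thesis using e(2) that by blast
      qed
      have 2: "x \<in> U" if "x + z \<in> K"
      proof -
        have "x \<in> cball (x + z) e" using z by (simp add: dist_norm)
        then show ?thesis using e(2) that by blast
      qed
      show "ennreal \<bar>indicator E (x + z) - indicator E x\<bar> \<le> indicator (U - K) (z + x) + indicator (U - K) x"
        using 1 2 K(2) U(2) by (auto simp: indicator_def add.commute)
    qed
    also have "\<dots> = (\<integral>\<^sup>+x. indicator (U - K) (z + x) \<partial>lborel) + emeasure lborel (U - K)"
      by (subst nn_integral_add) auto
    also have "(\<integral>\<^sup>+x. indicator (U - K) (z + x) \<partial>lborel) = emeasure lborel (U - K)"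
      by (subst nn_integral_lborel_translate) auto
    also have "emeasure lborel (U - K) + emeasure lborel (U - K) \<le> ennreal (\<eta> / 2) + ennreal (\<eta> / 2)"
      by (intro add_mono UK)
    also have "\<dots> = ennreal \<eta>" using \<eta> by (simp add: ennreal_plus[symmetric] del: ennreal_plus)
    finally show ?thesis .
  qed
  with e(1) that show ?thesis by blast
qed

lemma integrable_indicator_lborel:
  fixes E :: "'a::euclidean_space set"
  assumes "E \<in> sets borel" "emeasure lborel E < \<infinity>"
  shows "integrable lborel (indicator E :: 'a \<Rightarrow> real)"
  using assms by (intro integrable_real_indicator) auto

section \<open>Moving the mollifier onto the test field\<close>

abbreviation trace_of :: "('a::euclidean_space \<Rightarrow> 'a \<Rightarrow> 'a) \<Rightarrow> 'a \<Rightarrow> real" where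
  "trace_of D x \<equiv> (\<Sum>i\<in>Basis. D x i \<bullet> i)"

lemma trace_compact_support:
  assumes \<phi>: "C1b \<phi> D" and R: "\<And>x. norm x > R \<Longrightarrow> \<phi> x = 0"
  shows "continuous_on UNIV (trace_of D)" "\<And>x. norm x > R \<Longrightarrow> trace_of D x = 0"
proof -
  show "continuous_on UNIV (trace_of D)"
    by (intro continuous_intros C1b_continuous(2)[OF \<phi>])
  show "trace_of D x = 0" if "norm x > R" for x
    using has_derivative_zero_outside[OF C1bD(1)[OF \<phi>] R that] by simp
qed

text \<open>A mollified test field is again admissible: averaging keeps the norm at most 1, and the
  support grows by \<open>e\<close>. Hence a bound on the variation of \<open>f\<close> is inherited
  by its mollifications, with no loss in the constant.\<close>

lemma mollify_field:
  fixes f :: "'a::euclidean_space \<Rightarrow> real"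
  assumes f: "integrable lborel f" and e: "e > 0"
    and \<phi>: "C1b \<phi> D" and R: "\<And>x. norm x > R \<Longrightarrow> \<phi> x = 0" and 1: "\<And>x. norm (\<phi> x) \<le> 1"
  obtains \<psi> D' R' where "C1b \<psi> D'" "\<And>x. norm x > R' \<Longrightarrow> \<psi> x = 0" "\<And>x. norm (\<psi> x) \<le> 1"
    "\<And>x. trace_of D' x = (\<integral>y. moll e y * trace_of D (x - y) \<partial>lborel)"
    "(\<integral>x. f x * trace_of D' x \<partial>lborel) = (\<integral>x. mollify e f x * trace_of D x \<partial>lborel)"
proof -
  note [measurable] = C1b_measurable[OF \<phi>] measurable_moll[OF e]
  note im = integrable_moll[OF e, where 'a='a]
  define \<psi> where "\<psi> x = (\<integral>y. moll e y *\<^sub>R \<phi> (x - y) \<partial>lborel)" for x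
  define D' where "D' x h = (\<integral>y. moll e y *\<^sub>R D (x - y) h \<partial>lborel)" for x h
  have C: "C1b \<psi> D'" unfolding \<psi>_def[abs_def] D'_def[abs_def] by (rule C1b_conv[OF im \<phi>])
  have supp: "\<psi> x = 0" if x: "norm x > R + e" for x
  proof -
    have z: "moll e y *\<^sub>R \<phi> (x - y) = 0" for y
    proof (cases "norm y > e")
      case False
      then have "norm (x - y) > R" using norm_triangle_ineq2[of x y] x by linarith
      then show ?thesis using R by simp
    qed (simp add: moll_outside[OF e])
    show ?thesis by (simp only: \<psi>_def z integral_zero)
  qed
  have n1: "norm (\<psi> x) \<le> 1" for x
    using norm_conv_le[OF im, of "\<lambda>y. \<phi> (x - y)" 1] 1
    by (simp add: \<psi>_def moll_nonneg[OF e] integral_moll[OF e])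
  obtain B where B: "\<And>x h. norm (D x h) \<le> B * norm h" using C1b_bound[OF \<phi>] by metis
  have iD: "integrable lborel (\<lambda>y. moll e y *\<^sub>R D (x - y) h)" for x h
    by (rule integrable_conv[OF im _ B[of _ h]]) measurable
  have tr: "trace_of D' x = (\<integral>y. moll e y * trace_of D (x - y) \<partial>lborel)" for x
  proof -
    have "trace_of D' x = (\<Sum>i\<in>Basis. (\<integral>y. (moll e y *\<^sub>R D (x - y) i) \<bullet> i \<partial>lborel))"
      unfolding D'_def by (intro sum.cong refl integral_inner_left[symmetric]) (rule iD)
    also have "\<dots> = (\<integral>y. (\<Sum>i\<in>Basis. (moll e y *\<^sub>R D (x - y) i) \<bullet> i) \<partial>lborel)"
      by (intro Bochner_Integration.integral_sum[symmetric] integrable_inner_left iD)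
    finally show ?thesis by (simp add: sum_distrib_left)
  qed
  obtain Bm where Bm: "\<And>x. norm (moll e (x::'a)) \<le> Bm" using C1b_bound[OF C1b_moll[OF e]] by metis
  have iq: "integrable lborel (trace_of D)"
    by (rule integrable_compact_support[where R=R]) (use trace_compact_support[OF \<phi>, of R] R in auto)
  have "(\<integral>x. f x * trace_of D' x \<partial>lborel) = (\<integral>x. mollify e f x * trace_of D x \<partial>lborel)"
    unfolding tr mollify_def
    by (rule conv_swap[where B=Bm]) (use f iq Bm in \<open>auto simp: moll_even[OF e]\<close>)
  with C supp n1 tr that show ?thesis by blast
qed

text \<open>The approximation is made on the side of the test field: its divergence is uniformly
  continuous, so the mollified divergence is uniformly close to it, and pairing with the integrable
  \<open>f\<close> preserves the strict inequality.\<close>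

lemma mollify_trace_close:
  fixes f :: "'a::euclidean_space \<Rightarrow> real"
  assumes f: "integrable lborel f"
    and \<phi>: "C1b \<phi> D" and R: "\<And>x. norm x > R \<Longrightarrow> \<phi> x = 0" and 1: "\<And>x. norm (\<phi> x) \<le> 1"
    and a: "a < (\<integral>x. f x * trace_of D x \<partial>lborel)"
  obtains e where "e > 0" "a < (\<integral>x. mollify e f x * trace_of D x \<partial>lborel)"
proof -
  let ?I = "\<integral>x. f x * trace_of D x \<partial>lborel" and ?L = "\<integral>x. \<bar>f x\<bar> \<partial>lborel"
  let ?q = "trace_of D"
  have L: "?L \<ge> 0" by simp
  \<comment> \<open>A uniform error \<open>\<eta>\<close> in the divergence costs at most
    \<open>\<eta> * ?L\<close>, strictly less than the available gap \<open>?I - a\<close>.\<close>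
  define \<eta> where "\<eta> = (?I - a) / (?L + 1)"
  have \<eta>: "\<eta> > 0" unfolding \<eta>_def using a L by (intro divide_pos_pos) linarith+
  have \<eta>L: "\<eta> * ?L < ?I - a"
  proof -
    have "?L + 1 \<noteq> 0" using L by linarith
    then have "\<eta> * (?L + 1) = ?I - a" unfolding \<eta>_def by simp
    then show ?thesis using \<eta> by (simp add: distrib_left)
  qed
  have q: "continuous_on UNIV ?q" "\<And>x. norm x > R \<Longrightarrow> ?q x = 0"
    using trace_compact_support[OF \<phi>, of R] R by auto
  have "uniformly_continuous_on UNIV ?q" by (rule compact_support_uniformly_continuous[OF q(1), of R]) (rule q(2))
  then obtain \<delta> where d: "\<delta> > 0" "\<And>x y. dist y x < \<delta> \<Longrightarrow> dist (?q y) (?q x) < \<eta>"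
    using \<eta> unfolding uniformly_continuous_on_def by (metis UNIV_I)
  define e where "e = \<delta> / 2"
  have e: "e > 0" "e < \<delta>" using d(1) by (auto simp: e_def)
  note im = integrable_moll[OF e(1), where 'a='a]
  obtain \<psi> D' R' where D': "C1b \<psi> D'" and "\<And>x. norm x > R' \<Longrightarrow> \<psi> x = 0" "\<And>x. norm (\<psi> x) \<le> 1"
    and D'': "\<And>x. trace_of D' x = (\<integral>y. moll e y * ?q (x - y) \<partial>lborel)"
    "(\<integral>x. f x * trace_of D' x \<partial>lborel) = (\<integral>x. mollify e f x * ?q x \<partial>lborel)"
    by (rule mollify_field[OF f e(1) \<phi> R 1]) (assumption, rule that)
  obtain Bq where Bq: "\<And>x. norm (?q x) \<le> Bq" by (rule compact_support_bounded[OF q(1), of R]) (use q(2) in auto)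
  have mq: "?q \<in> borel_measurable borel" by (rule borel_measurable_continuous_onI[OF q(1)])
  have close: "\<bar>trace_of D' x - ?q x\<bar> \<le> \<eta>" for x
  proof -
    have i1: "integrable lborel (\<lambda>y. moll e y * ?q (x - y))"
      using integrable_conv[OF im mq Bq, of x] by simp
    have i2: "integrable lborel (\<lambda>y. moll e (y::'a) * ?q x)" using im by simp
    have "?q x = (\<integral>y. moll e (y::'a) * ?q x \<partial>lborel)" by (simp add: integral_moll[OF e(1)])
    then have "trace_of D' x - ?q x = (\<integral>y. moll e y * ?q (x - y) \<partial>lborel) - (\<integral>y. moll e (y::'a) * ?q x \<partial>lborel)"
      unfolding D''(1) by simp
    also have "\<dots> = (\<integral>y. moll e y * (?q (x - y) - ?q x) \<partial>lborel)"
      using i1 i2 by (simp only: right_diff_distrib Bochner_Integration.integral_diff)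
    also have "\<bar>\<dots>\<bar> \<le> (\<integral>y. moll e (y::'a) * \<eta> \<partial>lborel)"
    proof (subst real_norm_def[symmetric], rule Bochner_Integration.integral_norm_bound_integral)
      show "integrable lborel (\<lambda>y. moll e y * (?q (x - y) - ?q x))"
        using i1 i2 by (simp only: right_diff_distrib Bochner_Integration.integrable_diff)
      show "integrable lborel (\<lambda>y. moll e (y::'a) * \<eta>)" using im by simp
      fix y :: 'a
      show "norm (moll e y * (?q (x - y) - ?q x)) \<le> moll e y * \<eta>"
      proof (cases "norm y \<le> e")
        case True
        then have "dist (?q (x - y)) (?q x) < \<eta>" using e by (intro d(2)) (simp add: dist_norm)
        then show ?thesis using moll_nonneg[OF e(1), of y]
          by (auto simp: abs_mult dist_norm intro!: mult_left_mono)
      qed (simp add: moll_outside[OF e(1)])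
    qed
    also have "\<dots> = \<eta>" by (simp add: integral_moll[OF e(1)])
    finally show ?thesis .
  qed
  have mD': "trace_of D' \<in> borel_measurable borel"
    using C1b_measurable(2)[OF D'] by measurable
  have bD': "norm (trace_of D' x) \<le> Bq + \<eta>" for x using close[of x] Bq[of x] by simp
  have i1: "integrable lborel (\<lambda>x. f x * trace_of D' x)" and i2: "integrable lborel (\<lambda>x. f x * ?q x)"
  proof -
    \<comment> \<open>A plain product is viewed as a convolution at the point 0 with the reflected
      kernel.\<close>
    have "integrable lborel (\<lambda>y. f y *\<^sub>R trace_of D' (- (0 - y)))"
      by (rule integrable_conv[OF f, where K="\<lambda>y. trace_of D' (- y)"]) (use mD' bD' in auto)
    then show "integrable lborel (\<lambda>x. f x * trace_of D' x)" by simp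
    have "integrable lborel (\<lambda>y. f y *\<^sub>R ?q (- (0 - y)))"
      by (rule integrable_conv[OF f, where K="\<lambda>y. ?q (- y)"]) (use mq Bq in auto)
    then show "integrable lborel (\<lambda>x. f x * ?q x)" by simp
  qed
  have "(\<integral>x. f x * trace_of D' x \<partial>lborel) - ?I = (\<integral>x. f x *\<^sub>R (trace_of D' x - ?q x) \<partial>lborel)"
    using i1 i2 by (simp add: right_diff_distrib)
  also have "\<bar>\<dots>\<bar> \<le> \<eta> * ?L"
    using norm_conv_le[OF f, of "\<lambda>x. trace_of D' x - ?q x" \<eta>] close by simp
  finally have "a < (\<integral>x. mollify e f x * ?q x \<partial>lborel)" using \<eta>L unfolding D''(2) by linarith
  with e(1) that show ?thesis by blast
qed

subsection \<open>Translation differences and the perimeter\<close>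

text \<open>The total variation of \<open>f\<close> is at most \<open>P\<close>, expressed field by
  field in real numbers. It is stated for functions and \<open>lborel\<close> so that it applies to
  the indicator of a Borel representative of \<open>E\<close>.\<close>

definition perimeter_bound :: "('a::euclidean_space \<Rightarrow> real) \<Rightarrow> real \<Rightarrow> bool" where
  "perimeter_bound f P \<longleftrightarrow> (\<forall>\<phi> D R. C1b \<phi> D \<longrightarrow> (\<forall>x. norm x > R \<longrightarrow> \<phi> x = 0) \<longrightarrow> (\<forall>x. norm (\<phi> x) \<le> 1)
      \<longrightarrow> (\<integral>x. f x * trace_of D x \<partial>lborel) \<le> P)"

text \<open>A compactly supported field close to \<open>-v / |v|\<close>; it almost attains the supremum
  that defines the perimeter.\<close>

lemma C1b_truncated_direction:
  fixes v :: "'a::euclidean_space \<Rightarrow> 'a"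
  assumes v: "C1b v Dv" and \<delta>: "\<delta> > 0" and R: "R > 0"
  obtains D where "C1b (\<lambda>x. (- bump R x * inverse (sqrt (\<delta>\<^sup>2 + v x \<bullet> v x))) *\<^sub>R v x) D"
proof -
  let ?s = "\<lambda>x. sqrt (\<delta>\<^sup>2 + v x \<bullet> v x)"
  \<comment> \<open>The regularising term keeps the root positive where \<open>v\<close> vanishes;
    there \<open>v / |v|\<close> would not even be continuous.\<close>
  have pos: "\<delta>\<^sup>2 + v x \<bullet> v x > 0" for x using \<delta> by (intro add_pos_nonneg) auto
  define Ds where "Ds x h = inverse (?s x) / 2 * (2 * (v x \<bullet> Dv x h))" for x h
  define Dw where "Dw x h = - (inverse (?s x) * Ds x h * inverse (?s x))" for x h
  define Dc where "Dc x h = - bump R x * Dw x h + - (bump_grad R x \<bullet> h) * inverse (?s x)" for x h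
  define D where "D x h = (- bump R x * inverse (?s x)) *\<^sub>R Dv x h + Dc x h *\<^sub>R v x" for x h
  note [continuous_intros] = C1b_continuous[OF v] C1b_continuous(1)[OF C1b_bump[OF R]]
    C1b_continuous(1)[OF C1b_bump_grad[OF R]]
  have dq: "((\<lambda>x. \<delta>\<^sup>2 + v x \<bullet> v x) has_derivative (\<lambda>h. 2 * (v x \<bullet> Dv x h))) (at x)" for x
    using has_derivative_add[OF has_derivative_const has_derivative_inner[OF C1bD(1)[OF v] C1bD(1)[OF v]], of "\<delta>\<^sup>2" x]
    by (simp add: inner_commute)
  have ds: "(?s has_derivative Ds x) (at x)" for x
  proof -
    have "(sqrt has_derivative (*) (inverse (?s x) / 2)) (at (\<delta>\<^sup>2 + v x \<bullet> v x))"
      using DERIV_real_sqrt[OF pos[of x]] by (simp add: has_field_derivative_def)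
    from has_derivative_compose[OF dq this] show ?thesis unfolding Ds_def by simp
  qed
  have s0: "?s x \<noteq> 0" for x using pos[of x] by simp
  have dw: "((\<lambda>x. inverse (?s x)) has_derivative Dw x) (at x)" for x
    unfolding Dw_def by (rule Deriv.has_derivative_inverse[OF s0 ds])
  have dc: "((\<lambda>x. - bump R x * inverse (?s x)) has_derivative Dc x) (at x)" for x
    unfolding Dc_def by (rule has_derivative_mult[OF has_derivative_minus[OF C1bD(1)[OF C1b_bump[OF R]]] dw])
  have "C1b (\<lambda>x. (- bump R x * inverse (?s x)) *\<^sub>R v x) D"
  proof (rule C1b_compact_support[where R=R])
    show "((\<lambda>x. (- bump R x * inverse (?s x)) *\<^sub>R v x) has_derivative D x) (at x)" for x
      unfolding D_def by (rule has_derivative_scaleR[OF dc C1bD(1)[OF v]])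
    show "continuous_on UNIV (\<lambda>x. D x i)" for i
      unfolding D_def Dc_def Dw_def Ds_def by (intro continuous_intros) (use s0 in auto)
  qed (use bump_outside[OF R] in auto)
  with that show ?thesis by blast
qed

text \<open>The truncated directions of \<open>-v\<close> are tested against the mollification; the
  minus sign cancels the one from integration by parts. Letting the cutoff radius grow and the
  regularisation vanish recovers \<open>norm (v x)\<close>.\<close>

lemma nn_integral_mollify_grad_le:
  fixes f :: "'a::euclidean_space \<Rightarrow> real"
  assumes f: "integrable lborel f" and e: "e > 0" and P: "perimeter_bound f P"
  shows "(\<integral>\<^sup>+x. ennreal (norm (mollify_grad e f x)) \<partial>lborel) \<le> ennreal P"
proof -
  define v where "v = mollify_grad e f"
  obtain Dv where Dv: "C1b v Dv" using C1b_mollify(2)[OF f e] unfolding v_def by blast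
  have u: "C1b (mollify e f) (\<lambda>x h. v x \<bullet> h)" using C1b_mollify(1)[OF f e] unfolding v_def .
  have cv: "continuous_on UNIV v" by (rule C1b_continuous(1)[OF Dv])
  have [measurable]: "v \<in> borel_measurable borel" by (rule C1b_measurable(1)[OF Dv])
  \<comment> \<open>\<open>g n x\<close> is \<open>- (v x \<bullet> \<phi> x)\<close> for the
    truncated direction \<open>\<phi>\<close> with cutoff radius \<open>n + 1\<close> and
    regularisation \<open>1 / (n + 1)\<close>.\<close>
  define g where "g n x = bump (real (Suc n)) x * inverse (sqrt ((1 / real (Suc n))\<^sup>2 + v x \<bullet> v x)) * (v x \<bullet> v x)" for n x
  have pos: "(1 / real (Suc n))\<^sup>2 + v x \<bullet> v x > 0" for n x by (intro add_pos_nonneg) auto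
  have g0: "g n x \<ge> 0" for n x unfolding g_def using pos[of n x] by (auto simp: bump_nonneg)
  have cb: "continuous_on UNIV (bump (real (Suc n)) :: 'a \<Rightarrow> real)" for n
    by (rule C1b_continuous(1)[OF C1b_bump]) simp
  have gi: "integrable lborel (g n)" for n
  proof (rule integrable_compact_support[where R="real (Suc n)"])
    show "continuous_on UNIV (g n)" unfolding g_def
      by (intro continuous_intros cv cb) (use pos[of n] in \<open>auto simp: less_imp_neq[THEN not_sym]\<close>)
    show "g n x = 0" if "norm x > real (Suc n)" for x using bump_outside[OF _ that] by (simp add: g_def)
  qed
  have gP: "(\<integral>x. g n x \<partial>lborel) \<le> P" for n
  proof -
    define \<phi> where "\<phi> x = (- bump (real (Suc n)) x * inverse (sqrt ((1 / real (Suc n))\<^sup>2 + v x \<bullet> v x))) *\<^sub>R v x" for x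
    obtain D where \<phi>: "C1b \<phi> D"
      using C1b_truncated_direction[OF Dv, of "1 / real (Suc n)" "real (Suc n)"] unfolding \<phi>_def[abs_def] by auto
    have R: "\<phi> x = 0" if "norm x > real (Suc n)" for x using bump_outside[OF _ that] by (simp add: \<phi>_def)
    have 1: "norm (\<phi> x) \<le> 1" for x
    proof -
      let ?s = "sqrt ((1 / real (Suc n))\<^sup>2 + v x \<bullet> v x)"
      have s: "?s > 0" using pos[of n x] by simp
      have "norm (v x) = sqrt (v x \<bullet> v x)" by (rule norm_eq_sqrt_inner)
      also have "\<dots> \<le> ?s" by (intro real_sqrt_le_mono) simp
      finally have "inverse ?s * norm (v x) \<le> 1" using s by (simp add: field_simps)
      then have "bump (real (Suc n)) x * (inverse ?s * norm (v x)) \<le> 1 * 1"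
        using s by (intro mult_mono bump_le_1) auto
      then show ?thesis using s bump_nonneg[of "real (Suc n)" x] by (simp add: \<phi>_def abs_mult mult.assoc)
    qed
    obtain \<psi> D' R' where D': "C1b \<psi> D'" "\<And>x. norm x > R' \<Longrightarrow> \<psi> x = 0" "\<And>x. norm (\<psi> x) \<le> 1"
      "\<And>x. trace_of D' x = (\<integral>y. moll e y * trace_of D (x - y) \<partial>lborel)"
      "(\<integral>x. f x * trace_of D' x \<partial>lborel) = (\<integral>x. mollify e f x * trace_of D x \<partial>lborel)"
      by (rule mollify_field[OF f e \<phi> R 1]) (assumption, rule that)
    have "(\<integral>x. g n x \<partial>lborel) = - (\<integral>x. v x \<bullet> \<phi> x \<partial>lborel)"
      unfolding \<phi>_def g_def by (simp add: mult.assoc)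
    also have "\<dots> = (\<integral>x. mollify e f x * trace_of D x \<partial>lborel)"
      by (rule integration_by_parts_divergence[OF u cv \<phi> R, symmetric])
    also have "\<dots> = (\<integral>x. f x * trace_of D' x \<partial>lborel)" by (rule D'(5)[symmetric])
    also have "\<dots> \<le> P" using P D'(1-3) unfolding perimeter_bound_def by blast
    finally show ?thesis .
  qed
  have lim: "(\<lambda>n. g n x) \<longlonglongrightarrow> norm (v x)" for x
  proof (cases "v x = 0")
    case False
    then have vv: "v x \<bullet> v x > 0" by simp
    have z: "(\<lambda>n. 1 / real (Suc n)) \<longlonglongrightarrow> 0" by (rule LIMSEQ_Suc[OF lim_1_over_n])
    have "(\<lambda>n. max 0 (1 - (x \<bullet> x) * (1 / real (Suc n))\<^sup>2) ^ 3) \<longlonglongrightarrow> max 0 (1 - (x \<bullet> x) * 0\<^sup>2) ^ 3"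
      by (intro tendsto_intros z)
    then have b: "(\<lambda>n. bump (real (Suc n)) x) \<longlonglongrightarrow> 1" by (simp add: bump_def power_one_over)
    have "(\<lambda>n. g n x) \<longlonglongrightarrow> 1 * inverse (sqrt (0\<^sup>2 + v x \<bullet> v x)) * (v x \<bullet> v x)"
      unfolding g_def by (intro tendsto_intros z b) (use vv in auto)
    also have "1 * inverse (sqrt (0\<^sup>2 + v x \<bullet> v x)) * (v x \<bullet> v x) = norm (v x)"
      using False by (simp add: norm_eq_sqrt_inner[symmetric] dot_square_norm power2_eq_square)
    finally show ?thesis .
  qed (simp add: g_def)
  \<comment> \<open>Only an upper bound for the limit is wanted, so Fatou's lemma suffices.\<close>
  have "(\<integral>\<^sup>+x. ennreal (norm (v x)) \<partial>lborel) = (\<integral>\<^sup>+x. liminf (\<lambda>n. ennreal (g n x)) \<partial>lborel)"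
    by (intro nn_integral_cong lim_imp_Liminf[symmetric] tendsto_ennrealI lim) simp
  also have "\<dots> \<le> liminf (\<lambda>n. \<integral>\<^sup>+x. ennreal (g n x) \<partial>lborel)"
    by (rule nn_integral_liminf) (use borel_measurable_integrable[OF gi] in measurable)
  also have "\<dots> \<le> ennreal P"
  proof -
    have "(\<integral>\<^sup>+x. ennreal (g n x) \<partial>lborel) \<le> ennreal P" for n
      using nn_integral_eq_integral[OF gi[of n]] g0 gP[of n] by (simp add: ennreal_leI)
    then have "liminf (\<lambda>n. \<integral>\<^sup>+x. ennreal (g n x) \<partial>lborel) \<le> liminf (\<lambda>n::nat. ennreal P)"
      by (intro Liminf_mono always_eventually) auto
    then show ?thesis by (simp add: Liminf_const)
  qed
  finally show ?thesis unfolding v_def .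
qed

text \<open>With \<open>\<rho>\<close> fixed, replacing the indicator by a fine mollification
  changes \<open>ball_diff\<close> by an arbitrarily small amount, and the mollification satisfies
  the bound exactly.\<close>

lemma ball_diff_le_perimeter:
  fixes E :: "'a::euclidean_space set"
  assumes E[measurable]: "E \<in> sets borel" and fin: "emeasure lborel E < \<infinity>"
    and P: "perimeter_bound (indicator E) P" and \<rho>: "\<rho> > 0"
  shows "ball_diff (indicator E) \<rho> \<le> ennreal (moment_const DIM('a) * \<rho> ^ (DIM('a) + 1)) * ennreal P"
proof (rule ennreal_le_epsilon)
  fix \<epsilon> :: real assume \<epsilon>: "\<epsilon> > 0"
  let ?f = "indicator E :: 'a \<Rightarrow> real"
  let ?V = "unit_ball_vol (real DIM('a)) * \<rho> ^ DIM('a)"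
  have f: "integrable lborel ?f" by (rule integrable_indicator_lborel[OF E fin])
  have fm: "?f \<in> borel_measurable borel" by measurable
  have V: "?V > 0" using \<rho> by simp
  \<comment> \<open>The error \<open>2 * \<eta>\<close> per shift is integrated over a ball of
    volume \<open>?V\<close>, giving \<open>\<epsilon>\<close> in total.\<close>
  define \<eta> where "\<eta> = \<epsilon> / (2 * ?V)"
  have \<eta>: "\<eta> > 0" using \<epsilon> V unfolding \<eta>_def by (intro divide_pos_pos) auto
  have "2 * ?V \<noteq> 0" using V by linarith
  then have \<eta>V: "2 * \<eta> * ?V = \<epsilon>" unfolding \<eta>_def by (metis mult.assoc mult.commute nonzero_eq_divide_eq)
  obtain e where e: "e > 0" "\<And>z. norm z \<le> e \<Longrightarrow> shift_diff ?f z \<le> ennreal \<eta>"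
    by (rule shift_diff_indicator_small[OF E fin \<eta>]) (rule that)
  let ?g = "mollify e ?f"
  have u: "C1b ?g (\<lambda>x h. mollify_grad e ?f x \<bullet> h)" by (rule C1b_mollify(1)[OF f e(1)])
  have [measurable]: "?g \<in> borel_measurable borel" by (rule C1b_measurable(1)[OF u])
  have cv: "continuous_on UNIV (mollify_grad e ?f)"
    using C1b_mollify(2)[OF f e(1)] C1b_continuous(1) by blast
  have "ball_diff ?f \<rho> \<le> (\<integral>\<^sup>+h. indicator (cball 0 \<rho>) h * shift_diff ?g h + ennreal (2 * \<eta>) * indicator (cball 0 \<rho>) h \<partial>lborel)"
    unfolding ball_diff_def
  proof (rule nn_integral_mono)
    fix h :: 'a
    have "shift_diff ?f h \<le> shift_diff ?g h + 2 * ennreal \<eta>"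
      by (rule shift_diff_le_mollify[OF fm _ e(1) f e(2), of 1]) (auto simp: indicator_def)
    also have "2 * ennreal \<eta> = ennreal (2 * \<eta>)" using \<eta> by (simp add: ennreal_mult)
    finally show "indicator (cball 0 \<rho>) h * shift_diff ?f h
        \<le> indicator (cball 0 \<rho>) h * shift_diff ?g h + ennreal (2 * \<eta>) * indicator (cball 0 \<rho>) h"
      by (cases "h \<in> cball 0 \<rho>") simp_all
  qed
  also have "\<dots> = ball_diff ?g \<rho> + ennreal (2 * \<eta>) * emeasure lborel (cball 0 \<rho> :: 'a set)"
    unfolding ball_diff_def by (subst nn_integral_add) (auto simp: nn_integral_cmult)
  also have "ennreal (2 * \<eta>) * emeasure lborel (cball 0 \<rho> :: 'a set) = ennreal (2 * \<eta> * ?V)"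
    using \<rho> \<eta> by (subst emeasure_cball) (auto simp: ennreal_mult)
  also have "2 * \<eta> * ?V = \<epsilon>" by (rule \<eta>V)
  also have "ball_diff ?g \<rho> + ennreal \<epsilon> \<le>
      ennreal (moment_const DIM('a) * \<rho> ^ (DIM('a) + 1)) * ennreal P + ennreal \<epsilon>"
  proof (rule add_right_mono)
    show "ball_diff ?g \<rho> \<le> ennreal (moment_const DIM('a) * \<rho> ^ (DIM('a) + 1)) * ennreal P"
      by (rule order_trans[OF ball_diff_C1b_le[OF u cv \<rho>]])
         (intro mult_left_mono nn_integral_mollify_grad_le[OF f e(1) P] zero_le)
  qed
  finally show "ball_diff ?f \<rho> \<le> ennreal (moment_const DIM('a) * \<rho> ^ (DIM('a) + 1)) * ennreal P + ennreal \<epsilon>" .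
qed

text \<open>The strict gap between \<open>a\<close> and the divergence integral is spent in two
  parts: above the intermediate \<open>a'\<close> on the choice of the mollification, below it on
  the Taylor error. The resulting \<open>\<delta>\<close> depends on the mollification, which is
  harmless since mollifying does not increase \<open>ball_diff\<close>.\<close>

lemma ball_diff_ge_divergence:
  fixes E :: "'a::euclidean_space set"
  assumes E[measurable]: "E \<in> sets borel" and fin: "emeasure lborel E < \<infinity>"
    and \<phi>: "C1b \<phi> D" and R: "\<And>x. norm x > R \<Longrightarrow> \<phi> x = 0" and 1: "\<And>x. norm (\<phi> x) \<le> 1"
    and a: "0 \<le> a" "a < (\<integral>x. indicator E x * trace_of D x \<partial>lborel)"
  obtains \<delta> where "\<delta> > 0" "\<And>\<rho>. 0 < \<rho> \<Longrightarrow> \<rho> < \<delta> \<Longrightarrow>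
     ennreal (moment_const DIM('a) * a * \<rho> ^ (DIM('a) + 1)) \<le> ball_diff (indicator E) \<rho>"
proof -
  let ?f = "indicator E :: 'a \<Rightarrow> real"
  let ?m = "moment_const DIM('a)"
  have m: "?m > 0" unfolding moment_const_def using DIM_positive[where 'a='a]
    by (intro divide_pos_pos mult_pos_pos unit_ball_vol_pos) auto
  have f: "integrable lborel ?f" by (rule integrable_indicator_lborel[OF E fin])
  have fm: "?f \<in> borel_measurable borel" by measurable
  obtain a' where a': "a < a'" "a' < (\<integral>x. ?f x * trace_of D x \<partial>lborel)" using a(2) dense by blast
  obtain e where e: "e > 0" "a' < (\<integral>x. mollify e ?f x * trace_of D x \<partial>lborel)"
    by (rule mollify_trace_close[OF f \<phi> R 1 a'(2)]) (assumption, rule that)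
  define v where "v = mollify_grad e ?f"
  have u: "C1b (mollify e ?f) (\<lambda>x h. v x \<bullet> h)" unfolding v_def by (rule C1b_mollify(1)[OF f e(1)])
  have [measurable]: "mollify e ?f \<in> borel_measurable borel" by (rule C1b_measurable(1)[OF u])
  have cv: "continuous_on UNIV v"
    using C1b_mollify(2)[OF f e(1)] C1b_continuous(1) unfolding v_def by blast
  \<comment> \<open>The radius given with the support may be nonpositive, whereas the ball used for
    the Taylor estimate needs a positive one.\<close>
  define R' where "R' = max R 1"
  have R': "R' > 0" "\<And>x. norm x > R' \<Longrightarrow> \<phi> x = 0" using R by (auto simp: R'_def)
  have iv: "integrable lborel (\<lambda>x. indicator (cball 0 R') x *\<^sub>R norm (v x))"
    by (rule borel_integrable_compact) (auto intro!: continuous_intros continuous_on_subset[OF cv])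
  have "a' \<le> - (\<integral>x. v x \<bullet> \<phi> x \<partial>lborel)"
    using e(2) integration_by_parts_divergence[OF u cv \<phi> R] by simp
  also have "\<dots> \<le> norm (\<integral>x. v x \<bullet> \<phi> x \<partial>lborel)" by simp
  also have "\<dots> \<le> (\<integral>x. indicator (cball 0 R') x *\<^sub>R norm (v x) \<partial>lborel)"
  proof (rule Bochner_Integration.integral_norm_bound_integral[OF _ iv])
    show "integrable lborel (\<lambda>x. v x \<bullet> \<phi> x)"
      by (rule integrable_compact_support[where R=R'], intro continuous_intros cv C1b_continuous(1)[OF \<phi>])
         (use R' in auto)
    fix x
    have "norm (v x \<bullet> \<phi> x) \<le> norm (v x) * norm (\<phi> x)" using Cauchy_Schwarz_ineq2 by simp
    also have "\<dots> \<le> norm (v x) * 1" by (intro mult_left_mono 1) auto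
    finally have "norm (v x \<bullet> \<phi> x) \<le> norm (v x)" by simp
    then show "norm (v x \<bullet> \<phi> x) \<le> indicator (cball 0 R') x *\<^sub>R norm (v x)"
      using R'(2)[of x] by (cases "norm x > R'") (auto simp: indicator_def)
  qed
  finally have a'v: "ennreal a' \<le> (\<integral>\<^sup>+x. indicator (cball 0 R') x * ennreal (norm (v x)) \<partial>lborel)"
  proof -
    assume "a' \<le> (\<integral>x. indicator (cball 0 R') x *\<^sub>R norm (v x) \<partial>lborel)"
    then have "ennreal a' \<le> ennreal (\<integral>x. indicator (cball 0 R') x *\<^sub>R norm (v x) \<partial>lborel)" by (rule ennreal_leI)
    also have "\<dots> = (\<integral>\<^sup>+x. ennreal (indicator (cball 0 R') x *\<^sub>R norm (v x)) \<partial>lborel)"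
      by (rule nn_integral_eq_integral[OF iv, symmetric]) auto
    also have "\<dots> = (\<integral>\<^sup>+x. indicator (cball 0 R') x * ennreal (norm (v x)) \<partial>lborel)"
      by (intro nn_integral_cong) (auto simp: indicator_def)
    finally show ?thesis .
  qed
  \<comment> \<open>With this value the Taylor error is exactly the difference between the bounds
    for \<open>a'\<close> and for \<open>a\<close>.\<close>
  define \<eta> where "\<eta> = ?m * (a' - a)"
  have \<eta>: "\<eta> > 0" using m a' by (simp add: \<eta>_def)
  obtain \<delta> where d: "\<delta> > 0" "\<And>\<rho>. 0 < \<rho> \<Longrightarrow> \<rho> < \<delta> \<Longrightarrow>
     ennreal (?m * \<rho> ^ (DIM('a) + 1)) * (\<integral>\<^sup>+x. indicator (cball 0 R') x * ennreal (norm (v x)) \<partial>lborel)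
     \<le> ball_diff (mollify e ?f) \<rho> + ennreal (\<eta> * \<rho> ^ (DIM('a) + 1))"
    by (rule ball_diff_C1b_ge[OF u cv \<eta> R'(1)]) (rule that)
  have "ennreal (?m * a * \<rho> ^ (DIM('a) + 1)) \<le> ball_diff ?f \<rho>" if \<rho>: "0 < \<rho>" "\<rho> < \<delta>" for \<rho>
  proof -
    let ?r = "\<rho> ^ (DIM('a) + 1)"
    have r: "?r > 0" using \<rho> by simp
    have "ennreal (?m * a * ?r) + ennreal (\<eta> * ?r) = ennreal (?m * a * ?r + \<eta> * ?r)"
      using m a(1) \<eta> r by (intro ennreal_plus[symmetric] mult_nonneg_nonneg) auto
    also have "?m * a * ?r + \<eta> * ?r = (?m * ?r) * a'" by (simp add: \<eta>_def algebra_simps)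
    also have "ennreal \<dots> = ennreal (?m * ?r) * ennreal a'"
      using m r a a' by (intro ennreal_mult mult_nonneg_nonneg) auto
    also have "\<dots> \<le> ennreal (?m * ?r) * (\<integral>\<^sup>+x. indicator (cball 0 R') x * ennreal (norm (v x)) \<partial>lborel)"
      by (intro mult_left_mono a'v) auto
    also have "\<dots> \<le> ball_diff (mollify e ?f) \<rho> + ennreal (\<eta> * ?r)" by (rule d(2)[OF \<rho>])
    also have "\<dots> \<le> ball_diff ?f \<rho> + ennreal (\<eta> * ?r)"
      unfolding ball_diff_def
      by (intro add_right_mono nn_integral_mono mult_left_mono shift_diff_mollify_le[OF fm _ e(1), of 1])
         (auto simp: indicator_def)
    finally show ?thesis by (simp add: ennreal_add_left_cancel_le add.commute[of _ "ennreal (\<eta> * ?r)"])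
  qed
  with d(1) that show ?thesis by blast
qed

subsection \<open>Layer-cake decomposition of the kernel\<close>

text \<open>Tonelli and the translation lemmas are used for Borel functions and
  \<open>lborel\<close>; both the energy and the perimeter ignore null sets, so \<open>E\<close> may
  be replaced by \<open>A\<close>.\<close>

lemma lebesgue_borel_representative:
  fixes E :: "'a::euclidean_space set"
  assumes "E \<in> sets lebesgue" "emeasure lebesgue E < \<infinity>"
  obtains A where "A \<in> sets borel" "emeasure lborel A < \<infinity>" "AE x in lborel. x \<in> E \<longleftrightarrow> x \<in> A"
proof -
  obtain A N N' where *: "E = A \<union> N" "N \<subseteq> N'" "N' \<in> null_sets lborel" "A \<in> sets lborel"
    using assms(1) by (rule sets_completionE)
  have "emeasure lborel A = (\<integral>\<^sup>+x. indicator A x \<partial>lebesgue)"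
    using *(4) by (simp add: nn_integral_completion del: nn_integral_indicator) simp
  also have "\<dots> = emeasure lebesgue A" using *(4) by (intro nn_integral_indicator) simp
  also have "\<dots> \<le> emeasure lebesgue E" using *(1) assms(1) by (intro emeasure_mono) auto
  also have "\<dots> < \<infinity>" by fact
  finally have "emeasure lborel A < \<infinity>" .
  moreover have "AE x in lborel. x \<in> E \<longleftrightarrow> x \<in> A"
    using AE_not_in[OF *(3)] by eventually_elim (use *(1,2) in auto)
  ultimately show ?thesis using that *(4) by auto
qed

section \<open>Integrals of powers and the layer-cake formula\<close>

lemma nn_integral_powr_Icc:
  fixes a b p :: real
  assumes "0 < a" "a \<le> b" "p \<noteq> 1"
  shows "(\<integral>\<^sup>+t. ennreal (t powr - p) * indicator {a..b} t \<partial>lborel) = ennreal ((a powr (1 - p) - b powr (1 - p)) / (p - 1))"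
proof -
  have "(\<integral>\<^sup>+t. ennreal (t powr - p) * indicator {a..b} t \<partial>lborel) = ennreal (b powr (1 - p) / (1 - p) - a powr (1 - p) / (1 - p))"
  proof (rule nn_integral_FTC_Icc[where F="\<lambda>t. t powr (1 - p) / (1 - p)"])
    fix t assume "t \<in> {a..b}"
    then have "t > 0" using assms by auto
    then have "((\<lambda>t. t powr (1 - p) / (1 - p)) has_real_derivative (1 - p) * t powr (1 - p - 1) / (1 - p)) (at t)"
      by (intro DERIV_cdivide has_real_derivative_powr)
    then show "((\<lambda>t. t powr (1 - p) / (1 - p)) has_real_derivative t powr - p) (at t)" using assms(3) by simp
  qed (use assms in auto)
  also have "b powr (1 - p) / (1 - p) - a powr (1 - p) / (1 - p) = (a powr (1 - p) - b powr (1 - p)) / (p - 1)"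
    by (metis diff_divide_distrib minus_diff_eq minus_divide_divide)
  finally show ?thesis .
qed

lemma nn_integral_inverse_Icc:
  fixes a b :: real
  assumes "0 < a" "a \<le> b"
  shows "(\<integral>\<^sup>+t. ennreal (t powr - 1) * indicator {a..b} t \<partial>lborel) = ennreal (ln b - ln a)"
proof (rule nn_integral_FTC_Icc[where F=ln])
  fix t assume "t \<in> {a..b}"
  then have "t > 0" using assms by auto
  then show "(ln has_real_derivative t powr - 1) (at t)"
    using DERIV_ln_divide[of t] by (simp add: powr_minus_divide)
qed (use assms in auto)

lemma nn_integral_powr_atLeast:
  fixes a p :: real
  assumes "0 < a" "p > 1"
  shows "(\<integral>\<^sup>+t. ennreal (t powr - p) * indicator {a..} t \<partial>lborel) = ennreal (a powr (1 - p) / (p - 1))"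
proof -
  have "(\<integral>\<^sup>+t. ennreal (t powr - p) * indicator {a..} t \<partial>lborel) = ennreal (0 - a powr (1 - p) / (1 - p))"
  proof (rule nn_integral_FTC_atLeast[where F="\<lambda>t. t powr (1 - p) / (1 - p)"])
    fix t assume "a \<le> t"
    then have "t > 0" using assms by linarith
    then have "((\<lambda>t. t powr (1 - p) / (1 - p)) has_real_derivative (1 - p) * t powr (1 - p - 1) / (1 - p)) (at t)"
      by (intro DERIV_cdivide has_real_derivative_powr)
    then show "((\<lambda>t. t powr (1 - p) / (1 - p)) has_real_derivative t powr - p) (at t)" using assms(2) by simp
    show "0 \<le> t powr - p" by simp
  next
    show "((\<lambda>t. t powr (1 - p) / (1 - p)) \<longlongrightarrow> 0) at_top"
      using tendsto_divide[OF tendsto_neg_powr[of "1 - p", OF _ filterlim_ident] tendsto_const[of "1 - p"]] assms(2)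
      by simp
  qed simp
  also have "0 - a powr (1 - p) / (1 - p) = a powr (1 - p) / (p - 1)"
    using assms(2) by (simp add: field_simps)
  finally show ?thesis .
qed

text \<open>Both branches of the kernel are the power \<open>- d - s\<close> of
  \<open>max r t\<close>, which is the integral of the weight from \<open>max r t\<close> to
  infinity. Truncating the kernel at \<open>r\<close> thus means discarding the layers below
  \<open>r\<close>.\<close>

lemma kern_layer_cake:
  assumes r: "r > 0" and s: "s \<ge> 1" and t: "t \<ge> 0"
  shows "ennreal (kern d s r t) = (\<integral>\<^sup>+\<rho>. (if r \<le> \<rho> \<and> t \<le> \<rho> then ennreal ((real d + s) * \<rho> powr (- real d - s - 1)) else 0) \<partial>lborel)"
proof -
  let ?p = "real d + s + 1"
  let ?a = "max r t"
  have "(\<integral>\<^sup>+\<rho>. (if r \<le> \<rho> \<and> t \<le> \<rho> then ennreal ((real d + s) * \<rho> powr (- real d - s - 1)) else 0) \<partial>lborel)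
     = (\<integral>\<^sup>+\<rho>. ennreal (real d + s) * (ennreal (\<rho> powr - ?p) * indicator {?a..} \<rho>) \<partial>lborel)"
  proof (rule nn_integral_cong)
    fix \<rho> :: real
    have "- real d - s - 1 = - ?p" by simp
    then show "(if r \<le> \<rho> \<and> t \<le> \<rho> then ennreal ((real d + s) * \<rho> powr (- real d - s - 1)) else 0)
        = ennreal (real d + s) * (ennreal (\<rho> powr - ?p) * indicator {?a..} \<rho>)"
      using s by (auto simp: indicator_def ennreal_mult)
  qed
  also have "\<dots> = ennreal (real d + s) * ennreal (?a powr (1 - ?p) / (?p - 1))"
    by (subst nn_integral_cmult, simp, subst nn_integral_powr_atLeast) (use r s in auto)
  also have "\<dots> = ennreal (?a powr (- real d - s))"
    using s by (subst ennreal_mult[symmetric]) auto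
  also have "?a powr (- real d - s) = kern d s r t" by (auto simp: kern_def max_def)
  finally show ?thesis by simp
qed

lemma measurable_kern [measurable]: "kern d s r \<in> borel_measurable borel"
  unfolding kern_def[abs_def] by measurable

text \<open>The kernel is the superposition over \<open>\<rho> \<ge> r\<close> of the indicators of balls of radius \<open>\<rho>\<close>, with weight
  \<open>(d + s) \<rho>\<^bsup>-d-s-1\<^esup>\<close>. This replaces polar coordinates.\<close>

lemma Jt_layer_cake:
  fixes E A :: "'a::euclidean_space set"
  assumes A[measurable]: "A \<in> sets borel" and EA: "AE x in lborel. x \<in> E \<longleftrightarrow> x \<in> A"
    and r: "r > 0" and s: "s \<ge> 1"
  shows "2 * Jt s r E = (\<integral>\<^sup>+\<rho>. indicator {r..} \<rho> * ennreal ((real DIM('a) + s) * \<rho> powr (- real DIM('a) - s - 1))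
      * ball_diff (indicator A) \<rho> \<partial>lborel)"
proof -
  let ?k = "\<lambda>t. ennreal (kern DIM('a) s r t)"
  let ?c = "\<lambda>\<rho>. ennreal ((real DIM('a) + s) * \<rho> powr (- real DIM('a) - s - 1))"
  let ?f = "indicator A :: 'a \<Rightarrow> real"
  let ?F = "\<lambda>x y. indicator A x * indicator (- A) y * ?k (dist x y)"
  have J: "Jt s r E = (\<integral>\<^sup>+x. (\<integral>\<^sup>+y. ?F x y \<partial>lborel) \<partial>lborel)"
  proof -
    have in_eq: "(\<integral>\<^sup>+y. indicator (UNIV - E) y * ?k (dist x y) \<partial>lebesgue) = (\<integral>\<^sup>+y. indicator (- A) y * ?k (dist x y) \<partial>lborel)" for x
      unfolding nn_integral_completion
      by (rule nn_integral_cong_AE) (use EA in eventually_elim, auto simp: indicator_def)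
    have "Jt s r E = (\<integral>\<^sup>+x. indicator E x * (\<integral>\<^sup>+y. indicator (- A) y * ?k (dist x y) \<partial>lborel) \<partial>lborel)"
      unfolding Jt_def in_eq by (rule nn_integral_completion)
    also have "\<dots> = (\<integral>\<^sup>+x. indicator A x * (\<integral>\<^sup>+y. indicator (- A) y * ?k (dist x y) \<partial>lborel) \<partial>lborel)"
      by (rule nn_integral_cong_AE) (use EA in eventually_elim, auto simp: indicator_def)
    also have "\<dots> = (\<integral>\<^sup>+x. (\<integral>\<^sup>+y. ?F x y \<partial>lborel) \<partial>lborel)"
      by (intro nn_integral_cong, subst nn_integral_cmult[symmetric]) (auto simp: mult_ac)
    finally show ?thesis .
  qed
  \<comment> \<open>Symmetrisation: adding the two orders of the variables turns the product of the
    indicators of \<open>A\<close> and its complement into \<open>\<bar>?f y - ?f x\<bar>\<close>,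
    the source of the factor 2.\<close>
  have J': "Jt s r E = (\<integral>\<^sup>+x. (\<integral>\<^sup>+y. ?F y x \<partial>lborel) \<partial>lborel)"
    unfolding J by (rule lborel_pair.Fubini'[symmetric]) measurable
  have "2 * Jt s r E = (\<integral>\<^sup>+x. (\<integral>\<^sup>+y. ?F x y \<partial>lborel) \<partial>lborel) + (\<integral>\<^sup>+x. (\<integral>\<^sup>+y. ?F y x \<partial>lborel) \<partial>lborel)"
    unfolding mult_2 J[symmetric] J'[symmetric] ..
  also have "\<dots> = (\<integral>\<^sup>+x. (\<integral>\<^sup>+y. ?F x y \<partial>lborel) + (\<integral>\<^sup>+y. ?F y x \<partial>lborel) \<partial>lborel)"
    by (rule nn_integral_add[symmetric]) measurable
  also have "\<dots> = (\<integral>\<^sup>+x. (\<integral>\<^sup>+y. ?F x y + ?F y x \<partial>lborel) \<partial>lborel)"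
    by (intro nn_integral_cong nn_integral_add[symmetric]) measurable
  also have "\<dots> = (\<integral>\<^sup>+x. (\<integral>\<^sup>+y. ennreal \<bar>?f y - ?f x\<bar> * ?k (dist x y) \<partial>lborel) \<partial>lborel)"
    by (intro nn_integral_cong) (auto simp: indicator_def dist_commute)
  also have "\<dots> = (\<integral>\<^sup>+x. (\<integral>\<^sup>+h. ennreal \<bar>?f (x + h) - ?f x\<bar> * ?k (norm h) \<partial>lborel) \<partial>lborel)"
  proof (rule nn_integral_cong)
    fix x
    show "(\<integral>\<^sup>+y. ennreal \<bar>?f y - ?f x\<bar> * ?k (dist x y) \<partial>lborel) = (\<integral>\<^sup>+h. ennreal \<bar>?f (x + h) - ?f x\<bar> * ?k (norm h) \<partial>lborel)"
      using nn_integral_lborel_translate[of "\<lambda>y. ennreal \<bar>?f y - ?f x\<bar> * ?k (dist x y)" x]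
      by (simp add: dist_norm)
  qed
  also have "\<dots> = (\<integral>\<^sup>+h. (\<integral>\<^sup>+x. ennreal \<bar>?f (x + h) - ?f x\<bar> * ?k (norm h) \<partial>lborel) \<partial>lborel)"
    by (rule lborel_pair.Fubini'[symmetric]) measurable
  also have "\<dots> = (\<integral>\<^sup>+h. shift_diff ?f h * ?k (norm h) \<partial>lborel)"
    unfolding shift_diff_def by (intro nn_integral_cong nn_integral_multc) measurable
  also have "\<dots> = (\<integral>\<^sup>+h. shift_diff ?f h * (\<integral>\<^sup>+\<rho>. (if r \<le> \<rho> \<and> norm h \<le> \<rho> then ?c \<rho> else 0) \<partial>lborel) \<partial>lborel)"
    by (subst kern_layer_cake[OF r s]) auto
  also have "\<dots> = (\<integral>\<^sup>+h. (\<integral>\<^sup>+\<rho>. shift_diff ?f h * (if r \<le> \<rho> \<and> norm h \<le> \<rho> then ?c \<rho> else 0) \<partial>lborel) \<partial>lborel)"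
    by (intro nn_integral_cong nn_integral_cmult[symmetric]) measurable
  also have "\<dots> = (\<integral>\<^sup>+\<rho>. (\<integral>\<^sup>+h. shift_diff ?f h * (if r \<le> \<rho> \<and> norm h \<le> \<rho> then ?c \<rho> else 0) \<partial>lborel) \<partial>lborel)"
    by (rule lborel_pair.Fubini'[symmetric]) measurable
  also have "\<dots> = (\<integral>\<^sup>+\<rho>. indicator {r..} \<rho> * ?c \<rho> * ball_diff ?f \<rho> \<partial>lborel)"
  proof (rule nn_integral_cong)
    fix \<rho> :: real
    have "(\<integral>\<^sup>+h. shift_diff ?f h * (if r \<le> \<rho> \<and> norm h \<le> \<rho> then ?c \<rho> else 0) \<partial>lborel)
       = (\<integral>\<^sup>+h. indicator {r..} \<rho> * ?c \<rho> * (indicator (cball 0 \<rho>) h * shift_diff ?f h) \<partial>lborel)"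
      by (intro nn_integral_cong) (auto simp: indicator_def mult_ac)
    also have "\<dots> = indicator {r..} \<rho> * ?c \<rho> * ball_diff ?f \<rho>"
      unfolding ball_diff_def by (rule nn_integral_cmult) measurable
    finally show "(\<integral>\<^sup>+h. shift_diff ?f h * (if r \<le> \<rho> \<and> norm h \<le> \<rho> then ?c \<rho> else 0) \<partial>lborel) = indicator {r..} \<rho> * ?c \<rho> * ball_diff ?f \<rho>" .
  qed
  finally show ?thesis .
qed

text \<open>Meant for large radii: it grows like \<open>\<rho> ^ DIM('a)\<close> rather than
  \<open>\<rho> ^ (DIM('a) + 1)\<close>, and this gain of one power makes the tail converge at
  \<open>s = 1\<close>.\<close>

lemma ball_diff_le_volume:
  fixes A :: "'a::euclidean_space set"
  assumes [measurable]: "A \<in> sets borel" and \<rho>: "\<rho> \<ge> 0"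
  shows "ball_diff (indicator A) \<rho> \<le> 2 * emeasure lborel A * ennreal (unit_ball_vol (real DIM('a)) * \<rho> ^ DIM('a))"
proof -
  have "shift_diff (indicator A) h \<le> 2 * emeasure lborel A" for h
  proof -
    have "shift_diff (indicator A) h \<le> (\<integral>\<^sup>+x. indicator A (h + x) + indicator A x \<partial>lborel)"
      unfolding shift_diff_def
      by (intro nn_integral_mono) (auto simp: indicator_def add.commute)
    also have "\<dots> = (\<integral>\<^sup>+x. indicator A (h + x) \<partial>lborel) + emeasure lborel A"
      by (subst nn_integral_add) auto
    also have "(\<integral>\<^sup>+x. indicator A (h + x) \<partial>lborel) = emeasure lborel A"
      by (subst nn_integral_lborel_translate) auto
    finally show ?thesis by (simp add: mult_2)
  qed
  then have "ball_diff (indicator A) \<rho> \<le> (\<integral>\<^sup>+h. 2 * emeasure lborel A * indicator (cball 0 \<rho> :: 'a set) h \<partial>lborel)"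
    unfolding ball_diff_def by (intro nn_integral_mono) (auto simp: indicator_def)
  also have "\<dots> = 2 * emeasure lborel A * ennreal (unit_ball_vol (real DIM('a)) * \<rho> ^ DIM('a))"
    by (subst nn_integral_cmult_indicator) (use \<rho> in \<open>auto simp: emeasure_cball\<close>)
  finally show ?thesis .
qed

lemma powr_layer_mult:
  assumes "\<rho> > 0"
  shows "\<rho> powr (- real d - s - 1) * \<rho> ^ (d + 1) = \<rho> powr - s"
proof -
  have "\<rho> powr (- real d - s - 1) * \<rho> ^ (d + 1) = \<rho> powr (- real d - s - 1) * \<rho> powr (real (d + 1))"
    using assms by (subst powr_realpow) auto
  also have "\<dots> = \<rho> powr (- real d - s - 1 + real (d + 1))" by (rule powr_add[symmetric])
  also have "- real d - s - 1 + real (d + 1) = - s" by simp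
  finally show ?thesis .
qed

text \<open>Induction in steps of 2 through \<open>Gamma (x + 1) = x * Gamma x\<close>: the left
  side gains the factor \<open>x\<close>, the right side the larger \<open>x + 1 / 2\<close>.
  Equality holds at \<open>n = 1\<close>; for \<open>n = 2\<close> the claim is
  \<open>1 \<le> pi / 2\<close>.\<close>

lemma Gamma_half_step_le:
  fixes n :: nat
  assumes "n \<ge> 1"
  shows "Gamma (real n / 2) \<le> sqrt pi * Gamma (real n / 2 + 1 / 2)"
  using assms
proof (induction n rule: less_induct)
  case (less n)
  have "n = 1 \<or> n = 2 \<or> (\<exists>m. n = m + 2 \<and> m \<ge> 1)" using less.prems by presburger
  then consider "n = 1" | "n = 2" | m where "n = m + 2" "m \<ge> 1" by blast
  then show ?case
  proof cases
    case 1
    then show ?thesis by (simp add: Gamma_one_half_real)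
  next
    case 2
    have "Gamma (1 / 2 + 1 :: real) = 1 / 2 * sqrt pi"
      by (subst Gamma_plus1) (auto simp: Gamma_one_half_real dest: nonpos_Ints_nonpos)
    then have "sqrt pi * Gamma (1 + 1 / 2 :: real) = sqrt pi * (1 / 2 * sqrt pi)" by (simp only: add.commute)
    then have "sqrt pi * Gamma (1 + 1 / 2 :: real) = pi / 2" by simp
    then show ?thesis using 2 pi_ge_two by simp
  next
    case (3 m)
    let ?x = "real m / 2"
    have x: "?x > 0" using 3 by simp
    have "Gamma (?x + 1) = ?x * Gamma ?x" using x by (intro Gamma_plus1) auto
    also have "\<dots> \<le> (?x + 1 / 2) * (sqrt pi * Gamma (?x + 1 / 2))"
      using less.IH[of m] 3 x by (intro mult_mono) (auto intro!: less_imp_le Gamma_real_pos)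
    also have "\<dots> = sqrt pi * Gamma (?x + 1 / 2 + 1)"
      using x by (subst Gamma_plus1) (auto simp: mult_ac)
    finally show ?thesis using 3 by (simp add: add_divide_distrib add_ac)
  qed
qed

text \<open>Geometrically, the flat unit disc has at most the area of the hemisphere above it. This
  passes from the sharp constant to \<open>Mconst\<close> at \<open>s = 1\<close>.\<close>

lemma unit_ball_vol_pred_le:
  assumes "d \<ge> 1"
  shows "unit_ball_vol (real d - 1) \<le> real d * unit_ball_vol (real d) / 2"
proof -
  have d: "real d / 2 > 0" using assms by simp
  have G: "Gamma (real d / 2) > 0" "Gamma (real d / 2 + 1 / 2) > 0" using d by (auto intro!: Gamma_real_pos)
  have "Gamma (real d / 2 + 1) = real d / 2 * Gamma (real d / 2)" using d by (intro Gamma_plus1) auto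
  then have 1: "real d * unit_ball_vol (real d) / 2 = pi powr (real d / 2) / Gamma (real d / 2)"
    using d by (simp add: unit_ball_vol_def)
  have 2: "unit_ball_vol (real d - 1) = pi powr ((real d - 1) / 2) / Gamma (real d / 2 + 1 / 2)"
    by (simp add: unit_ball_vol_def add_divide_distrib diff_divide_distrib add.commute)
  have 3: "pi powr (real d / 2) = pi powr ((real d - 1) / 2) * sqrt pi"
    by (simp add: powr_half_sqrt[symmetric] powr_add[symmetric] diff_divide_distrib)
  have "pi powr ((real d - 1) / 2) * Gamma (real d / 2) \<le> pi powr ((real d - 1) / 2) * (sqrt pi * Gamma (real d / 2 + 1 / 2))"
    by (intro mult_left_mono Gamma_half_step_le assms) simp
  then show ?thesis unfolding 1 2 3
    using G by (simp add: divide_le_eq le_divide_eq mult_ac)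
qed

subsection \<open>Lower bound\<close>

lemma set_integral_divergence:
  fixes E A :: "'a::euclidean_space set"
  assumes E: "E \<in> sets lebesgue" and A: "A \<in> sets borel" and EA: "AE x in lborel. x \<in> E \<longleftrightarrow> x \<in> A"
    and \<phi>: "C1b \<phi> D" and div: "\<And>x. divergence \<phi> x = trace_of D x"
  shows "(LINT x:E|lebesgue. divergence \<phi> x) = (\<integral>x. indicator A x * trace_of D x \<partial>lborel)"
proof -
  have m: "trace_of D \<in> borel_measurable borel" using C1b_measurable(2)[OF \<phi>] by measurable
  then have m': "trace_of D \<in> borel_measurable lebesgue" by (simp add: measurable_completion)
  have "(LINT x:E|lebesgue. divergence \<phi> x) = (\<integral>x. indicator A x * trace_of D x \<partial>lebesgue)"
    unfolding set_lebesgue_integral_def div real_scaleR_def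
  proof (rule integral_cong_AE)
    show "(\<lambda>x. indicator E x * trace_of D x) \<in> borel_measurable lebesgue"
      by (intro borel_measurable_times borel_measurable_indicator E m')
    show "(\<lambda>x. indicator A x * trace_of D x) \<in> borel_measurable lebesgue"
      by (intro borel_measurable_times borel_measurable_indicator m') (use A in simp)
    show "AE x in lebesgue. indicator E x * trace_of D x = indicator A x * trace_of D x"
      by (rule AE_completion) (use EA in eventually_elim, auto simp: indicator_def)
  qed
  also have "\<dots> = (\<integral>x. indicator A x * trace_of D x \<partial>lborel)"
    by (rule integral_completion) (use A m in simp)
  finally show ?thesis .
qed

lemma perimeter_nonneg: "perimeter (E :: 'a::euclidean_space set) \<ge> 0"
proof -
  have z: "C1b (\<lambda>_::'a. 0 :: 'a) (\<lambda>_ _. 0)"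
    by (rule C1b_compact_support[where R=0]) auto
  have "(\<lambda>_. 0 :: 'a) \<in> {\<phi> \<in> C1c_fields. \<forall>x. norm (\<phi> x) \<le> 1}"
    using C1b_C1c_fields(1)[OF z, of 0] by auto
  then have "ereal (LINT x:E|lebesgue. divergence (\<lambda>_. 0 :: 'a) x) \<le> perimeter E"
    unfolding perimeter_def by (rule SUP_upper)
  moreover have "divergence (\<lambda>_. 0 :: 'a) x = 0" for x
    using C1b_C1c_fields(2)[OF z, of 0 x] by simp
  ultimately show ?thesis by (simp add: set_lebesgue_integral_def zero_ereal_def)
qed

lemma perimeter_boundI:
  fixes E A :: "'a::euclidean_space set"
  assumes E: "E \<in> sets lebesgue" and A: "A \<in> sets borel" and EA: "AE x in lborel. x \<in> E \<longleftrightarrow> x \<in> A"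
    and P: "perimeter E = ereal P"
  shows "perimeter_bound (indicator A) P"
  unfolding perimeter_bound_def
proof (intro allI impI)
  fix \<phi> :: "'a \<Rightarrow> 'a" and D R
  assume \<phi>: "C1b \<phi> D" and R: "\<forall>x. norm x > R \<longrightarrow> \<phi> x = 0" and 1: "\<forall>x. norm (\<phi> x) \<le> 1"
  have R': "\<And>x. norm x > R \<Longrightarrow> \<phi> x = 0" using R by blast
  have c: "\<phi> \<in> C1c_fields" by (rule C1b_C1c_fields(1)[OF \<phi>, of R]) (rule R')
  have div: "\<And>x. divergence \<phi> x = trace_of D x" by (rule C1b_C1c_fields(2)[OF \<phi>, of R]) (rule R')
  have "ereal (LINT x:E|lebesgue. divergence \<phi> x) \<le> perimeter E"
    unfolding perimeter_def by (rule SUP_upper) (use c 1 in auto)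
  then show "(\<integral>x. indicator A x * trace_of D x \<partial>lborel) \<le> P"
    unfolding P set_integral_divergence[OF E A EA \<phi> div] by simp
qed

text \<open>The integral of \<open>t powr - s\<close> over \<open>{r..\<eta>}\<close> in closed
  form.\<close>

definition radial_mass :: "real \<Rightarrow> real \<Rightarrow> real \<Rightarrow> real" where
  "radial_mass s r \<eta> = (if s = 1 then ln \<eta> - ln r else (r powr (1 - s) - \<eta> powr (1 - s)) / (s - 1))"

lemma radial_mass:
  assumes "0 < r" "r \<le> \<eta>" "s \<ge> 1"
  shows "(\<integral>\<^sup>+t. ennreal (t powr - s) * indicator {r..\<eta>} t \<partial>lborel) = ennreal (radial_mass s r \<eta>)"
    and "radial_mass s r \<eta> \<ge> 0"
proof -
  show "(\<integral>\<^sup>+t. ennreal (t powr - s) * indicator {r..\<eta>} t \<partial>lborel) = ennreal (radial_mass s r \<eta>)"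
    using nn_integral_powr_Icc[OF assms(1,2), of s] nn_integral_inverse_Icc[OF assms(1,2)]
    by (simp add: radial_mass_def)
  have "\<eta> powr (1 - s) \<le> r powr (1 - s)" if "s > 1" using assms that by (intro powr_mono2') auto
  then show "radial_mass s r \<eta> \<ge> 0" using assms by (auto simp: radial_mass_def ln_mono)
qed

lemma sigma_s_pos:
  assumes "0 < r" "r < 1" "s \<ge> 1"
  shows "sigma_s d s r > 0"
proof (cases "s = 1")
  case True
  then show ?thesis using assms ln_less_zero[of r] by (simp add: sigma_s_def)
next
  case False
  then show ?thesis using assms by (auto simp: sigma_s_def intro!: mult_pos_pos divide_pos_pos add_nonneg_pos)
qed

lemma inverse_ln_tendsto_0: "((\<lambda>r::real. c / ln r) \<longlongrightarrow> 0) (at_right 0)"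
  by (rule tendsto_divide_0[OF tendsto_const filterlim_at_bot_imp_at_infinity[OF ln_at_0]])

text \<open>The upper end \<open>\<eta>\<close> contributes a fixed amount while
  \<open>sigma_s\<close> diverges, so the limit does not depend on \<open>\<eta>\<close>. The
  quotient is \<open>1 - ln \<eta> / ln r\<close> at \<open>s = 1\<close> and
  \<open>1 - \<eta> powr (1 - s) * r powr (s - 1)\<close> for \<open>s > 1\<close>, once
  \<open>r < 1\<close>.\<close>

lemma radial_mass_sigma_tendsto:
  assumes s: "s \<ge> 1" and \<eta>: "\<eta> > 0"
  shows "((\<lambda>r. (real d + s) / (real d + 1) * radial_mass s r \<eta> / sigma_s d s r) \<longlongrightarrow> 1) (at_right 0)"
proof -
  have ev: "\<forall>\<^sub>F r in at_right 0. 0 < r \<and> r < (1::real)"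
    using eventually_at_right_real[of 0 1] by (auto elim: eventually_mono)
  show ?thesis
  proof (cases "s = 1")
    case True
    have "((\<lambda>r. 1 - ln \<eta> / ln r) \<longlongrightarrow> 1 - 0) (at_right 0)"
      by (intro tendsto_intros inverse_ln_tendsto_0)
    then have "((\<lambda>r. 1 - ln \<eta> / ln r) \<longlongrightarrow> 1) (at_right 0)" by simp
    moreover have "\<forall>\<^sub>F r in at_right 0. 1 - ln \<eta> / ln r = (real d + s) / (real d + 1) * radial_mass s r \<eta> / sigma_s d s r"
      using ev
    proof eventually_elim
      case (elim r)
      then have l: "ln r < 0" using ln_less_zero by simp
      have "1 - ln \<eta> / ln r = (ln \<eta> - ln r) / - ln r" using l by (simp add: field_simps)
      then show ?case using True l by (simp add: radial_mass_def sigma_s_def)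
    qed
    ultimately show ?thesis by (rule tendsto_cong[THEN iffD1, rotated])
  next
    case False
    then have s1: "s > 1" using s by simp
    have "((\<lambda>r. r powr (s - 1)) \<longlongrightarrow> 0) (at_right (0::real))"
      by (rule tendsto_zero_powrI[where b="s - 1"])
         (use s1 in \<open>auto intro!: tendsto_intros eventually_at_right_less[THEN eventually_mono]\<close>)
    then have "((\<lambda>r. 1 - \<eta> powr (1 - s) * r powr (s - 1)) \<longlongrightarrow> 1 - \<eta> powr (1 - s) * 0) (at_right 0)"
      by (intro tendsto_intros)
    then have "((\<lambda>r. 1 - \<eta> powr (1 - s) * r powr (s - 1)) \<longlongrightarrow> 1) (at_right 0)" by simp
    moreover have "\<forall>\<^sub>F r in at_right 0. 1 - \<eta> powr (1 - s) * r powr (s - 1) = (real d + s) / (real d + 1) * radial_mass s r \<eta> / sigma_s d s r"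
      using ev
    proof eventually_elim
      case (elim r)
      let ?p = "r powr (1 - s)"
      have p: "?p > 0" using elim by simp
      have inv: "r powr (s - 1) = 1 / ?p" using powr_minus_divide[of r "1 - s"] by simp
      have c: "(real d + s) / (real d + 1) > 0" using s by (intro divide_pos_pos) auto
      have "(real d + s) / (real d + 1) * radial_mass s r \<eta> / sigma_s d s r
         = ((?p - \<eta> powr (1 - s)) / (s - 1)) / (?p / (s - 1))"
        unfolding radial_mass_def sigma_s_def using False c
        by (simp only: if_False) (rule mult_divide_mult_cancel_left, linarith)
      also have "\<dots> = (?p - \<eta> powr (1 - s)) / ?p" using s1 by simp
      also have "\<dots> = 1 - \<eta> powr (1 - s) * r powr (s - 1)" unfolding inv using p by (simp add: diff_divide_distrib)
      finally show ?case by simp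
    qed
    ultimately show ?thesis by (rule tendsto_cong[THEN iffD1, rotated])
  qed
qed

lemma ennreal_two_mult_le_iff: "2 * a \<le> 2 * b \<longleftrightarrow> a \<le> (b::ennreal)"
  by (rule ennreal_mult_le_mult_iff) auto

text \<open>Only the layers between \<open>r\<close> and \<open>\<eta>\<close> are kept, where the
  small-radius bound on \<open>ball_diff\<close> is available; the others are nonnegative.\<close>

lemma Jt_lower_bound:
  fixes E A :: "'a::euclidean_space set"
  assumes A: "A \<in> sets borel" and fin: "emeasure lborel A < \<infinity>" and EA: "AE x in lborel. x \<in> E \<longleftrightarrow> x \<in> A"
    and s: "s \<ge> 1" and \<phi>: "C1b \<phi> D" and R: "\<And>x. norm x > R \<Longrightarrow> \<phi> x = 0" and 1: "\<And>x. norm (\<phi> x) \<le> 1"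
    and a: "0 \<le> a" "a < (\<integral>x. indicator A x * trace_of D x \<partial>lborel)"
  obtains \<eta> where "\<eta> > 0" "\<And>r. 0 < r \<Longrightarrow> r < \<eta> \<Longrightarrow>
     ennreal (unit_ball_vol (real DIM('a) - 1) * a * ((real DIM('a) + s) / (real DIM('a) + 1) * radial_mass s r \<eta>)) \<le> Jt s r E"
proof -
  let ?d = "DIM('a)"
  let ?w = "unit_ball_vol (real ?d - 1)"
  have w: "?w \<ge> 0" using DIM_positive[where 'a='a] by (intro unit_ball_vol_nonneg) (simp add: Suc_leI)
  obtain \<delta> where d: "\<delta> > 0" "\<And>\<rho>. 0 < \<rho> \<Longrightarrow> \<rho> < \<delta> \<Longrightarrow>
     ennreal (moment_const ?d * a * \<rho> ^ (?d + 1)) \<le> ball_diff (indicator A) \<rho>"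
    by (rule ball_diff_ge_divergence[OF A fin \<phi> R 1 a]) (assumption, rule that)
  \<comment> \<open>The bound holds for radii strictly below \<open>\<delta>\<close>, while the
    closed interval up to \<open>\<eta>\<close> is integrated.\<close>
  define \<eta> where "\<eta> = \<delta> / 2"
  have \<eta>: "\<eta> > 0" "\<eta> < \<delta>" using d(1) by (auto simp: \<eta>_def)
  have m: "moment_const ?d \<ge> 0" by (rule moment_const_nonneg) (simp add: Suc_leI)
  have "ennreal (?w * a * ((real ?d + s) / (real ?d + 1) * radial_mass s r \<eta>)) \<le> Jt s r E" if r: "0 < r" "r < \<eta>" for r
  proof -
    let ?c = "(real ?d + s) * (moment_const ?d * a)"
    have c: "?c \<ge> 0" using s m a by (intro mult_nonneg_nonneg) auto
    have "2 * ennreal (?w * a * ((real ?d + s) / (real ?d + 1) * radial_mass s r \<eta>)) =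
        ennreal (2 * (?w * a * ((real ?d + s) / (real ?d + 1) * radial_mass s r \<eta>)))"
      using w a s radial_mass(2)[OF r(1) less_imp_le[OF r(2)] s]
      by (subst ennreal_mult) (auto intro!: mult_nonneg_nonneg divide_nonneg_nonneg)
    \<comment> \<open>Here \<open>2 * ?w = (real ?d + 1) * moment_const ?d\<close> absorbs the
      denominator of \<open>sigma_s\<close>.\<close>
    also have "2 * (?w * a * ((real ?d + s) / (real ?d + 1) * radial_mass s r \<eta>)) = ?c * radial_mass s r \<eta>"
      by (simp add: moment_const_def)
    also have "ennreal (?c * radial_mass s r \<eta>) = ennreal ?c * ennreal (radial_mass s r \<eta>)"
      by (rule ennreal_mult[OF c radial_mass(2)]) (use r s in auto)
    also have "\<dots> = ennreal ?c * (\<integral>\<^sup>+\<rho>. ennreal (\<rho> powr - s) * indicator {r..\<eta>} \<rho> \<partial>lborel)"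
      by (subst radial_mass(1)) (use r s in auto)
    also have "\<dots> = (\<integral>\<^sup>+\<rho>. ennreal ?c * (ennreal (\<rho> powr - s) * indicator {r..\<eta>} \<rho>) \<partial>lborel)"
      by (rule nn_integral_cmult[symmetric]) measurable
    also have "\<dots> \<le> (\<integral>\<^sup>+\<rho>. indicator {r..} \<rho> * ennreal ((real ?d + s) * \<rho> powr (- real ?d - s - 1))
      * ball_diff (indicator A) \<rho> \<partial>lborel)"
    proof (rule nn_integral_mono)
      fix \<rho> :: real
      show "ennreal ?c * (ennreal (\<rho> powr - s) * indicator {r..\<eta>} \<rho>) \<le>
         indicator {r..} \<rho> * ennreal ((real ?d + s) * \<rho> powr (- real ?d - s - 1)) * ball_diff (indicator A) \<rho>"
      proof (cases "\<rho> \<in> {r..\<eta>}")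
        case True
        then have \<rho>: "0 < \<rho>" "\<rho> < \<delta>" using r \<eta> by auto
        have "ennreal ?c * ennreal (\<rho> powr - s) = ennreal (?c * \<rho> powr - s)"
          by (rule ennreal_mult[symmetric, OF c]) simp
        also have "?c * \<rho> powr - s = ((real ?d + s) * \<rho> powr (- real ?d - s - 1)) * (moment_const ?d * a * \<rho> ^ (?d + 1))"
          unfolding powr_layer_mult[OF \<rho>(1), of ?d s, symmetric] by (simp add: mult_ac)
        also have "ennreal \<dots> = ennreal ((real ?d + s) * \<rho> powr (- real ?d - s - 1)) * ennreal (moment_const ?d * a * \<rho> ^ (?d + 1))"
          using s m a \<rho> by (intro ennreal_mult mult_nonneg_nonneg) auto
        also have "\<dots> \<le> ennreal ((real ?d + s) * \<rho> powr (- real ?d - s - 1)) * ball_diff (indicator A) \<rho>"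
          by (intro mult_left_mono d(2)[OF \<rho>]) auto
        finally show ?thesis using True by simp
      qed simp
    qed
    also have "\<dots> = 2 * Jt s r E" by (rule Jt_layer_cake[OF A EA r(1) s, symmetric])
    finally show ?thesis by (simp only: ennreal_two_mult_le_iff)
  qed
  with \<eta>(1) that show ?thesis by blast
qed

section \<open>Extended real quotients and the lower limit\<close>

lemma ereal_le_ratio:
  assumes "ennreal c \<le> Jt s r E" "0 < r" "r < 1" "s \<ge> 1" "c \<ge> 0"
  shows "ereal (c / sigma_s DIM('a::euclidean_space) s r) \<le> ratio s (E :: 'a set) r"
proof -
  have sg: "sigma_s DIM('a) s r > 0" by (rule sigma_s_pos[OF assms(2-4)])
  have "ereal c \<le> enn2ereal (Jt s r E)"
    using assms(1,5) by (metis enn2ereal_ennreal less_eq_ennreal.rep_eq)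
  then have "ereal c / ereal (sigma_s DIM('a) s r) \<le> ratio s E r"
    unfolding ratio_def by (rule ereal_divide_right_mono) (use sg in simp)
  then show ?thesis using sg by simp
qed

lemma ratio_le_ereal:
  assumes "Jt s r E \<le> ennreal c" "0 < r" "r < 1" "s \<ge> 1" "c \<ge> 0"
  shows "ratio s (E :: 'a set) r \<le> ereal (c / sigma_s DIM('a::euclidean_space) s r)"
proof -
  have sg: "sigma_s DIM('a) s r > 0" by (rule sigma_s_pos[OF assms(2-4)])
  have "enn2ereal (Jt s r E) \<le> ereal c"
    using assms(1,5) by (metis enn2ereal_ennreal less_eq_ennreal.rep_eq)
  then have "ratio s E r \<le> ereal c / ereal (sigma_s DIM('a) s r)"
    unfolding ratio_def by (rule ereal_divide_right_mono) (use sg in simp)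
  then show ?thesis using sg by simp
qed

lemma eventually_at_right_0: "\<epsilon> > 0 \<Longrightarrow> \<forall>\<^sub>F r in at_right 0. 0 < r \<and> r < (\<epsilon>::real)"
  using eventually_at_right_real[of 0 \<epsilon>] by (auto elim: eventually_mono)

lemma Liminf_ratio_nonneg:
  assumes "s \<ge> 1"
  shows "0 \<le> Liminf (at_right 0) (ratio s (E :: 'a::euclidean_space set))"
proof (rule Liminf_bounded)
  show "\<forall>\<^sub>F r in at_right 0. 0 \<le> ratio s E r"
    using eventually_at_right_0[of 1]
  proof (rule eventually_mono)
    fix r :: real assume "0 < r \<and> r < 1"
    then show "0 \<le> ratio s E r" using ereal_le_ratio[of 0 s r E] assms by (simp add: zero_ereal_def)
  qed simp
qed

text \<open>Every test field is treated separately and the supremum is taken last, so infinite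
  perimeter is covered; this is what yields the finiteness criterion.\<close>

lemma Liminf_ratio_ge:
  fixes E :: "'a::euclidean_space set"
  assumes E: "E \<in> sets lebesgue" "emeasure lebesgue E < \<infinity>" and s: "s \<ge> 1"
  shows "ereal (unit_ball_vol (real DIM('a) - 1)) * perimeter E \<le> Liminf (at_right 0) (ratio s E)"
proof -
  let ?d = "DIM('a)"
  let ?w = "unit_ball_vol (real ?d - 1)"
  let ?L = "Liminf (at_right 0) (ratio s E)"
  have w: "?w > 0" using DIM_positive[where 'a='a] by (intro unit_ball_vol_pos) (simp add: Suc_leI)
  have L0: "?L \<ge> 0" by (rule Liminf_ratio_nonneg[OF s])
  obtain A where A: "A \<in> sets borel" "emeasure lborel A < \<infinity>" "AE x in lborel. x \<in> E \<longleftrightarrow> x \<in> A"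
    by (rule lebesgue_borel_representative[OF E]) (rule that)
  have "perimeter E \<le> ?L / ereal ?w"
    unfolding perimeter_def
  proof (rule SUP_least)
    fix \<phi> :: "'a \<Rightarrow> 'a" assume "\<phi> \<in> {\<phi> \<in> C1c_fields. \<forall>x. norm (\<phi> x) \<le> 1}"
    then have \<phi>c: "\<phi> \<in> C1c_fields" and 1: "\<And>x. norm (\<phi> x) \<le> 1" by auto
    obtain D R where \<phi>: "C1b \<phi> D" and R: "\<And>x. norm x > R \<Longrightarrow> \<phi> x = 0" and div: "\<And>x. divergence \<phi> x = trace_of D x"
      by (rule C1c_fields_C1b[OF \<phi>c]) (rule that)
    define I where "I = (\<integral>x. indicator A x * trace_of D x \<partial>lborel)"
    have I: "(LINT x:E|lebesgue. divergence \<phi> x) = I"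
      unfolding I_def by (rule set_integral_divergence[OF E(1) A(1) A(3) \<phi> div])
    have key: "ereal (?w * a) \<le> ?L" if a: "0 \<le> a" "a < I" for a
    proof -
      obtain \<eta> where \<eta>: "\<eta> > 0" "\<And>r. 0 < r \<Longrightarrow> r < \<eta> \<Longrightarrow>
         ennreal (?w * a * ((real ?d + s) / (real ?d + 1) * radial_mass s r \<eta>)) \<le> Jt s r E"
        by (rule Jt_lower_bound[OF A s \<phi> R 1 a[unfolded I_def]]) (assumption, rule that)
      let ?l = "\<lambda>r. ?w * a * ((real ?d + s) / (real ?d + 1) * radial_mass s r \<eta> / sigma_s ?d s r)"
      have "(?l \<longlongrightarrow> ?w * a * 1) (at_right 0)"
        by (intro tendsto_mult tendsto_const radial_mass_sigma_tendsto[OF s \<eta>(1)])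
      then have "((\<lambda>r. ereal (?l r)) \<longlongrightarrow> ereal (?w * a)) (at_right 0)" by simp
      then have "ereal (?w * a) = Liminf (at_right 0) (\<lambda>r. ereal (?l r))"
        by (intro lim_imp_Liminf[symmetric]) auto
      also have "\<dots> \<le> ?L"
      proof (rule Liminf_mono)
        show "\<forall>\<^sub>F r in at_right 0. ereal (?l r) \<le> ratio s E r"
          using eventually_at_right_0[of "min 1 \<eta>"]
        proof (rule eventually_mono)
          fix r assume r: "0 < r \<and> r < min 1 \<eta>"
          have "ereal (?w * a * ((real ?d + s) / (real ?d + 1) * radial_mass s r \<eta>) / sigma_s ?d s r) \<le> ratio s E r"
            using r s w a radial_mass(2)[of r \<eta> s]
            by (intro ereal_le_ratio \<eta>(2) mult_nonneg_nonneg divide_nonneg_nonneg) auto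
          then show "ereal (?l r) \<le> ratio s E r" by simp
        qed (use \<eta>(1) in simp)
      qed
      finally show ?thesis .
    qed
    \<comment> \<open>\<open>key\<close> concerns nonnegative \<open>a\<close> only. For
      \<open>I \<le> 0\<close> nonnegativity of the lower limit is enough; otherwise a violation
      would leave room for an \<open>a\<close> strictly between \<open>l / ?w\<close> and
      \<open>I\<close>.\<close>
    have "ereal (?w * I) \<le> ?L"
    proof (cases "I \<le> 0")
      case True
      then have "?w * I \<le> 0" using w by (simp add: mult_le_0_iff)
      then have "ereal (?w * I) \<le> 0" by (simp add: zero_ereal_def)
      then show ?thesis using L0 by (rule order_trans)
    next
      case False
      show ?thesis
      proof (rule ccontr)
        assume "\<not> ereal (?w * I) \<le> ?L"
        then have lt: "?L < ereal (?w * I)" by simp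
        then obtain l where l: "?L = ereal l" using L0 by (cases ?L) auto
        have l0: "l \<ge> 0" using L0 l by (simp add: zero_ereal_def)
        have "l / ?w < I" using lt l w by (simp add: pos_divide_less_eq mult.commute)
        then obtain a where a: "l / ?w < a" "a < I" using dense by blast
        have "a \<ge> 0" using a(1) l0 w by (meson divide_nonneg_pos less_eq_real_def order_trans)
        then have "?w * a \<le> l" using key[of a] a(2) l by simp
        then show False using a(1) w by (simp add: pos_divide_less_eq mult.commute)
      qed
    qed
    then show "ereal (LINT x:E|lebesgue. divergence \<phi> x) \<le> ?L / ereal ?w"
      unfolding I using w by (subst ereal_le_divide_pos) auto
  qed
  then show ?thesis using w by (subst (asm) ereal_le_divide_pos) auto
qed

subsection \<open>Upper bound\<close>

text \<open>For \<open>s > 1\<close> the perimeter estimate can be integrated over all layers from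
  \<open>r\<close> to infinity, which produces \<open>sigma_s\<close> itself: the inequality holds
  for each \<open>r\<close>, not only in the limit.\<close>

lemma Jt_upper_bound:
  fixes E A :: "'a::euclidean_space set"
  assumes A: "A \<in> sets borel" and fin: "emeasure lborel A < \<infinity>" and EA: "AE x in lborel. x \<in> E \<longleftrightarrow> x \<in> A"
    and P: "perimeter_bound (indicator A) P" "P \<ge> 0" and s: "s > 1" and r: "0 < r"
  shows "Jt s r E \<le> ennreal (unit_ball_vol (real DIM('a) - 1) * P * sigma_s DIM('a) s r)"
proof -
  let ?d = "DIM('a)"
  let ?w = "unit_ball_vol (real ?d - 1)"
  let ?c = "(real ?d + s) * (moment_const ?d * P)"
  have w: "?w \<ge> 0" using DIM_positive[where 'a='a] by (intro unit_ball_vol_nonneg) (simp add: Suc_leI)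
  have m: "moment_const ?d \<ge> 0" by (rule moment_const_nonneg) (simp add: Suc_leI)
  have c: "?c \<ge> 0" using s m P by (intro mult_nonneg_nonneg) auto
  have "2 * Jt s r E = (\<integral>\<^sup>+\<rho>. indicator {r..} \<rho> * ennreal ((real ?d + s) * \<rho> powr (- real ?d - s - 1))
      * ball_diff (indicator A) \<rho> \<partial>lborel)"
    by (rule Jt_layer_cake[OF A EA r]) (use s in simp)
  also have "\<dots> \<le> (\<integral>\<^sup>+\<rho>. ennreal ?c * (ennreal (\<rho> powr - s) * indicator {r..} \<rho>) \<partial>lborel)"
  proof (rule nn_integral_mono)
    fix \<rho> :: real
    show "indicator {r..} \<rho> * ennreal ((real ?d + s) * \<rho> powr (- real ?d - s - 1)) * ball_diff (indicator A) \<rho>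
       \<le> ennreal ?c * (ennreal (\<rho> powr - s) * indicator {r..} \<rho>)"
    proof (cases "\<rho> \<in> {r..}")
      case True
      then have \<rho>: "0 < \<rho>" using r by auto
      have "ennreal ((real ?d + s) * \<rho> powr (- real ?d - s - 1)) * ball_diff (indicator A) \<rho>
        \<le> ennreal ((real ?d + s) * \<rho> powr (- real ?d - s - 1)) * (ennreal (moment_const ?d * \<rho> ^ (?d + 1)) * ennreal P)"
        by (intro mult_left_mono ball_diff_le_perimeter[OF A fin P(1) \<rho>]) auto
      also have "\<dots> = ennreal (((real ?d + s) * \<rho> powr (- real ?d - s - 1)) * ((moment_const ?d * \<rho> ^ (?d + 1)) * P))"
        using s m P \<rho> by (simp add: ennreal_mult[symmetric] del: ennreal_plus)
      also have "((real ?d + s) * \<rho> powr (- real ?d - s - 1)) * ((moment_const ?d * \<rho> ^ (?d + 1)) * P) = ?c * \<rho> powr - s"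
        unfolding powr_layer_mult[OF \<rho>, of ?d s, symmetric] by (simp add: mult_ac)
      also have "ennreal \<dots> = ennreal ?c * ennreal (\<rho> powr - s)" by (rule ennreal_mult[OF c]) simp
      finally show ?thesis using True by simp
    qed simp
  qed
  also have "\<dots> = ennreal ?c * ennreal (r powr (1 - s) / (s - 1))"
    by (subst nn_integral_cmult, simp, subst nn_integral_powr_atLeast) (use r s in auto)
  also have "\<dots> = ennreal (?c * (r powr (1 - s) / (s - 1)))"
    by (rule ennreal_mult[symmetric, OF c]) (use s in simp)
  also have "?c * (r powr (1 - s) / (s - 1)) = 2 * (?w * P * sigma_s ?d s r)"
    using s by (simp add: moment_const_def sigma_s_def)
  also have "ennreal \<dots> = 2 * ennreal (?w * P * sigma_s ?d s r)"
    using w P s by (subst ennreal_mult) (auto simp: sigma_s_def intro!: mult_nonneg_nonneg divide_nonneg_nonneg)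
  finally show ?thesis by (simp only: ennreal_two_mult_le_iff)
qed

text \<open>The layers are split at radius 1: below it the perimeter estimate gives the logarithm,
  above it the volume estimate gives a constant independent of \<open>r\<close>.\<close>

lemma Jt_upper_bound_log:
  fixes E A :: "'a::euclidean_space set"
  assumes A: "A \<in> sets borel" and fin: "emeasure lborel A < \<infinity>" and EA: "AE x in lborel. x \<in> E \<longleftrightarrow> x \<in> A"
    and P: "perimeter_bound (indicator A) P" "P \<ge> 0"
  obtains C where "C \<ge> 0" "\<And>r. 0 < r \<Longrightarrow> r < 1 \<Longrightarrow> Jt 1 r E \<le> ennreal (unit_ball_vol (real DIM('a) - 1) * P * \<bar>ln r\<bar> + C)"
proof -
  let ?d = "DIM('a)"
  let ?w = "unit_ball_vol (real ?d - 1)"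
  let ?c = "(real ?d + 1) * (moment_const ?d * P)"
  have w: "?w \<ge> 0" using DIM_positive[where 'a='a] by (intro unit_ball_vol_nonneg) (simp add: Suc_leI)
  have m: "moment_const ?d \<ge> 0" by (rule moment_const_nonneg) (simp add: Suc_leI)
  have c: "?c \<ge> 0" using m P by (intro mult_nonneg_nonneg) auto
  define V where "V = measure lborel A"
  have V: "emeasure lborel A = ennreal V" "V \<ge> 0"
    using fin by (auto simp: V_def emeasure_eq_ennreal_measure)
  \<comment> \<open>The weight times the volume estimate is \<open>2 * C * \<rho> powr - 2\<close>,
    and \<open>\<rho> powr - 2\<close> has integral 1 over \<open>{1..}\<close>.\<close>
  define C where "C = (real ?d + 1) * (V * unit_ball_vol (real ?d))"
  have C: "C \<ge> 0" using V by (simp add: C_def)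
  have "Jt 1 r E \<le> ennreal (?w * P * \<bar>ln r\<bar> + C)" if r: "0 < r" "r < 1" for r
  proof -
    have "2 * Jt 1 r E = (\<integral>\<^sup>+\<rho>. indicator {r..} \<rho> * ennreal ((real ?d + 1) * \<rho> powr (- real ?d - 1 - 1))
        * ball_diff (indicator A) \<rho> \<partial>lborel)"
      by (rule Jt_layer_cake[OF A EA r(1)]) simp
    also have "\<dots> \<le> (\<integral>\<^sup>+\<rho>. ennreal ?c * (ennreal (\<rho> powr - 1) * indicator {r..1} \<rho>)
        + ennreal (2 * C) * (ennreal (\<rho> powr - 2) * indicator {1..} \<rho>) \<partial>lborel)"
    proof (rule nn_integral_mono)
      fix \<rho> :: real
      let ?l = "ennreal ((real ?d + 1) * \<rho> powr (- real ?d - 1 - 1))"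
      consider "\<rho> \<in> {r..1}" | "\<rho> > 1" | "\<rho> < r" by fastforce
      then show "indicator {r..} \<rho> * ?l * ball_diff (indicator A) \<rho>
         \<le> ennreal ?c * (ennreal (\<rho> powr - 1) * indicator {r..1} \<rho>)
        + ennreal (2 * C) * (ennreal (\<rho> powr - 2) * indicator {1..} \<rho>)"
      proof cases
        case 1
        then have \<rho>: "0 < \<rho>" using r by auto
        have "?l * ball_diff (indicator A) \<rho> \<le> ?l * (ennreal (moment_const ?d * \<rho> ^ (?d + 1)) * ennreal P)"
          by (intro mult_left_mono ball_diff_le_perimeter[OF A fin P(1) \<rho>]) auto
        also have "\<dots> = ennreal (((real ?d + 1) * \<rho> powr (- real ?d - 1 - 1)) * ((moment_const ?d * \<rho> ^ (?d + 1)) * P))"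
          using m P \<rho> by (simp add: ennreal_mult[symmetric] del: ennreal_plus)
        also have "((real ?d + 1) * \<rho> powr (- real ?d - 1 - 1)) * ((moment_const ?d * \<rho> ^ (?d + 1)) * P) = ?c * \<rho> powr - 1"
          unfolding powr_layer_mult[OF \<rho>, of ?d 1, symmetric] by (simp add: mult_ac)
        also have "ennreal \<dots> = ennreal ?c * ennreal (\<rho> powr - 1)" by (rule ennreal_mult[OF c]) simp
        also have "\<dots> \<le> ennreal ?c * ennreal (\<rho> powr - 1) + ennreal (2 * C) * (ennreal (\<rho> powr - 2) * indicator {1..} \<rho>)"
          by simp
        finally show ?thesis using 1 by simp
      next
        case 2
        then have \<rho>: "0 < \<rho>" by simp
        have "\<rho> powr (- real ?d - 1 - 1) * \<rho> ^ ?d = \<rho> powr (- real ?d - 1 - 1) * \<rho> powr real ?d"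
          using \<rho> by (simp add: powr_realpow)
        also have "\<dots> = \<rho> powr - 2" by (subst powr_add[symmetric]) simp
        finally have pw: "\<rho> powr (- real ?d - 1 - 1) * \<rho> ^ ?d = \<rho> powr - 2" .
        have "?l * ball_diff (indicator A) \<rho> \<le> ?l * (2 * emeasure lborel A * ennreal (unit_ball_vol (real ?d) * \<rho> ^ ?d))"
          using \<rho> by (intro mult_left_mono ball_diff_le_volume[OF A]) auto
        also have "2 * emeasure lborel A = ennreal (2 * V)" unfolding V(1) using V(2) by (simp add: ennreal_mult)
        also have "?l * (ennreal (2 * V) * ennreal (unit_ball_vol (real ?d) * \<rho> ^ ?d))
          = ennreal (((real ?d + 1) * \<rho> powr (- real ?d - 1 - 1)) * ((2 * V) * (unit_ball_vol (real ?d) * \<rho> ^ ?d)))"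
          using V(2) \<rho> by (simp add: ennreal_mult[symmetric] del: ennreal_plus)
        also have "((real ?d + 1) * \<rho> powr (- real ?d - 1 - 1)) * ((2 * V) * (unit_ball_vol (real ?d) * \<rho> ^ ?d)) = 2 * C * \<rho> powr - 2"
          unfolding C_def pw[symmetric] by (simp add: mult_ac)
        also have "ennreal \<dots> = ennreal (2 * C) * ennreal (\<rho> powr - 2)" by (rule ennreal_mult) (use C in auto)
        also have "\<dots> \<le> ennreal ?c * (ennreal (\<rho> powr - 1) * indicator {r..1} \<rho>) + ennreal (2 * C) * ennreal (\<rho> powr - 2)"
          by simp
        finally show ?thesis using 2 r by simp
      qed simp
    qed
    also have "\<dots> = ennreal ?c * (\<integral>\<^sup>+\<rho>. ennreal (\<rho> powr - 1) * indicator {r..1} \<rho> \<partial>lborel)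
        + ennreal (2 * C) * (\<integral>\<^sup>+\<rho>. ennreal (\<rho> powr - 2) * indicator {1..} \<rho> \<partial>lborel)"
      by (subst nn_integral_add, simp, simp, subst nn_integral_cmult, simp, subst nn_integral_cmult, simp, rule refl)
    also have "(\<integral>\<^sup>+\<rho>. ennreal (\<rho> powr - 1) * indicator {r..1} \<rho> \<partial>lborel) = ennreal \<bar>ln r\<bar>"
      using nn_integral_inverse_Icc[of r 1] r ln_less_zero[of r] by simp
    also have "(\<integral>\<^sup>+\<rho>. ennreal (\<rho> powr - 2) * indicator {1..} \<rho> \<partial>lborel) = ennreal 1"
      using nn_integral_powr_atLeast[of 1 2] by simp
    also have "ennreal ?c * ennreal \<bar>ln r\<bar> + ennreal (2 * C) * ennreal 1 = ennreal (?c * \<bar>ln r\<bar>) + ennreal (2 * C)"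
      using c by (simp only: ennreal_mult[symmetric] abs_ge_zero) simp
    also have "\<dots> = ennreal (?c * \<bar>ln r\<bar> + 2 * C)"
      by (rule ennreal_plus[symmetric]) (use c C in \<open>auto intro: mult_nonneg_nonneg\<close>)
    also have "?c * \<bar>ln r\<bar> + 2 * C = 2 * (?w * P * \<bar>ln r\<bar> + C)"
      by (simp add: moment_const_def)
    also have "ennreal \<dots> = 2 * ennreal (?w * P * \<bar>ln r\<bar> + C)"
      using w P C by (subst ennreal_mult) auto
    finally show ?thesis by (simp only: ennreal_two_mult_le_iff)
  qed
  with C that show ?thesis by blast
qed

text \<open>The same constant is reached at \<open>s = 1\<close>, because the additive
  \<open>C\<close> disappears after division by \<open>\<bar>ln r\<bar>\<close>.\<close>

lemma Limsup_ratio_le: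
  fixes E :: "'a::euclidean_space set"
  assumes E: "E \<in> sets lebesgue" "emeasure lebesgue E < \<infinity>" and s: "s \<ge> 1" and fin: "perimeter E < \<infinity>"
  shows "Limsup (at_right 0) (ratio s E) \<le> ereal (unit_ball_vol (real DIM('a) - 1)) * perimeter E"
proof -
  let ?d = "DIM('a)"
  let ?w = "unit_ball_vol (real ?d - 1)"
  have w: "?w \<ge> 0" using DIM_positive[where 'a='a] by (intro unit_ball_vol_nonneg) (simp add: Suc_leI)
  obtain P where P: "perimeter E = ereal P" "P \<ge> 0"
    using fin perimeter_nonneg[of E] by (cases "perimeter E") auto
  obtain A where A: "A \<in> sets borel" "emeasure lborel A < \<infinity>" "AE x in lborel. x \<in> E \<longleftrightarrow> x \<in> A"
    by (rule lebesgue_borel_representative[OF E]) (rule that)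
  have PA: "perimeter_bound (indicator A) P" by (rule perimeter_boundI[OF E(1) A(1,3) P(1)])
  have "Limsup (at_right 0) (ratio s E) \<le> ereal (?w * P)"
  proof (cases "s = 1")
    case False
    then have s1: "s > 1" using s by simp
    show ?thesis
    proof (rule Limsup_bounded)
      show "\<forall>\<^sub>F r in at_right 0. ratio s E r \<le> ereal (?w * P)"
        using eventually_at_right_0[of 1]
      proof (rule eventually_mono)
        fix r :: real assume r: "0 < r \<and> r < 1"
        then have sg: "sigma_s ?d s r > 0" using sigma_s_pos s by simp
        have "ratio s E r \<le> ereal (?w * P * sigma_s ?d s r / sigma_s ?d s r)"
          by (rule ratio_le_ereal[OF Jt_upper_bound[OF A PA P(2) s1]])
             (use r s w P sg in \<open>auto intro!: mult_nonneg_nonneg\<close>)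
        then show "ratio s E r \<le> ereal (?w * P)" using sg by simp
      qed simp
    qed
  next
    case True
    obtain C where C: "C \<ge> 0" "\<And>r. 0 < r \<Longrightarrow> r < 1 \<Longrightarrow> Jt 1 r E \<le> ennreal (?w * P * \<bar>ln r\<bar> + C)"
      by (rule Jt_upper_bound_log[OF A PA P(2)]) (rule that)
    have "((\<lambda>r. ?w * P - C / ln r) \<longlongrightarrow> ?w * P - 0) (at_right 0)"
      by (intro tendsto_intros inverse_ln_tendsto_0)
    then have "((\<lambda>r. ereal (?w * P - C / ln r)) \<longlongrightarrow> ereal (?w * P)) (at_right 0)" by simp
    then have "Limsup (at_right 0) (\<lambda>r. ereal (?w * P - C / ln r)) = ereal (?w * P)"
      by (intro lim_imp_Limsup) auto
    moreover have "Limsup (at_right 0) (ratio s E) \<le> Limsup (at_right 0) (\<lambda>r. ereal (?w * P - C / ln r))"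
    proof (rule Limsup_mono)
      show "\<forall>\<^sub>F r in at_right 0. ratio s E r \<le> ereal (?w * P - C / ln r)"
        using eventually_at_right_0[of 1]
      proof (rule eventually_mono)
        fix r :: real assume r: "0 < r \<and> r < 1"
        then have l: "ln r < 0" using ln_less_zero by simp
        have "?w * P * \<bar>ln r\<bar> + C \<ge> 0"
          using w P(2) C(1) by (intro add_nonneg_nonneg mult_nonneg_nonneg) auto
        then have "ratio s E r \<le> ereal ((?w * P * \<bar>ln r\<bar> + C) / sigma_s ?d s r)"
          unfolding True using r by (intro ratio_le_ereal C(2)) auto
        also have "(?w * P * \<bar>ln r\<bar> + C) / sigma_s ?d s r = ?w * P - C / ln r"
          using True l by (simp add: sigma_s_def field_simps)
        finally show "ratio s E r \<le> ereal (?w * P - C / ln r)" .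
      qed simp
    qed
    ultimately show ?thesis by simp
  qed
  then show ?thesis using P(1) by simp
qed

theorem theorem3p4:
  fixes E :: "'a::euclidean_space set"
  assumes "DIM('a) \<ge> 2" and "E \<in> sets lebesgue" and "emeasure lebesgue E < \<infinity>"
  shows "(\<forall>s\<ge>1. Limsup (at_right 0) (ratio s E) < \<infinity> \<longrightarrow> perimeter E < \<infinity>)
    \<and> (perimeter E < \<infinity> \<longrightarrow>
        (\<forall>s\<ge>1. ereal (omega (real DIM('a) - 1)) * perimeter E \<le> Liminf (at_right 0) (ratio s E)
              \<and> Liminf (at_right 0) (ratio s E) \<le> Limsup (at_right 0) (ratio s E)
              \<and> Limsup (at_right 0) (ratio s E) \<le> ereal (Mconst s DIM('a)) * perimeter E)
      \<and> (\<forall>s>1. ((ratio s E) \<longlongrightarrow> ereal (omega (real DIM('a) - 1)) * perimeter E) (at_right 0)))"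
proof -
  let ?w = "omega (real DIM('a) - 1)"
  have w: "?w > 0" using assms(1) by (intro unit_ball_vol_pos) simp
  have le: "Liminf (at_right 0) (ratio s E) \<le> Limsup (at_right 0) (ratio s E)" for s
    by (rule Liminf_le_Limsup) simp
  have lower: "ereal ?w * perimeter E \<le> Liminf (at_right 0) (ratio s E)" if "s \<ge> 1" for s
    by (rule Liminf_ratio_ge[OF assms(2,3) that])
  \<comment> \<open>If the perimeter were infinite, the lower bound, whose constant is positive,
    would make the limsup infinite.\<close>
  have fin: "perimeter E < \<infinity>" if "s \<ge> 1" "Limsup (at_right 0) (ratio s E) < \<infinity>" for s
  proof (rule ccontr)
    assume "\<not> perimeter E < \<infinity>"
    then have "perimeter E = \<infinity>" by simp
    moreover have "ereal c * \<infinity> = \<infinity>" if "c > 0" for c using that by simp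
    ultimately have "ereal ?w * perimeter E = \<infinity>" using w by metis
    then have "\<infinity> \<le> Limsup (at_right 0) (ratio s E)"
      using order_trans[OF lower[OF that(1)] le[of s]] by (simp only:)
    then show False using that(2) by simp
  qed
  have M: "ereal ?w * perimeter E \<le> ereal (Mconst s DIM('a)) * perimeter E" for s
  proof -
    have "?w \<le> Mconst s DIM('a)"
      using unit_ball_vol_pred_le[of "DIM('a)"] assms(1) by (simp add: Mconst_def)
    then show ?thesis by (intro ereal_mult_right_mono perimeter_nonneg) simp
  qed
  have upper: "Limsup (at_right 0) (ratio s E) \<le> ereal ?w * perimeter E" if "s \<ge> 1" "perimeter E < \<infinity>" for s
    by (rule Limsup_ratio_le[OF assms(2,3) that])
  have "((ratio s E) \<longlongrightarrow> ereal ?w * perimeter E) (at_right 0)" if "s > 1" "perimeter E < \<infinity>" for s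
    by (rule Liminf_eq_Limsup)
       (use lower[of s] upper[of s] le[of s] that in \<open>auto intro: antisym order_trans\<close>)
  then show ?thesis
    using lower upper le fin M by (meson order_trans)
qed

end
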